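(* Let $T>0$, $0<\rho<2$, $A\in\mathbb C^{N\times N}$, $B\in\mathbb C^{N\times\ell}$. Assume: (i) $\operatorname{rank}[\lambda I_N-A\mid B]=N$ for all $\lambda\in\sigma(A)$; (ii) $\lambda_{j,m}^{\sigma}\ne\lambda_{k,n}^{\eta}$ whenever $(j,m)\ne(k,n)$, for all $1\le j,k\le p_0$, $m,n\ge1$, $\sigma,\eta\in\{+,-\}$; (iii) $(\lambda_{j,m}^{\sigma})^2+\gamma_j\ne0$ for all $1\le j\le p_0$, $m\ge1$, $\sigma\in\Sigma_{j,m}$. Then for every $(u^0,u^1)\in\mathcal X^3\times\mathcal X^1$ there exist vectors $\zeta_{j,q,m}^{\sigma}\in\mathbb C^\ell$, indexed by $1\le j\le p_0$, $m\ge1$, $\sigma\in\Sigma_{j,m}$, $0\le q<d_{j,m}^{\sigma}$, such that every $f\in H_0^2(0,T;\mathbb C^\ell)$ satisfying $$\int_0^T\bigl(f''(t)+\gamma_jf(t)\bigr)E_{j,q,m}^{\sigma}(t)\,dt=\zeta_{j,q,m}^{\sigma}$$ for every such $(j,q,m,\sigma)$ also satisfies the terminal conditions $$a_{j,k,s,m}(T)=-b_{j,k,s,m}(T),\qquad a'_{j,k,s,m}(T)=-b'_{j,k,s,m}(T)$$ for all $1\le j\le p_0$, $1\le k\le g_j$, $1\le s\le r_{j,k}$, $m\ge1$. Moreover, for some constants $C>0$, $P\ge0$ and $c>0$ (independent of the indices and of $(u^0,u^1)$), $$|\zeta_{j,q,m}^{\sigma}|\le C(1+m)^Pe^{-cm^2T}\mathcal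 E_0,\qquad \mathcal E_0=\|u^0\|_{\mathcal X^3}+\|u^1\|_{\mathcal X^1}.$$
   Context: $\varphi_m(x)=\sqrt{2/\pi}\,\sin(mx)$, $m\ge1$; $L=-\partial_{xx}$ is the Dirichlet Laplacian in $L^2(0,\pi)$, $L\varphi_m=m^2\varphi_m$. For $s\in\mathbb R$, $X^s=\{y=\sum_{m\ge1}y_m\varphi_m:\ \|y\|_{X^s}^2:=\sum_m m^{2s}|y_m|^2<\infty\}$, $\mathcal X^s:=(X^s)^N$. $H_0^2(0,T;\mathbb C^\ell)=\{f\in H^2(0,T;\mathbb C^\ell): f(0)=f'(0)=f(T)=f'(T)=0\}$. Spectral data: $\sigma(A)=\{\gamma_1,\dots,\gamma_{p_0}\}$ are the distinct eigenvalues of $A$; $g_j$ is the geometric multiplicity of $\gamma_j$, $r_{j,1},\dots,r_{j,g_j}$ its Jordan-block sizes, $\nu_j=\max_kr_{j,k}$. The temporal roots $\lambda_{j,m}^{\pm}=\tfrac12\bigl(-\rho m^2\pm\sqrt{\rho^2m^4-4(m^4+\gamma_j)}\bigr)$ are the two roots of $z^2+\rho m^2z+m^4+\gamma_j=0$. $\mathcal D_\rho=\{(j,m):\lambda_{j,m}^+=\lambda_{j,m}^-\}$, and for $(j,m)\in\mathcal D_\rho$, $\lambda_{j,m}^{\mathrm c}:=\lambda_{j,m}^{\pm}=-\rho m^2/2$. $\Sigma_{j,m}=\{+,-\}$ if $(j,m)\notin\mathcal D_\rho$, $\Sigma_{j,m}=\{\mathrm c\}$ if $(j,m)\in\mathcal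 D_\rho$; $d_{j,m}^{\pm}=\nu_j$, $d_{j,m}^{\mathrm c}=2\nu_j$. $E_{j,q,m}^{\sigma}(t)=(T-t)^qe^{\lambda_{j,m}^{\sigma}(T-t)}$. Modal coefficients: the Hermitian product is linear in the first argument. Fix a basis $\{\psi_{j,k,s}\}_{1\le j\le p_0,\,1\le k\le g_j,\,1\le s\le r_{j,k}}$ of $\mathbb C^N$ of adjoint Jordan chains, $A^*\psi_{j,k,s}=\overline{\gamma_j}\psi_{j,k,s}+\psi_{j,k,s-1}$, $\psi_{j,k,0}=0$, and set $\beta_{j,k,s}=B^*\psi_{j,k,s}$ ($\beta_{j,k,0}=0$), $x_m=(-1)^{m+1}\sqrt{2/\pi}\,m^{-1}$, $\mathcal P_{j,m}=\partial_t^2+\rho m^2\partial_t+m^4+\gamma_j$. Given $f$ and $(u^0,u^1)$, $a_{j,k,s,m}$ and $b_{j,k,s,m}$ are the scalar functions on $[0,T]$ defined recursively in $s$ by $$\mathcal P_{j,m}a_{j,k,s,m}=-a_{j,k,s-1,m}-x_m\bigl(\beta_{j,k,s}^*(f''+\gamma_jf)+\beta_{j,k,s-1}^*f\bigr),\qquad \mathcal P_{j,m}b_{j,k,s,m}=-b_{j,k,s-1,m},$$ with $a_{j,k,0,m}=b_{j,k,0,m}=0$, $a_{j,k,s,m}(0)=a'_{j,k,s,m}(0)=0$, and $b_{j,k,s,m}(0)=u^0_{j,k,s,m}$, $b'_{j,k,s,m}(0)=u^1_{j,k,s,m}$, where $u^r_{j,k,s,m}=\int_0^\pi\langle u^r(x),\psi_{j,k,s}\rangle_{\mathbb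 C^N}\varphi_m(x)\,dx$. (They are the coefficients of the control-driven and free parts of the solution $v$ of $v_{tt}+L^2v+\rho Lv_t+Av=-\frac{x}{\pi}(Bf''+ABf)$, $(v(0),v_t(0))=(u^0,u^1)$, with homogeneous hinged boundary conditions.) *)

theory Defs
  imports "HOL-Analysis.Analysis"
begin

subsection \<open>Linear algebra\<close>

text \<open>Hermitian product, linear in the first argument; thus \<open>herm v w\<close> is \<open>w\<^sup>* v\<close>.\<close>

definition herm :: "complex ^ 'a \<Rightarrow> complex ^ 'a \<Rightarrow> complex" where
  "herm v w = (\<Sum>i\<in>UNIV. v $ i * cnj (w $ i))"

definition conj_transpose :: "complex ^ 'a ^ 'b \<Rightarrow> complex ^ 'b ^ 'a" where
  "conj_transpose M = (\<chi> i j. cnj (M $ j $ i))"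

definition block_row :: "complex ^ 'a ^ 'c \<Rightarrow> complex ^ 'b ^ 'c \<Rightarrow> complex ^ ('a + 'b) ^ 'c" where
  "block_row M K = (\<chi> i k. case k of Inl j \<Rightarrow> M $ i $ j | Inr j \<Rightarrow> K $ i $ j)"

definition eigenvalues :: "complex ^ 'n ^ 'n \<Rightarrow> complex set" where
  "eigenvalues M = {\<mu>. \<exists>v. v \<noteq> 0 \<and> M *v v = \<mu> *s v}"

definition geom_mult :: "complex ^ 'n ^ 'n \<Rightarrow> complex \<Rightarrow> nat" where
  "geom_mult M \<mu> = vec.dim {v. M *v v = \<mu> *s v}"

definition chain_indices :: "nat \<Rightarrow> (nat \<Rightarrow> nat) \<Rightarrow> (nat \<Rightarrow> nat \<Rightarrow> nat) \<Rightarrow> (nat \<times> nat \<times> nat) set" where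
  "chain_indices p g r = {(j, k, s). j \<in> {1..p} \<and> k \<in> {1..g j} \<and> s \<in> {1..r j k}}"

definition jordan_chain_basis ::
  "complex ^ 'n ^ 'n \<Rightarrow> nat \<Rightarrow> (nat \<Rightarrow> complex) \<Rightarrow> (nat \<Rightarrow> nat) \<Rightarrow> (nat \<Rightarrow> nat \<Rightarrow> nat) \<Rightarrow>
   (nat \<Rightarrow> nat \<Rightarrow> nat \<Rightarrow> complex ^ 'n) \<Rightarrow> bool" where
  "jordan_chain_basis M p \<mu> g r \<psi> \<longleftrightarrow>
     (\<forall>j\<in>{1..p}. \<forall>k\<in>{1..g j}. \<psi> j k 0 = 0) \<and>
     (\<forall>(j, k, s)\<in>chain_indices p g r. M *v \<psi> j k s = \<mu> j *s \<psi> j k s + \<psi> j k (s - 1)) \<and>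
     inj_on (\<lambda>(j, k, s). \<psi> j k s) (chain_indices p g r) \<and>
     vec.independent ((\<lambda>(j, k, s). \<psi> j k s) ` chain_indices p g r) \<and>
     vec.span ((\<lambda>(j, k, s). \<psi> j k s) ` chain_indices p g r) = UNIV"

text \<open>
  \<open>\<gamma> 1, \<dots>, \<gamma> p\<close> enumerate the distinct eigenvalues of \<open>M\<close>, \<open>g j\<close> is the geometric
  multiplicity of \<open>\<gamma> j\<close>, and \<open>r j 1, \<dots>, r j (g j)\<close> are the sizes of its Jordan blocks,
  that is, the lengths of the chains in some Jordan basis of \<open>M\<close>.
\<close>

definition jordan_structure ::
  "complex ^ 'n ^ 'n \<Rightarrow> nat \<Rightarrow> (nat \<Rightarrow> complex) \<Rightarrow> (nat \<Rightarrow> nat) \<Rightarrow> (nat \<Rightarrow> nat \<Rightarrow> nat) \<Rightarrow> bool" where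
  "jordan_structure M p \<gamma> g r \<longleftrightarrow>
     bij_betw \<gamma> {1..p} (eigenvalues M) \<and>
     (\<forall>j\<in>{1..p}. g j = geom_mult M (\<gamma> j)) \<and>
     (\<forall>j\<in>{1..p}. \<forall>k\<in>{1..g j}. r j k \<ge> 1) \<and>
     (\<exists>e. jordan_chain_basis M p \<gamma> g r e)"

definition max_block :: "(nat \<Rightarrow> nat) \<Rightarrow> (nat \<Rightarrow> nat \<Rightarrow> nat) \<Rightarrow> nat \<Rightarrow> nat" where
  "max_block g r j = Max (r j ` {1..g j})"


subsection \<open>Temporal roots\<close>

datatype root_label = Plus | Minus | Crit

fun temporal_root :: "real \<Rightarrow> complex \<Rightarrow> nat \<Rightarrow> root_label \<Rightarrow> complex" where
  "temporal_root \<rho> \<gamma> m Plus =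
     (- of_real \<rho> * of_nat m ^ 2
        + csqrt (of_real \<rho> ^ 2 * of_nat m ^ 4 - 4 * (of_nat m ^ 4 + \<gamma>))) / 2"
| "temporal_root \<rho> \<gamma> m Minus =
     (- of_real \<rho> * of_nat m ^ 2
        - csqrt (of_real \<rho> ^ 2 * of_nat m ^ 4 - 4 * (of_nat m ^ 4 + \<gamma>))) / 2"
| "temporal_root \<rho> \<gamma> m Crit = - of_real \<rho> * of_nat m ^ 2 / 2"

definition root_labels :: "real \<Rightarrow> complex \<Rightarrow> nat \<Rightarrow> root_label set" where
  "root_labels \<rho> \<gamma> m =
     (if temporal_root \<rho> \<gamma> m Plus = temporal_root \<rho> \<gamma> m Minus then {Crit} else {Plus, Minus})"

text \<open>The number of moment functions attached to a root, where \<open>\<nu>\<close> is the largest block size.\<close>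

fun moment_count :: "nat \<Rightarrow> root_label \<Rightarrow> nat" where
  "moment_count \<nu> Plus = \<nu>"
| "moment_count \<nu> Minus = \<nu>"
| "moment_count \<nu> Crit = 2 * \<nu>"

definition moment_fun :: "real \<Rightarrow> complex \<Rightarrow> nat \<Rightarrow> real \<Rightarrow> complex" where
  "moment_fun T z q t = of_real ((T - t) ^ q) * exp (z * of_real (T - t))"


subsection \<open>Function spaces\<close>

definition L2_on :: "real set \<Rightarrow> (real \<Rightarrow> 'a::euclidean_space) \<Rightarrow> bool" where
  "L2_on S f \<longleftrightarrow> f \<in> borel_measurable (lebesgue_on S) \<and>
     integrable (lebesgue_on S) (\<lambda>x. (norm (f x))\<^sup>2)"

definition sine_mode :: "nat \<Rightarrow> real \<Rightarrow> real" where
  "sine_mode m x = sqrt (2 / pi) * sin (real m * x)"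

definition sine_coeff :: "(real \<Rightarrow> complex) \<Rightarrow> nat \<Rightarrow> complex" where
  "sine_coeff y m = (LINT x|lebesgue_on {0..pi}. y x * of_real (sine_mode m x))"

text \<open>
  The spaces \<open>X\<^sup>s\<close> for \<open>s \<ge> 0\<close>, whose elements are functions in \<open>L\<^sup>2(0, \<pi>)\<close>; the series
  of \<open>y\<close> in the orthonormal sine modes converges in \<open>L\<^sup>2(0, \<pi>)\<close>.
\<close>

definition X_space :: "real \<Rightarrow> (real \<Rightarrow> complex) set" where
  "X_space s = {y. L2_on {0..pi} y \<and>
     (\<lambda>M. LINT x|lebesgue_on {0..pi}.
        (cmod (y x - (\<Sum>m=1..M. sine_coeff y m * of_real (sine_mode m x))))\<^sup>2) \<longlonglongrightarrow> 0 \<and>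
     summable (\<lambda>m. real (Suc m) powr (2 * s) * (cmod (sine_coeff y (Suc m)))\<^sup>2)}"

definition X_norm :: "real \<Rightarrow> (real \<Rightarrow> complex) \<Rightarrow> real" where
  "X_norm s y = sqrt (\<Sum>m. real (Suc m) powr (2 * s) * (cmod (sine_coeff y (Suc m)))\<^sup>2)"

definition XN_space :: "real \<Rightarrow> (real \<Rightarrow> complex ^ 'n) set" where
  "XN_space s = {u. \<forall>i. (\<lambda>x. u x $ i) \<in> X_space s}"

definition XN_norm :: "real \<Rightarrow> (real \<Rightarrow> complex ^ 'n) \<Rightarrow> real" where
  "XN_norm s u = sqrt (\<Sum>i\<in>UNIV. (X_norm s (\<lambda>x. u x $ i))\<^sup>2)"

text \<open>
  \<open>H2_derivs T f f1 f2\<close>: \<open>f \<in> H\<^sup>2(0, T)\<close>, represented by its continuously differentiable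
  representative on \<open>[0, T]\<close>, with derivative \<open>f1\<close>, which is absolutely continuous, and second
  (weak) derivative \<open>f2 \<in> L\<^sup>2(0, T)\<close>, determined up to null sets.
\<close>

definition H2_derivs ::
  "real \<Rightarrow> (real \<Rightarrow> 'a::euclidean_space) \<Rightarrow> (real \<Rightarrow> 'a) \<Rightarrow> (real \<Rightarrow> 'a) \<Rightarrow> bool" where
  "H2_derivs T f f1 f2 \<longleftrightarrow>
     L2_on {0..T} f2 \<and>
     (\<forall>t\<in>{0..T}. f1 t = f1 0 + (LINT \<tau>|lebesgue_on {0..t}. f2 \<tau>)) \<and>
     (\<forall>t\<in>{0..T}. (f has_vector_derivative f1 t) (at t within {0..T}))"

definition H20_derivs ::
  "real \<Rightarrow> (real \<Rightarrow> 'a::euclidean_space) \<Rightarrow> (real \<Rightarrow> 'a) \<Rightarrow> (real \<Rightarrow> 'a) \<Rightarrow> bool" where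
  "H20_derivs T f f1 f2 \<longleftrightarrow>
     H2_derivs T f f1 f2 \<and> f 0 = 0 \<and> f1 0 = 0 \<and> f T = 0 \<and> f1 T = 0"


subsection \<open>Modal coefficients\<close>

text \<open>
  \<open>y \<in> H\<^sup>2(0, T)\<close>, with derivative \<open>y1\<close>, solves
  \<open>y'' + \<rho> m\<^sup>2 y' + (m\<^sup>4 + \<gamma>) y = h\<close>, \<open>y(0) = c0\<close>, \<open>y'(0) = c1\<close>. The right-hand side is in
  general only square integrable in time, so the equation holds almost everywhere.
\<close>

definition modal_ivp ::
  "real \<Rightarrow> real \<Rightarrow> complex \<Rightarrow> nat \<Rightarrow> (real \<Rightarrow> complex) \<Rightarrow> complex \<Rightarrow> complex \<Rightarrow>
   (real \<Rightarrow> complex) \<Rightarrow> (real \<Rightarrow> complex) \<Rightarrow> bool" where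
  "modal_ivp T \<rho> \<gamma> m h c0 c1 y y1 \<longleftrightarrow>
     (\<exists>y2. H2_derivs T y y1 y2 \<and>
        (AE t in lebesgue_on {0..T}.
           y2 t + of_real \<rho> * of_nat m ^ 2 * y1 t + (of_nat m ^ 4 + \<gamma>) * y t = h t)) \<and>
     y 0 = c0 \<and> y1 0 = c1"

text \<open>Coefficient of \<open>x / \<pi>\<close> on the \<open>m\<close>-th sine mode.\<close>

definition lift_coeff :: "nat \<Rightarrow> real" where
  "lift_coeff m = (- 1) ^ (m + 1) * sqrt (2 / pi) / real m"

definition modal_coeff :: "(real \<Rightarrow> complex ^ 'n) \<Rightarrow> complex ^ 'n \<Rightarrow> nat \<Rightarrow> complex" where
  "modal_coeff u w m =
     (LINT x|lebesgue_on {0..pi}. herm (u x) w * of_real (sine_mode m x))"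

text \<open>
  In the next two definitions \<open>a j k s m\<close> and \<open>b j k s m\<close> are the coefficient functions,
  and \<open>a1 j k s m\<close> and \<open>b1 j k s m\<close> their time derivatives.
\<close>

definition control_coeffs ::
  "real \<Rightarrow> real \<Rightarrow> complex ^ 'l ^ 'n \<Rightarrow> nat \<Rightarrow> (nat \<Rightarrow> complex) \<Rightarrow> (nat \<Rightarrow> nat) \<Rightarrow>
   (nat \<Rightarrow> nat \<Rightarrow> nat) \<Rightarrow> (nat \<Rightarrow> nat \<Rightarrow> nat \<Rightarrow> complex ^ 'n) \<Rightarrow>
   (real \<Rightarrow> complex ^ 'l) \<Rightarrow> (real \<Rightarrow> complex ^ 'l) \<Rightarrow>
   (nat \<Rightarrow> nat \<Rightarrow> nat \<Rightarrow> nat \<Rightarrow> real \<Rightarrow> complex) \<Rightarrow>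
   (nat \<Rightarrow> nat \<Rightarrow> nat \<Rightarrow> nat \<Rightarrow> real \<Rightarrow> complex) \<Rightarrow> bool" where
  "control_coeffs T \<rho> B p \<gamma> g r \<psi> f f2 a a1 \<longleftrightarrow>
     (let \<beta> = (\<lambda>j k s. conj_transpose B *v \<psi> j k s) in
      \<forall>j\<in>{1..p}. \<forall>k\<in>{1..g j}. \<forall>m\<ge>1.
        (\<forall>t\<in>{0..T}. a j k 0 m t = 0) \<and>
        (\<forall>s\<in>{1..r j k}.
           modal_ivp T \<rho> (\<gamma> j) m
             (\<lambda>t. - a j k (s - 1) m t
                  - of_real (lift_coeff m) *
                    (herm (f2 t + \<gamma> j *s f t) (\<beta> j k s) + herm (f t) (\<beta> j k (s - 1))))
             0 0 (a j k s m) (a1 j k s m)))"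

definition free_coeffs ::
  "real \<Rightarrow> real \<Rightarrow> nat \<Rightarrow> (nat \<Rightarrow> complex) \<Rightarrow> (nat \<Rightarrow> nat) \<Rightarrow>
   (nat \<Rightarrow> nat \<Rightarrow> nat) \<Rightarrow> (nat \<Rightarrow> nat \<Rightarrow> nat \<Rightarrow> complex ^ 'n) \<Rightarrow>
   (real \<Rightarrow> complex ^ 'n) \<Rightarrow> (real \<Rightarrow> complex ^ 'n) \<Rightarrow>
   (nat \<Rightarrow> nat \<Rightarrow> nat \<Rightarrow> nat \<Rightarrow> real \<Rightarrow> complex) \<Rightarrow>
   (nat \<Rightarrow> nat \<Rightarrow> nat \<Rightarrow> nat \<Rightarrow> real \<Rightarrow> complex) \<Rightarrow> bool" where
  "free_coeffs T \<rho> p \<gamma> g r \<psi> u0 u1 b b1 \<longleftrightarrow>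
     (\<forall>j\<in>{1..p}. \<forall>k\<in>{1..g j}. \<forall>m\<ge>1.
        (\<forall>t\<in>{0..T}. b j k 0 m t = 0) \<and>
        (\<forall>s\<in>{1..r j k}.
           modal_ivp T \<rho> (\<gamma> j) m (\<lambda>t. - b j k (s - 1) m t)
             (modal_coeff u0 (\<psi> j k s) m) (modal_coeff u1 (\<psi> j k s) m)
             (b j k s m) (b1 j k s m)))"

end

theory Submission
  imports Defs "HOL-Complex_Analysis.Cauchy_Integral_Formula" "HOL-Library.Landau_Symbols"
begin

text \<open>
  The key point is that the moments need not be found by solving a linear system in the moments of
  one root at a time: they are the derivatives, at the roots, of one explicit function.

  Write \<open>\<L> y (z)\<close> for the integral of \<open>y(t) exp (z (T - t))\<close> over \<open>[0, T]\<close>. With \<open>\<Phi> = f'' + \<gamma>\<^sub>j f\<close>, the moments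
  of the theorem at a root \<open>\<lambda>\<close> are exactly the derivatives of \<open>\<L> \<Phi>\<close> at \<open>\<lambda>\<close>
  (\<open>exp_moment_jet\<close>), and \<open>\<L> \<Phi> (z) = (z\<^sup>2 + \<gamma>\<^sub>j) \<L> f (z)\<close> because \<open>f\<close> and \<open>f'\<close> vanish
  at both ends (\<open>exp_moment_control\<close>). Let \<open>p(z) = z\<^sup>2 + \<rho> m\<^sup>2 z + m\<^sup>4 + \<gamma>\<^sub>j\<close>. Integrating by parts, each
  modal equation for \<open>w\<^sub>s = a\<^sub>s + b\<^sub>s\<close> becomes
  \<open>p \<L> w\<^sub>s = - \<L> w\<^sub>s\<^sub>-\<^sub>1 - x\<^sub>m (\<beta>\<^sub>s\<^sup>* \<L> \<Phi> + \<beta>\<^sub>s\<^sub>-\<^sub>1\<^sup>* \<L> f) + exp (z T) U\<^sub>s(z) - \<omega>\<^sub>s(z)\<close>,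
  where \<open>U\<^sub>s\<close> and \<open>\<omega>\<^sub>s\<close> are the polynomials \<open>c\<^sub>1 + (z + \<rho> m\<^sup>2) c\<^sub>0\<close> formed from the initial and from
  the terminal state (\<open>exp_moment_modal_ivp\<close>). The terminal conditions say that every \<open>\<omega>\<^sub>s\<close> is zero.

  Adding the equations with weights \<open>(-p)\<^sup>s\<^sup>-\<^sup>1\<close> makes the left-hand sides telescope. So, once
  \<open>\<omega>\<^sub>1, \<dots>, \<omega>\<^sub>s\<^sub>-\<^sub>1\<close> are known to be zero, \<open>\<omega>\<^sub>s\<close> vanishes at the roots to the order of \<open>p\<close> as soon as the
  weighted sum of the data and control terms vanishes there to the order of \<open>p\<^sup>s\<close>; since \<open>\<omega>\<^sub>s\<close> has degree at
  most one and \<open>p\<close> has two roots with multiplicity, \<open>\<omega>\<^sub>s = 0\<close>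
  (\<open>terminal_symbol_bigo\<close>, \<open>state_symbol_eq_0\<close>). Modulo powers of \<open>p\<close>, the requirement on the control is
  that \<open>(1 - p / (z\<^sup>2 + \<gamma>\<^sub>j)) \<L> \<Phi>\<close> agree with \<open>exp (z T) / x\<^sub>m\<close> times \<open>\<Sum>\<^sub>n (-p)\<^sup>n Y\<^sub>n(z)\<close>, where
  \<open>\<Sum>\<^sub>i\<^sub>\<le>\<^sub>n \<beta>\<^sub>n\<^sub>+\<^sub>1\<^sub>-\<^sub>i\<^sup>* Y\<^sub>i = U\<^sub>n\<^sub>+\<^sub>1\<close> along each Jordan chain. This triangular system is solved
  recursively (\<open>chain_solution\<close>): by the rank condition the vectors \<open>\<beta>\<^sub>k\<^sub>,\<^sub>1\<close> belonging to one
  eigenvalue are linearly independent (\<open>observed_eigenvectors_independent\<close>), hence have a dual family.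
  Since \<open>p - (z\<^sup>2 + \<gamma>\<^sub>j) = \<rho> m\<^sup>2 z + m\<^sup>4\<close>, the function prescribed for \<open>\<L> \<Phi>\<close> is
  \<open>moment_symbol\<close>, whose only pole avoids the roots by nonresonance. The congruences refer to the order
  of vanishing only, so simple and double roots are treated alike.

  For the bound, the factor \<open>exp (z T)\<close> supplies the decay: the real parts of the roots are at most
  \<open>- \<rho> m\<^sup>2 / 2\<close> plus a constant (\<open>temporal_root_Re_le\<close>). The pole keeps a distance from the roots that
  does not shrink with \<open>m\<close> (\<open>pole_gap\<close>), so all other factors grow polynomially on discs of fixed radius
  about the roots, and Cauchy's inequality bounds the derivatives (\<open>moment_target_bound\<close>).
\<close>

section \<open>Integration by parts for absolutely continuous functions\<close>

text \<open>
  Over a partition into \<open>N\<close> equal steps the increments of \<open>D\<close> add up to at most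
  \<open>C (T / N) (\<Psi> T - \<Psi> 0)\<close>, and \<open>N\<close> is arbitrary.
\<close>

lemma norm_increment_square_imp_const:
  fixes D :: "real \<Rightarrow> complex" and \<Psi> :: "real \<Rightarrow> real"
  assumes "0 \<le> T"
    and D: "\<And>s t. 0 \<le> s \<Longrightarrow> s \<le> t \<Longrightarrow> t \<le> T \<Longrightarrow> norm (D t - D s) \<le> C * (t - s) * (\<Psi> t - \<Psi> s)"
  shows "D T = D 0"
proof -
  have bound: "norm (D T - D 0) \<le> C * T * (\<Psi> T - \<Psi> 0) * inverse (real (Suc N))" for N
  proof -
    define x where "x i = real i * T / real (Suc N)" for i
    have x_ends: "x 0 = 0" "x (Suc N) = T"
      unfolding x_def by (simp, metis nonzero_mult_div_cancel_left of_nat_eq_0_iff nat.simps(3))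
    have x_step: "x (Suc i) - x i = T / real (Suc N)" for i
      unfolding x_def diff_divide_distrib[symmetric] by (simp add: algebra_simps)
    have x_mono: "x i \<le> x (Suc i)" for i
      using x_step[of i] \<open>0 \<le> T\<close> by (smt (verit) divide_nonneg_nonneg of_nat_0_le_iff)
    have x_range: "0 \<le> x i" for i
      using \<open>0 \<le> T\<close> by (simp add: x_def)
    have x_le: "x (Suc i) \<le> T" if "i \<le> N" for i
    proof -
      have "real (Suc i) * T \<le> real (Suc N) * T"
        using that \<open>0 \<le> T\<close> by (intro mult_right_mono) auto
      then show ?thesis by (simp add: x_def field_simps)
    qed
    have "D T - D 0 = (\<Sum>i<Suc N. D (x (Suc i)) - D (x i))"
      using sum_lessThan_telescope[of "\<lambda>i. D (x i)" "Suc N"] by (simp only: x_ends)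
    also have "norm \<dots> \<le> (\<Sum>i<Suc N. norm (D (x (Suc i)) - D (x i)))"
      by (rule norm_sum)
    also have "\<dots> \<le> (\<Sum>i<Suc N. C * (T / real (Suc N)) * (\<Psi> (x (Suc i)) - \<Psi> (x i)))"
    proof (rule sum_mono)
      fix i assume "i \<in> {..<Suc N}"
      then have "i \<le> N" by simp
      from D[OF x_range x_mono x_le[OF this]]
      show "norm (D (x (Suc i)) - D (x i)) \<le> C * (T / real (Suc N)) * (\<Psi> (x (Suc i)) - \<Psi> (x i))"
        unfolding x_step .
    qed
    also have "\<dots> = C * (T / real (Suc N)) * (\<Psi> T - \<Psi> 0)"
      using sum_lessThan_telescope[of "\<lambda>i. \<Psi> (x i)" "Suc N"]
      by (simp only: sum_distrib_left[symmetric] x_ends)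
    finally show ?thesis
      by (simp add: field_simps)
  qed
  have "(\<lambda>N. C * T * (\<Psi> T - \<Psi> 0) * inverse (real (Suc N))) \<longlonglongrightarrow> C * T * (\<Psi> T - \<Psi> 0) * 0"
    by (intro tendsto_intros LIMSEQ_inverse_real_of_nat)
  then have "norm (D T - D 0) \<le> C * T * (\<Psi> T - \<Psi> 0) * 0"
    by (rule LIMSEQ_le_const) (use bound in blast)
  then show ?thesis by simp
qed

lemma L2_on_imp_integrable:
  fixes f :: "real \<Rightarrow> 'a::euclidean_space"
  assumes "L2_on {a..b} f"
  shows "integrable (lebesgue_on {a..b}) f"
proof (rule Bochner_Integration.integrable_bound)
  show "integrable (lebesgue_on {a..b}) (\<lambda>x. 1 + (norm (f x))\<^sup>2)"
    using assms unfolding L2_on_def by (intro Bochner_Integration.integrable_add) auto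
  show "f \<in> borel_measurable (lebesgue_on {a..b})"
    using assms by (simp add: L2_on_def)
  have "x \<le> 1 + x\<^sup>2" for x :: real
    using sum_squares_ge_zero[of "x - 1" "x"] by (sos)
  then show "AE x in lebesgue_on {a..b}. norm (f x) \<le> norm (1 + (norm (f x))\<^sup>2)"
    by (intro always_eventually allI) (smt (verit, best) real_norm_def zero_le_power2)
qed

lemma integrable_continuous_mult:
  fixes e w :: "real \<Rightarrow> complex"
  assumes e: "continuous_on {a..b} e" and w: "integrable (lebesgue_on {a..b}) w"
  shows "integrable (lebesgue_on {a..b}) (\<lambda>t. e t * w t)"
proof -
  obtain M where M: "\<And>t. t \<in> {a..b} \<Longrightarrow> norm (e t) \<le> M"
    using compact_continuous_image[OF e compact_Icc, THEN compact_imp_bounded]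
    unfolding bounded_iff by blast
  show ?thesis
  proof (rule Bochner_Integration.integrable_bound)
    show "integrable (lebesgue_on {a..b}) (\<lambda>t. M * norm (w t))"
      using w by simp
    show "(\<lambda>t. e t * w t) \<in> borel_measurable (lebesgue_on {a..b})"
      using continuous_imp_measurable_on_sets_lebesgue[OF e] w by auto
    show "AE t in lebesgue_on {a..b}. norm (e t * w t) \<le> norm (M * norm (w t))"
    proof (rule AE_I2)
      fix t assume "t \<in> space (lebesgue_on {a..b})"
      then have "norm (e t) * norm (w t) \<le> M * norm (w t)"
        by (intro mult_right_mono M) auto
      then show "norm (e t * w t) \<le> norm (M * norm (w t))"
        by (simp add: norm_mult)
    qed
  qed
qed

text \<open>
  The factor \<open>w\<close> is only an indefinite integral, so it need not be differentiable everywhere. Instead of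
  differentiating, one estimates the increments over \<open>[s, t]\<close> of the difference \<open>D\<close> between the two
  sides: \<open>w\<close> varies there by at most the integral of \<open>\<bar>w'\<bar>\<close> and \<open>e\<close> by \<open>O(t - s)\<close>, and the
  increment of \<open>D\<close> is controlled by the product of the two.
\<close>

lemma integration_by_parts_abs_cont:
  fixes e e' w w' :: "real \<Rightarrow> complex"
  assumes "0 \<le> T"
    and w': "integrable (lebesgue_on {0..T}) w'"
    and w: "\<And>t. t \<in> {0..T} \<Longrightarrow> w t = w 0 + (LINT \<tau>|lebesgue_on {0..t}. w' \<tau>)"
    and e: "\<And>t. t \<in> {0..T} \<Longrightarrow> (e has_vector_derivative e' t) (at t within {0..T})"
    and e': "continuous_on {0..T} e'"
  shows "(LINT t|lebesgue_on {0..T}. e t * w' t)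
           = e T * w T - e 0 * w 0 - (LINT t|lebesgue_on {0..T}. e' t * w t)"
proof -
  have cont_e: "continuous_on {0..T} e"
    using e by (meson continuous_on_vector_derivative)
  have sub: "integrable (lebesgue_on {s..t}) h"
    if "integrable (lebesgue_on {0..T}) h" "0 \<le> s" "t \<le> T" for s t and h :: "real \<Rightarrow> complex"
    using that by (intro integrable_subinterval[OF that(1)]) auto
  have L: "(LINT \<tau>|lebesgue_on {s..t}. h \<tau>) = integral {s..t} h" "h integrable_on {s..t}"
      "(\<lambda>x. norm (h x)) integrable_on {s..t}"
    if "integrable (lebesgue_on {0..T}) h" "0 \<le> s" "t \<le> T" for s t and h :: "real \<Rightarrow> complex"
    using sub[OF that] by (auto intro!: lebesgue_integral_eq_integral integrable_on_lebesgue_on)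
  have cont_w: "continuous_on {0..T} w"
  proof -
    have "continuous_on {0..T} (\<lambda>t. w 0 + integral {0..t} w')"
      using L(2)[OF w', of 0 T] by (intro continuous_intros indefinite_integral_continuous_1) auto
    moreover have "w 0 + integral {0..t} w' = w t" if "t \<in> {0..T}" for t
      using w[OF that] L(1)[OF w', of 0 t] that by simp
    ultimately show ?thesis
      by (rule continuous_on_eq)
  qed
  have w_diff: "w t - w s = integral {s..t} w'" if "0 \<le> s" "s \<le> t" "t \<le> T" for s t
    using w[of s] w[of t] that L(1)[OF w', of 0]
      Henstock_Kurzweil_Integration.integral_combine[of 0 s t w'] L(2)[OF w', of 0 t]
    by (auto simp: algebra_simps)
  have e_diff: "(e' has_integral e t - e s) {s..t}" if "0 \<le> s" "s \<le> t" "t \<le> T" for s t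
    using that
    by (intro fundamental_theorem_of_calculus)
       (auto intro: has_vector_derivative_within_subset[OF e])
  obtain M where M: "\<And>t. t \<in> {0..T} \<Longrightarrow> norm (e' t) \<le> M"
    using compact_continuous_image[OF e' compact_Icc, THEN compact_imp_bounded]
    unfolding bounded_iff by blast
  have "0 \<le> M" using M[of 0] \<open>0 \<le> T\<close> by (smt (verit) atLeastAtMost_iff norm_ge_zero)
  have ew': "integrable (lebesgue_on {0..T}) (\<lambda>t. e t * w' t)"
    by (rule integrable_continuous_mult[OF cont_e w'])
  have e'w: "integrable (lebesgue_on {0..T}) (\<lambda>t. e' t * w t)"
    by (intro continuous_imp_integrable_real continuous_intros e' cont_w)
  (* D T = D 0 is the claim; Psi measures the variation of w. *)
  define D where "D t = integral {0..t} (\<lambda>\<tau>. e \<tau> * w' \<tau>) - e t * w t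
      + integral {0..t} (\<lambda>\<tau>. e' \<tau> * w \<tau>)" for t
  define \<Psi> where "\<Psi> t = integral {0..t} (\<lambda>\<tau>. norm (w' \<tau>))" for t
  have "D T = D 0"
  proof (rule norm_increment_square_imp_const[OF \<open>0 \<le> T\<close>])
    fix s t assume st: "0 \<le> s" "s \<le> t" "t \<le> T"
    have V: "\<Psi> t - \<Psi> s = integral {s..t} (\<lambda>\<tau>. norm (w' \<tau>))"
      using st L(3)[OF w', of 0 t] 
        Henstock_Kurzweil_Integration.integral_combine[of 0 s t "\<lambda>\<tau>. norm (w' \<tau>)"]
      by (auto simp: \<Psi>_def algebra_simps)
    have e_lip: "norm (e \<tau> - e t) \<le> M * (t - s)" if "s \<le> \<tau>" "\<tau> \<le> t" for \<tau>
    proof -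
      have "norm (e t - e \<tau>) \<le> M * (t - \<tau>)"
        using has_integral_bound[OF \<open>0 \<le> M\<close> e_diff[of \<tau> t, folded cbox_interval]] M that st by auto
      also have "\<dots> \<le> M * (t - s)"
        using that \<open>0 \<le> M\<close> by (intro mult_left_mono) auto
      finally show ?thesis by (simp add: norm_minus_commute)
    qed
    have w_var: "norm (w \<tau> - w s) \<le> \<Psi> t - \<Psi> s" if "s \<le> \<tau>" "\<tau> \<le> t" for \<tau>
    proof -
      have "norm (w \<tau> - w s) \<le> integral {s..\<tau>} (\<lambda>x. norm (w' x))"
        unfolding w_diff[OF st(1) that(1) order.trans[OF that(2) st(3)]]
        using L[OF w', of s \<tau>] st that by (intro integral_norm_bound_integral) auto
      also have "\<dots> \<le> integral {s..t} (\<lambda>x. norm (w' x))"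
        using L(3)[OF w'] st that by (intro integral_subset_le) auto
      finally show ?thesis by (simp add: V)
    qed
    have comb: "integral {0..t} h - integral {0..s} h = integral {s..t} h"
      if "integrable (lebesgue_on {0..T}) h" for h :: "real \<Rightarrow> complex"
      using st L(2)[OF that, of 0 t] Henstock_Kurzweil_Integration.integral_combine[of 0 s t h]
      by (auto simp: algebra_simps)
    have "D t - D s = integral {s..t} (\<lambda>\<tau>. e \<tau> * w' \<tau>) + integral {s..t} (\<lambda>\<tau>. e' \<tau> * w \<tau>)
        - e t * (w t - w s) - (e t - e s) * w s"
      unfolding D_def using comb[OF ew'] comb[OF e'w] by (simp add: algebra_simps)
    also have "\<dots> = integral {s..t} (\<lambda>\<tau>. (e \<tau> - e t) * w' \<tau>) + integral {s..t} (\<lambda>\<tau>. e' \<tau> * (w \<tau> - w s))"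
    proof -
      have "integral {s..t} (\<lambda>\<tau>. (e \<tau> - e t) * w' \<tau>)
          = integral {s..t} (\<lambda>\<tau>. e \<tau> * w' \<tau>) - e t * (w t - w s)"
        unfolding w_diff[OF st] left_diff_distrib
        using L(2)[OF ew', of s t] L(2)[OF w', of s t] st
        by (subst Henstock_Kurzweil_Integration.integral_diff) (auto intro: integrable_on_mult_right)
      moreover have "integral {s..t} (\<lambda>\<tau>. e' \<tau> * (w \<tau> - w s))
          = integral {s..t} (\<lambda>\<tau>. e' \<tau> * w \<tau>) - (e t - e s) * w s"
        unfolding right_diff_distrib
        using L(2)[OF e'w, of s t] e_diff[OF st] st
        by (subst Henstock_Kurzweil_Integration.integral_diff)
           (auto intro: integrable_on_mult_left simp: has_integral_iff)
      ultimately show ?thesis by simp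
    qed
    also have "norm \<dots> \<le> M * (t - s) * (\<Psi> t - \<Psi> s) + M * (t - s) * (\<Psi> t - \<Psi> s)"
    proof (intro norm_triangle_mono)
      have "integrable (lebesgue_on {s..t}) (\<lambda>\<tau>. (e \<tau> - e t) * w' \<tau>)"
        using st by (intro integrable_continuous_mult sub[OF w'] continuous_intros
            continuous_on_subset[OF cont_e]) auto
      then have "norm (integral {s..t} (\<lambda>\<tau>. (e \<tau> - e t) * w' \<tau>))
          \<le> integral {s..t} (\<lambda>\<tau>. M * (t - s) * norm (w' \<tau>))"
        using e_lip L(3)[OF w', of s t] st
        by (intro integral_norm_bound_integral)
           (auto intro!: integrable_on_lebesgue_on mult_right_mono integrable_on_mult_right simp: norm_mult)
      then show "norm (integral {s..t} (\<lambda>\<tau>. (e \<tau> - e t) * w' \<tau>)) \<le> M * (t - s) * (\<Psi> t - \<Psi> s)"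
        by (simp add: V)
      have "(\<lambda>\<tau>. e' \<tau> * (w \<tau> - w s)) integrable_on {s..t}"
        using st by (intro integrable_continuous_real continuous_intros continuous_on_subset[OF e']
            continuous_on_subset[OF cont_w]) auto
      then have "norm (integral {s..t} (\<lambda>\<tau>. e' \<tau> * (w \<tau> - w s)))
          \<le> integral {s..t} (\<lambda>\<tau>. M * (\<Psi> t - \<Psi> s))"
        using w_var M st \<open>0 \<le> M\<close>
        by (intro integral_norm_bound_integral)
           (auto intro!: mult_mono simp: norm_mult)
      then show "norm (integral {s..t} (\<lambda>\<tau>. e' \<tau> * (w \<tau> - w s))) \<le> M * (t - s) * (\<Psi> t - \<Psi> s)"
        using st by (simp add: mult_ac)
    qed
    finally show "norm (D t - D s) \<le> 2 * M * (t - s) * (\<Psi> t - \<Psi> s)"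
      by simp
  qed
  then show ?thesis
    unfolding L(1)[OF ew' order_refl order_refl] L(1)[OF e'w order_refl order_refl]
    by (simp add: D_def algebra_simps)
qed

section \<open>Exponential moments\<close>

text \<open>
  As a function of \<open>z\<close> this is the Laplace transform, over \<open>[0, T]\<close>, of \<open>y\<close> reversed in time.
\<close>

definition exp_moment :: "real \<Rightarrow> (real \<Rightarrow> complex) \<Rightarrow> complex \<Rightarrow> complex" where
  "exp_moment T y z = (LINT t|lebesgue_on {0..T}. exp (z * of_real (T - t)) * y t)"

lemma integrable_exp_mult:
  fixes y :: "real \<Rightarrow> complex"
  assumes "integrable (lebesgue_on {0..T}) y"
  shows "integrable (lebesgue_on {0..T}) (\<lambda>t. exp (z * of_real (T - t)) * y t)"
  by (rule integrable_continuous_mult[OF _ assms]) (intro continuous_intros)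

lemma exp_moment_add:
  assumes "integrable (lebesgue_on {0..T}) y" "integrable (lebesgue_on {0..T}) w"
  shows "exp_moment T (\<lambda>t. y t + w t) z = exp_moment T y z + exp_moment T w z"
  unfolding exp_moment_def distrib_left
  by (intro Bochner_Integration.integral_add integrable_exp_mult assms)

lemma exp_moment_mult: "exp_moment T (\<lambda>t. c * y t) z = c * exp_moment T y z"
  unfolding exp_moment_def by (simp add: mult.left_commute)

lemma exp_moment_minus: "exp_moment T (\<lambda>t. - y t) z = - exp_moment T y z"
  using exp_moment_mult[of T "-1" y z] by simp

lemma exp_moment_diff:
  assumes "integrable (lebesgue_on {0..T}) y" "integrable (lebesgue_on {0..T}) w"
  shows "exp_moment T (\<lambda>t. y t - w t) z = exp_moment T y z - exp_moment T w z"
  unfolding exp_moment_def right_diff_distrib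
  by (intro Bochner_Integration.integral_diff integrable_exp_mult assms)

lemma exp_moment_sum:
  assumes "\<And>i. i \<in> I \<Longrightarrow> integrable (lebesgue_on {0..T}) (y i)"
  shows "exp_moment T (\<lambda>t. \<Sum>i\<in>I. y i t) z = (\<Sum>i\<in>I. exp_moment T (y i) z)"
  unfolding exp_moment_def sum_distrib_left
  by (intro Bochner_Integration.integral_sum integrable_exp_mult assms)

lemma exp_moment_cong:
  assumes "\<And>t. t \<in> {0..T} \<Longrightarrow> y t = w t"
  shows "exp_moment T y z = exp_moment T w z"
  unfolding exp_moment_def
  by (intro Bochner_Integration.integral_cong) (use assms in auto)

lemma exp_taylor_remainder:
  fixes u :: complex
  shows "norm (exp u - (\<Sum>q<n. u ^ q / fact q)) \<le> exp (norm u) * norm u ^ n"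
proof (cases n)
  case 0
  then show ?thesis using norm_exp[of u] by simp
next
  case (Suc k)
  have "norm (exp u - (\<Sum>q\<le>k. u ^ q / fact q)) \<le> exp (norm u) * norm u ^ Suc k / fact k"
    by (rule Taylor_exp_field)
  also have "\<dots> \<le> exp (norm u) * norm u ^ Suc k"
    using fact_ge_1[of k] by (intro divide_left_mono[of 1 "fact k", simplified]) auto
  finally show ?thesis
    by (simp add: Suc lessThan_Suc_atMost del: power_Suc)
qed

text \<open>
  The integrals against \<open>(T - t)\<^sup>q exp (\<mu> (T - t))\<close> are the derivatives of \<open>exp_moment T y\<close> at \<open>\<mu>\<close>. Integrating
  the Taylor expansion of the exponential, whose remainder is uniform in \<open>t\<close>, gives the expansion directly,
  without differentiating under the integral sign.
\<close>

lemma exp_moment_jet: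
  assumes "0 \<le> T" and y: "integrable (lebesgue_on {0..T}) y"
  shows "(\<lambda>z. exp_moment T y z
            - (\<Sum>q<n. (LINT t|lebesgue_on {0..T}. moment_fun T \<mu> q t * y t) / fact q * (z - \<mu>) ^ q))
          \<in> O[at \<mu>](\<lambda>z. (z - \<mu>) ^ n)"
proof -
  have cont_mom: "continuous_on {0..T} (moment_fun T \<mu> q)" for q
    unfolding moment_fun_def by (intro continuous_intros)
  have mom: "integrable (lebesgue_on {0..T}) (\<lambda>t. moment_fun T \<mu> q t * y t)" for q
    by (rule integrable_continuous_mult[OF cont_mom y])
  define C where "C = exp (norm \<mu> * T) * exp T * T ^ n"
  define N where "N = (LINT t|lebesgue_on {0..T}. norm (y t))"
  have "norm (exp_moment T y z
      - (\<Sum>q<n. (LINT t|lebesgue_on {0..T}. moment_fun T \<mu> q t * y t) / fact q * (z - \<mu>) ^ q))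
      \<le> C * N * norm ((z - \<mu>) ^ n)" if z: "dist z \<mu> < 1" for z
  proof -
    let ?R = "\<lambda>t. (exp (z * of_real (T - t)) - (\<Sum>q<n. (z - \<mu>) ^ q / fact q * moment_fun T \<mu> q t))"
    have eq: "exp_moment T y z
        - (\<Sum>q<n. (LINT t|lebesgue_on {0..T}. moment_fun T \<mu> q t * y t) / fact q * (z - \<mu>) ^ q)
        = (LINT t|lebesgue_on {0..T}. ?R t * y t)"
    proof -
      have "(LINT t|lebesgue_on {0..T}. ?R t * y t) = (LINT t|lebesgue_on {0..T}.
           exp (z * of_real (T - t)) * y t - (\<Sum>q<n. (z - \<mu>) ^ q / fact q * (moment_fun T \<mu> q t * y t)))"
        by (simp add: left_diff_distrib sum_distrib_right mult.assoc)
      also have "\<dots> = exp_moment T y z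
          - (\<Sum>q<n. (z - \<mu>) ^ q / fact q * (LINT t|lebesgue_on {0..T}. moment_fun T \<mu> q t * y t))"
        unfolding exp_moment_def
        by (subst Bochner_Integration.integral_diff)
           (use mom integrable_exp_mult[OF y] in auto)
      finally show ?thesis by (simp add: mult.commute)
    qed
    have R: "norm (?R t) \<le> C * norm (z - \<mu>) ^ n" if t: "t \<in> {0..T}" for t
    proof -
      define u where "u = (z - \<mu>) * of_real (T - t)"
      have "norm u \<le> norm (z - \<mu>) * T"
        using t by (auto simp: u_def norm_mult simp flip: of_real_diff intro!: mult_left_mono)
      moreover from this have "norm u \<le> T"
        using z \<open>0 \<le> T\<close> mult_right_mono[of "norm (z - \<mu>)" 1 T] by (auto simp: dist_norm)
      ultimately have u: "exp (norm u) * norm u ^ n \<le> exp T * (norm (z - \<mu>) * T) ^ n"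
        by (intro mult_mono power_mono) auto
      have R_eq: "?R t = exp (\<mu> * of_real (T - t)) * (exp u - (\<Sum>q<n. u ^ q / fact q))"
      proof -
        have "exp (\<mu> * of_real (T - t)) * exp u = exp (z * of_real (T - t))"
          by (simp add: u_def algebra_simps flip: exp_add)
        moreover have "exp (\<mu> * of_real (T - t)) * (u ^ q / fact q)
            = (z - \<mu>) ^ q / fact q * moment_fun T \<mu> q t" for q
          by (simp add: u_def moment_fun_def power_mult_distrib)
        ultimately show ?thesis
          unfolding right_diff_distrib sum_distrib_left by simp
      qed
      have "norm (exp (\<mu> * of_real (T - t))) \<le> exp (norm (\<mu> * of_real (T - t)))"
        by (rule norm_exp)
      also have "\<dots> \<le> exp (norm \<mu> * T)"
        using t by (auto simp: norm_mult simp flip: of_real_diff intro!: mult_left_mono)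
      finally have "norm (?R t) \<le> exp (norm \<mu> * T) * (exp T * (norm (z - \<mu>) * T) ^ n)"
        unfolding R_eq norm_mult
        by (intro mult_mono order.trans[OF exp_taylor_remainder u]) auto
      then show ?thesis by (simp add: C_def power_mult_distrib mult_ac)
    qed
    have "norm (LINT t|lebesgue_on {0..T}. ?R t * y t)
        \<le> (LINT t|lebesgue_on {0..T}. C * norm (z - \<mu>) ^ n * norm (y t))"
    proof (rule Bochner_Integration.integral_norm_bound_integral)
      have "continuous_on {0..T} ?R"
        by (intro continuous_intros cont_mom)
      then show "integrable (lebesgue_on {0..T}) (\<lambda>t. ?R t * y t)"
        using y by (rule integrable_continuous_mult)
      show "integrable (lebesgue_on {0..T}) (\<lambda>t. C * norm (z - \<mu>) ^ n * norm (y t))"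
        using y by simp
      show "norm (?R t * y t) \<le> C * norm (z - \<mu>) ^ n * norm (y t)"
        if "t \<in> space (lebesgue_on {0..T})" for t
        using that R[of t] by (auto simp: norm_mult intro!: mult_right_mono)
    qed
    also have "\<dots> = C * N * norm ((z - \<mu>) ^ n)"
      by (simp add: N_def norm_power mult_ac)
    finally show ?thesis unfolding eq .
  qed
  then have "eventually (\<lambda>z. norm (exp_moment T y z
      - (\<Sum>q<n. (LINT t|lebesgue_on {0..T}. moment_fun T \<mu> q t * y t) / fact q * (z - \<mu>) ^ q))
      \<le> C * N * norm ((z - \<mu>) ^ n)) (at \<mu>)"
    unfolding eventually_at by (intro exI[of _ 1]) auto
  then show ?thesis by (rule bigoI)
qed

corollary exp_moment_bounded:
  assumes "0 \<le> T" "integrable (lebesgue_on {0..T}) y"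
  shows "exp_moment T y \<in> O[at \<mu>](\<lambda>_. 1)"
  using exp_moment_jet[OF assms, where n = 0] by simp

text \<open>
  The counterpart of \<open>exp_moment_jet\<close> for a prescribed holomorphic function: if the moments of \<open>y\<close> are the
  derivatives of \<open>G\<close>, the two expansions together give agreement to order \<open>n\<close>.
\<close>

lemma analytic_jet:
  fixes G :: "complex \<Rightarrow> complex"
  assumes holo: "G holomorphic_on S" and "open S" "\<mu> \<in> S"
  shows "(\<lambda>z. G z - (\<Sum>q<n. (deriv ^^ q) G \<mu> / fact q * (z - \<mu>) ^ q)) \<in> O[at \<mu>](\<lambda>z. (z - \<mu>) ^ n)"
proof -
  obtain e where e: "e > 0" "cball \<mu> e \<subseteq> S"
    using assms open_contains_cball by blast
  have holo_q: "(deriv ^^ q) G holomorphic_on S" for q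
    by (rule holomorphic_higher_deriv[OF holo \<open>open S\<close>])
  have "continuous_on (cball \<mu> e) ((deriv ^^ n) G)"
    using holo_q e(2) by (meson holomorphic_on_imp_continuous_on continuous_on_subset)
  then obtain M where M: "\<And>z. z \<in> cball \<mu> e \<Longrightarrow> norm ((deriv ^^ n) G z) \<le> M"
    using compact_continuous_image[OF _ compact_cball, THEN compact_imp_bounded, of \<mu> e "(deriv ^^ n) G"]
    unfolding bounded_iff by blast
  have "norm (G z - (\<Sum>q<n. (deriv ^^ q) G \<mu> / fact q * (z - \<mu>) ^ q)) \<le> M * norm ((z - \<mu>) ^ n)"
    if z: "z \<in> cball \<mu> e" for z
  proof (cases n)
    case 0
    then show ?thesis using M[OF z] by simp
  next
    case (Suc k)
    have "0 \<le> M" using order.trans[OF norm_ge_zero M[of \<mu>]] e by simp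
    have "norm ((deriv ^^ 0) G z - (\<Sum>i\<le>k. (deriv ^^ i) G \<mu> * (z - \<mu>) ^ i / fact i))
        \<le> M * norm (z - \<mu>) ^ Suc k / fact k"
    proof (rule complex_Taylor[where S = "cball \<mu> e"])
      show "((deriv ^^ i) G has_field_derivative (deriv ^^ Suc i) G x) (at x within cball \<mu> e)"
        if "x \<in> cball \<mu> e" for i x
        using holomorphic_derivI[OF holo_q \<open>open S\<close>, of x i] that e(2)
        by (auto intro: has_field_derivative_at_within)
    qed (use z e M Suc in auto)
    also have "\<dots> \<le> M * norm (z - \<mu>) ^ Suc k"
      using \<open>0 \<le> M\<close> mult_left_mono[of 1 "fact k" "M * norm (z - \<mu>) ^ Suc k"]
      by (simp add: divide_le_eq fact_ge_1)
    finally show ?thesis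
      by (simp add: Suc lessThan_Suc_atMost norm_mult norm_power)
  qed
  then have "eventually (\<lambda>z. norm (G z - (\<Sum>q<n. (deriv ^^ q) G \<mu> / fact q * (z - \<mu>) ^ q))
      \<le> M * norm ((z - \<mu>) ^ n)) (at \<mu>)"
    unfolding eventually_at using e(1) by (intro exI[of _ e]) (auto simp: dist_commute)
  then show ?thesis by (rule bigoI)
qed

section \<open>Transformed modal equations\<close>

definition char_poly :: "real \<Rightarrow> complex \<Rightarrow> nat \<Rightarrow> complex \<Rightarrow> complex" where
  "char_poly \<rho> \<gamma> m z = z\<^sup>2 + of_real \<rho> * of_nat m ^ 2 * z + of_nat m ^ 4 + \<gamma>"

text \<open>
  The boundary contribution of a state \<open>(y, y') = (c0, c1)\<close> when \<open>y'' + \<rho> m\<^sup>2 y'\<close> is integrated by parts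
  against \<open>exp (z (T - t))\<close>.
\<close>

definition state_symbol :: "real \<Rightarrow> nat \<Rightarrow> complex \<Rightarrow> complex \<Rightarrow> complex \<Rightarrow> complex" where
  "state_symbol \<rho> m c0 c1 z = c1 + (z + of_real \<rho> * of_nat m ^ 2) * c0"

lemma H2_derivs_integrable:
  fixes y :: "real \<Rightarrow> complex"
  assumes "H2_derivs T y y1 y2"
  shows "integrable (lebesgue_on {0..T}) y" "integrable (lebesgue_on {0..T}) y1"
    "integrable (lebesgue_on {0..T}) y2"
proof -
  show y2: "integrable (lebesgue_on {0..T}) y2"
    using assms L2_on_imp_integrable by (auto simp: H2_derivs_def)
  have "continuous_on {0..T} (\<lambda>t. y1 0 + (LINT \<tau>|lebesgue_on {0..t}. y2 \<tau>))"
    by (intro continuous_intros indefinite_integral_continuous_real y2)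
  moreover have "y1 0 + (LINT \<tau>|lebesgue_on {0..t}. y2 \<tau>) = y1 t" if "t \<in> {0..T}" for t
    using assms that unfolding H2_derivs_def by metis
  ultimately have "continuous_on {0..T} y1"
    by (rule continuous_on_eq)
  then show "integrable (lebesgue_on {0..T}) y1"
    by (rule continuous_imp_integrable_real)
  have "continuous_on {0..T} y"
    using assms unfolding H2_derivs_def by (meson continuous_on_vector_derivative)
  then show "integrable (lebesgue_on {0..T}) y"
    by (rule continuous_imp_integrable_real)
qed

lemma exp_moment_derivative:
  assumes "0 \<le> T" "integrable (lebesgue_on {0..T}) w'"
    and "\<And>t. t \<in> {0..T} \<Longrightarrow> w t = w 0 + (LINT \<tau>|lebesgue_on {0..t}. w' \<tau>)"
  shows "exp_moment T w' z = w T - exp (z * of_real T) * w 0 + z * exp_moment T w z"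
proof -
  have "exp_moment T w' z = exp (z * of_real (T - T)) * w T - exp (z * of_real (T - 0)) * w 0
      - (LINT t|lebesgue_on {0..T}. (- z * exp (z * of_real (T - t))) * w t)"
    unfolding exp_moment_def
  proof (rule integration_by_parts_abs_cont[where T = T and w = w and w' = w'
        and e = "\<lambda>t. exp (z * of_real (T - t))" and e' = "\<lambda>t. - z * exp (z * of_real (T - t))",
        OF assms])
    fix t
    show "((\<lambda>t. exp (z * of_real (T - t))) has_vector_derivative - z * exp (z * of_real (T - t)))
        (at t within {0..T})"
      unfolding of_real_diff
      by (rule has_vector_derivative_real_field[where f = "\<lambda>x. exp (z * (of_real T - x))"])
         (auto intro!: derivative_eq_intros)
    show "continuous_on {0..T} (\<lambda>t. - z * exp (z * of_real (T - t)))"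
      by (intro continuous_intros)
  qed
  also have "\<dots> = w T - exp (z * of_real T) * w 0 + z * exp_moment T w z"
    by (simp add: exp_moment_def mult.assoc)
  finally show ?thesis .
qed

lemma exp_moment_H2_derivs:
  assumes "0 \<le> T" and H2: "H2_derivs T y y1 y2"
  shows "exp_moment T y1 z = y T - exp (z * of_real T) * y 0 + z * exp_moment T y z"
    and "exp_moment T y2 z = y1 T - exp (z * of_real T) * y1 0 + z * exp_moment T y1 z"
proof -
  note int = H2_derivs_integrable[OF H2]
  show "exp_moment T y2 z = y1 T - exp (z * of_real T) * y1 0 + z * exp_moment T y1 z"
  proof (rule exp_moment_derivative[OF \<open>0 \<le> T\<close> int(3)])
    show "y1 t = y1 0 + (LINT \<tau>|lebesgue_on {0..t}. y2 \<tau>)" if "t \<in> {0..T}" for t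
      using H2 that unfolding H2_derivs_def by blast
  qed
  have deriv: "(y has_vector_derivative y1 t) (at t within {0..T})" if "t \<in> {0..T}" for t
    using H2 that unfolding H2_derivs_def by blast
  have "y t = y 0 + (LINT \<tau>|lebesgue_on {0..t}. y1 \<tau>)" if t: "t \<in> {0..T}" for t
  proof -
    have "(y has_vector_derivative y1 x) (at x within {0..t})" if "x \<in> {0..t}" for x
    proof (rule has_vector_derivative_within_subset[where S = "{0..T}"])
      show "(y has_vector_derivative y1 x) (at x within {0..T})"
        using deriv that t by simp
    qed (use t in auto)
    then have "(y1 has_integral y t - y 0) {0..t}"
      using t by (intro fundamental_theorem_of_calculus) auto
    moreover have "(LINT \<tau>|lebesgue_on {0..t}. y1 \<tau>) = integral {0..t} y1"
      using t by (intro lebesgue_integral_eq_integral integrable_subinterval[OF int(2)]) auto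
    ultimately show ?thesis by (simp add: integral_unique)
  qed
  then show "exp_moment T y1 z = y T - exp (z * of_real T) * y 0 + z * exp_moment T y z"
    by (rule exp_moment_derivative[OF \<open>0 \<le> T\<close> int(2)])
qed

text \<open>
  Integrating by parts twice turns the differential operator into multiplication by its characteristic
  polynomial. The state at time \<open>T\<close> enters with weight one and the initial state with weight \<open>exp (z T)\<close>, which
  is the source of the exponential decay of the moments.
\<close>

lemma exp_moment_modal_ivp:
  assumes "0 \<le> T" and ivp: "modal_ivp T \<rho> \<gamma> m h c0 c1 y y1"
    and h: "integrable (lebesgue_on {0..T}) h"
  shows "char_poly \<rho> \<gamma> m z * exp_moment T y z
      = exp_moment T h z - state_symbol \<rho> m (y T) (y1 T) z
        + exp (z * of_real T) * state_symbol \<rho> m c0 c1 z"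
    and "integrable (lebesgue_on {0..T}) y"
proof -
  obtain y2 where H2: "H2_derivs T y y1 y2" and init: "y 0 = c0" "y1 0 = c1"
    and ae: "AE t in lebesgue_on {0..T}.
       y2 t + of_real \<rho> * of_nat m ^ 2 * y1 t + (of_nat m ^ 4 + \<gamma>) * y t = h t"
    using ivp by (auto simp: modal_ivp_def)
  note int = H2_derivs_integrable[OF H2]
  show "integrable (lebesgue_on {0..T}) y" by (fact int)
  have "exp_moment T h z = exp_moment T
      (\<lambda>t. y2 t + of_real \<rho> * of_nat m ^ 2 * y1 t + (of_nat m ^ 4 + \<gamma>) * y t) z"
    unfolding exp_moment_def
  proof (rule integral_cong_AE)
    show "(\<lambda>t. exp (z * of_real (T - t)) * h t) \<in> borel_measurable (lebesgue_on {0..T})"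
      by (intro borel_measurable_integrable integrable_exp_mult h)
    show "(\<lambda>t. exp (z * of_real (T - t)) * (y2 t + of_real \<rho> * of_nat m ^ 2 * y1 t
        + (of_nat m ^ 4 + \<gamma>) * y t)) \<in> borel_measurable (lebesgue_on {0..T})"
      by (intro borel_measurable_integrable integrable_exp_mult Bochner_Integration.integrable_add
          integrable_mult_right int)
  qed (use ae in auto)
  also have "\<dots> = exp_moment T y2 z + of_real \<rho> * of_nat m ^ 2 * exp_moment T y1 z
      + (of_nat m ^ 4 + \<gamma>) * exp_moment T y z"
    by (simp add: exp_moment_add exp_moment_mult int)
  also have "\<dots> = char_poly \<rho> \<gamma> m z * exp_moment T y z + state_symbol \<rho> m (y T) (y1 T) z
      - exp (z * of_real T) * state_symbol \<rho> m c0 c1 z"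
    unfolding exp_moment_H2_derivs[OF \<open>0 \<le> T\<close> H2] init char_poly_def state_symbol_def
    by (simp add: algebra_simps power2_eq_square)
  finally show "char_poly \<rho> \<gamma> m z * exp_moment T y z
      = exp_moment T h z - state_symbol \<rho> m (y T) (y1 T) z
        + exp (z * of_real T) * state_symbol \<rho> m c0 c1 z"
    by (simp add: algebra_simps)
qed

section \<open>The rank condition and dual vectors\<close>

lemma independent_image_scalars_zero:
  fixes f :: "'i \<Rightarrow> 'a::field ^ 'n"
  assumes inj: "inj_on f I" and "finite J" "J \<subseteq> I" and indep: "vec.independent (f ` I)"
    and zero: "(\<Sum>i\<in>J. c i *s f i) = 0" and "i \<in> J"
  shows "c i = 0"
proof -
  have injJ: "inj_on f J" using inj \<open>J \<subseteq> I\<close> by (rule inj_on_subset)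
  have "(\<Sum>v\<in>f ` J. c (the_inv_into J f v) *s v) = (\<Sum>i\<in>J. c i *s f i)"
    by (simp add: sum.reindex[OF injJ] the_inv_into_f_f[OF injJ])
  then have "c (the_inv_into J f (f i)) = 0"
    using zero \<open>finite J\<close> \<open>J \<subseteq> I\<close> \<open>i \<in> J\<close>
    by (intro vec.independentD[OF indep, of "f ` J"]) auto
  then show ?thesis
    using the_inv_into_f_f[OF injJ \<open>i \<in> J\<close>] by simp
qed

lemma full_row_rank_imp_left_kernel_trivial:
  fixes M :: "'a::field ^ 'm ^ 'n"
  assumes "rank M = CARD('n)" and zero: "\<And>j. (\<Sum>i\<in>UNIV. v i * M $ i $ j) = 0"
  shows "v i = 0"
proof -
  have rows: "rows M = range (\<lambda>i. row i M)"
    by (auto simp: rows_def)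
  have fin: "finite (rows M)" unfolding rows by simp
  have dim: "vec.dim (rows M) = CARD('n)"
    using assms(1) by (simp add: row_rank_def_gen)
  have le: "card (rows M) \<le> CARD('n)"
    unfolding rows by (rule card_image_le) simp
  have "vec.independent (rows M)"
    using fin le dim by (intro vec.card_le_dim_spanning[of _ "rows M"]) (auto intro: vec.span_base)
  moreover have "card (rows M) = CARD('n)"
    using le dim vec.dim_le_card'[OF fin] by linarith
  then have "inj (\<lambda>i. row i M)"
    unfolding rows by (intro eq_card_imp_inj_on) auto
  moreover have "(\<Sum>i\<in>UNIV. v i *s row i M) = 0"
    using zero by (simp add: vec_eq_iff row_def)
  ultimately show ?thesis
    unfolding rows by (intro independent_image_scalars_zero[of "\<lambda>i. row i M" UNIV UNIV v i]) auto
qed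

text \<open>
  The entrywise conjugate of \<open>v\<close> annihilates the block row from the left, and full row rank leaves only zero.
\<close>

lemma hautus_eigenvector:
  fixes A :: "complex ^ 'n ^ 'n" and B :: "complex ^ 'l ^ 'n"
  assumes rank: "rank (block_row (mat \<mu> - A) B) = CARD('n)"
    and eig: "conj_transpose A *v v = cnj \<mu> *s v" and ker: "conj_transpose B *v v = 0"
  shows "v = 0"
proof -
  have "(\<Sum>i\<in>UNIV. cnj (v $ i) * block_row (mat \<mu> - A) B $ i $ j) = 0" for j
  proof (cases j)
    case (Inl j')
    have "(\<Sum>i\<in>UNIV. cnj (A $ i $ j') * v $ i) = cnj \<mu> * v $ j'"
      using arg_cong[OF eig, of "\<lambda>w. w $ j'"] by (simp add: matrix_vector_mult_def conj_transpose_def)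
    from arg_cong[OF this, of cnj]
    have "(\<Sum>i\<in>UNIV. cnj (v $ i) * A $ i $ j') = \<mu> * cnj (v $ j')"
      by (simp add: mult.commute)
    moreover have "(\<Sum>i\<in>UNIV. cnj (v $ i) * mat \<mu> $ i $ j') = \<mu> * cnj (v $ j')"
      by (simp add: mat_def if_distrib[where f = "\<lambda>x. _ * x"] cong: if_cong)
    ultimately show ?thesis
      by (simp add: Inl block_row_def right_diff_distrib sum_subtractf)
  next
    case (Inr j')
    have "(\<Sum>i\<in>UNIV. cnj (B $ i $ j') * v $ i) = 0"
      using arg_cong[OF ker, of "\<lambda>w. w $ j'"] by (simp add: matrix_vector_mult_def conj_transpose_def)
    from arg_cong[OF this, of cnj] show ?thesis
      by (simp add: Inr block_row_def mult.commute)
  qed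
  from full_row_rank_imp_left_kernel_trivial[OF rank this] show ?thesis
    by (simp add: vec_eq_iff)
qed

text \<open>
  A vanishing combination of the \<open>B\<^sup>* \<psi>\<^sub>j\<^sub>,\<^sub>k\<^sub>,\<^sub>1\<close> is \<open>B\<^sup>* v\<close> for a vector \<open>v\<close> in the eigenspace of \<open>A\<^sup>*\<close>, so
  \<open>hautus_eigenvector\<close> forces \<open>v = 0\<close>.
\<close>

lemma observed_eigenvectors_independent:
  fixes A :: "complex ^ 'n ^ 'n" and B :: "complex ^ 'l ^ 'n"
  assumes rank: "rank (block_row (mat (\<gamma> j) - A) B) = CARD('n)"
    and basis: "jordan_chain_basis (conj_transpose A) p (\<lambda>j. cnj (\<gamma> j)) g r \<psi>"
    and j: "j \<in> {1..p}" and r: "\<And>k. k \<in> {1..g j} \<Longrightarrow> 1 \<le> r j k"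
    and zero: "(\<Sum>k\<in>{1..g j}. c k *s (conj_transpose B *v \<psi> j k 1)) = 0"
    and k: "k \<in> {1..g j}"
  shows "c k = 0"
proof -
  define v where "v = (\<Sum>k\<in>{1..g j}. c k *s \<psi> j k 1)"
  have idx: "(j, k, 1) \<in> chain_indices p g r" if "k \<in> {1..g j}" for k
    using that j r[OF that] by (auto simp: chain_indices_def)
  have eig1: "conj_transpose A *v \<psi> j k 1 = cnj (\<gamma> j) *s \<psi> j k 1" if "k \<in> {1..g j}" for k
    using basis idx[OF that] j that unfolding jordan_chain_basis_def by fastforce
  have "conj_transpose A *v v = cnj (\<gamma> j) *s v"
    unfolding v_def vec.linear_sum[OF matrix_vector_mul_linear_gen] vec.scale_sum_right
    by (intro sum.cong refl) (simp add: vector_scalar_commute eig1[unfolded One_nat_def] mult.commute)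
  moreover have "conj_transpose B *v v = 0"
    using zero unfolding v_def vec.linear_sum[OF matrix_vector_mul_linear_gen]
    by (simp add: vector_scalar_commute)
  ultimately have "v = 0"
    using hautus_eigenvector[OF rank] by blast
  let ?f = "\<lambda>(j, k, s). \<psi> j k s"
  have "(\<lambda>(j, k, s). c k) (j, k, 1::nat) = 0"
  proof (rule independent_image_scalars_zero[where f = ?f and I = "chain_indices p g r"
        and J = "(\<lambda>k. (j, k, 1)) ` {1..g j}"])
    show "(\<Sum>i\<in>(\<lambda>k. (j, k, 1)) ` {1..g j}. (case i of (j, k, s) \<Rightarrow> c k) *s ?f i) = 0"
      using \<open>v = 0\<close> unfolding v_def by (subst sum.reindex) (auto simp: inj_on_def)
  qed (use basis idx k in \<open>auto simp: jordan_chain_basis_def\<close>)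
  then show ?thesis by simp
qed

text \<open>
  \<open>d k\<close> represents, through \<open>herm\<close>, a linear functional that is one on \<open>\<beta> k\<close> and zero on the other
  \<open>\<beta> k'\<close>. Such a functional is read off from one coordinate of a linear extension.
\<close>

lemma herm_dual_family:
  fixes \<beta> :: "nat \<Rightarrow> complex ^ 'l"
  assumes "finite K"
    and indep: "\<And>c k. (\<Sum>k\<in>K. c k *s \<beta> k) = 0 \<Longrightarrow> k \<in> K \<Longrightarrow> c k = 0"
  shows "\<exists>d. \<forall>k\<in>K. \<forall>k'\<in>K. herm (d k) (\<beta> k') = (if k = k' then 1 else 0)"
proof -
  have inj: "inj_on \<beta> K"
  proof (rule inj_onI, rule ccontr)
    fix k k' assume k: "k \<in> K" "k' \<in> K" "\<beta> k = \<beta> k'" "k \<noteq> k'"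
    (* Equal vectors at two indices would admit the nontrivial relation with coefficients 1 and -1. *)
    define c :: "nat \<Rightarrow> complex" where "c i = (if i = k then 1 else 0) - (if i = k' then 1 else 0)" for i
    have "(\<Sum>i\<in>K. c i *s \<beta> i) = (\<Sum>i\<in>K. (if i = k then \<beta> k else 0) - (if i = k' then \<beta> k' else 0))"
      by (intro sum.cong refl) (auto simp: c_def)
    also have "\<dots> = 0"
      using k \<open>finite K\<close> by (simp add: sum_subtractf)
    finally have "c k = 0" using indep k(1) by blast
    then show False using k(4) by (simp add: c_def)
  qed
  have "vec.independent (\<beta> ` K)"
  proof (rule vec.independent_if_scalars_zero)
    fix f x assume "(\<Sum>x\<in>\<beta> ` K. f x *s x) = 0" "x \<in> \<beta> ` K"
    then show "f x = 0"
      using indep[of "f \<circ> \<beta>"] by (auto simp: sum.reindex[OF inj])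
  qed (use \<open>finite K\<close> in simp)
  have "\<exists>d. \<forall>k'\<in>K. herm d (\<beta> k') = (if k = k' then 1 else 0)" if "k \<in> K" for k
  proof -
    (* Any fixed coordinate serves to turn vector values into scalars. *)
    define i0 :: 'l where "i0 = undefined"
    obtain F where F: "Vector_Spaces.linear (*s) (*s) F"
      "\<And>x. x \<in> \<beta> ` K \<Longrightarrow> F x = (if x = \<beta> k then axis i0 1 else (0 :: complex ^ 'l))"
      using vec.linear_independent_extend[OF \<open>vec.independent (\<beta> ` K)\<close>,
          of "\<lambda>x. if x = \<beta> k then axis i0 1 else (0 :: complex ^ 'l)"] by blast
    define d where "d = (\<chi> i. cnj (matrix F $ i0 $ i))"
    have "herm d (\<beta> k') = (if k = k' then 1 else 0)" if "k' \<in> K" for k'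
    proof -
      have "herm d (\<beta> k') = cnj ((matrix F *v \<beta> k') $ i0)"
        by (simp add: herm_def d_def matrix_vector_mult_def)
      also have "\<dots> = cnj (F (\<beta> k') $ i0)"
        by (simp add: matrix_works[OF F(1)])
      also have "\<dots> = (if k = k' then 1 else 0)"
        using F(2)[of "\<beta> k'"] that \<open>k \<in> K\<close> inj by (auto simp: inj_on_def)
      finally show ?thesis .
    qed
    then show ?thesis by blast
  qed
  then show ?thesis by metis
qed

section \<open>The triangular system along the Jordan chains\<close>

text \<open>
  Solution \<open>Y\<^sub>n\<close> of \<open>\<Sum>\<^sub>i\<^sub>\<le>\<^sub>n \<beta>\<^sub>k\<^sub>,\<^sub>n\<^sub>+\<^sub>1\<^sub>-\<^sub>i\<^sup>* Y\<^sub>i = U\<^sub>k\<^sub>,\<^sub>n\<^sub>+\<^sub>1\<close>, imposed for all chains \<open>k\<close> of length \<open>r k > n\<close>. The newest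
  unknown \<open>Y\<^sub>n\<close> meets only the vectors \<open>\<beta>\<^sub>k\<^sub>,\<^sub>1\<close>, so it is assembled from the vectors \<open>d k\<close> dual to these;
  chains that are too short impose no condition at step \<open>n\<close>.
\<close>

fun chain_solution ::
  "nat \<Rightarrow> (nat \<Rightarrow> nat) \<Rightarrow> (nat \<Rightarrow> nat \<Rightarrow> complex ^ 'l) \<Rightarrow> (nat \<Rightarrow> complex ^ 'l) \<Rightarrow>
   (nat \<Rightarrow> nat \<Rightarrow> complex) \<Rightarrow> nat \<Rightarrow> complex ^ 'l" where
  "chain_solution g r \<beta> d U n =
     (\<Sum>k\<in>{k \<in> {1..g}. n < r k}.
        (U k (Suc n) - (\<Sum>i\<in>{..<n}. herm (chain_solution g r \<beta> d U i) (\<beta> k (Suc n - i)))) *s d k)"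

declare chain_solution.simps [simp del]

lemma herm_add_left: "herm (v + w) u = herm v u + herm w u"
  by (simp add: herm_def distrib_right sum.distrib)

lemma herm_scale_left: "herm (c *s v) u = c * herm v u"
  by (simp add: herm_def sum_distrib_left mult.assoc)

lemma herm_diff_left: "herm (v - w) u = herm v u - herm w u"
  by (simp add: herm_def left_diff_distrib sum_subtractf)

lemma norm_scale_complex: "norm (c *s v) = norm c * norm v" for v :: "complex ^ 'a"
  by (simp add: norm_vec_def norm_mult L2_set_right_distrib)

lemma herm_sum_left: "herm (\<Sum>i\<in>I. v i) u = (\<Sum>i\<in>I. herm (v i) u)"
  by (induction I rule: infinite_finite_induct) (simp_all add: herm_add_left, simp_all add: herm_def)

lemma norm_herm_le: "norm (herm v w) \<le> (\<Sum>i\<in>UNIV. norm (w $ i)) * norm v"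
proof -
  have "norm (herm v w) \<le> (\<Sum>i\<in>UNIV. norm (v $ i * cnj (w $ i)))"
    unfolding herm_def by (rule norm_sum)
  also have "\<dots> \<le> (\<Sum>i\<in>UNIV. norm (w $ i) * norm v)"
    by (intro sum_mono)
       (auto simp: norm_mult mult.commute[of "cmod (w $ _)"]
          intro!: mult_right_mono Finite_Cartesian_Product.norm_nth_le)
  finally show ?thesis by (simp add: sum_distrib_right)
qed

lemma chain_solution_correct:
  assumes d: "\<And>k k'. k \<in> {1..g} \<Longrightarrow> k' \<in> {1..g} \<Longrightarrow> herm (d k) (\<beta> k' 1) = (if k = k' then 1 else 0)"
    and k: "k \<in> {1..g}" "n < r k"
  shows "(\<Sum>i\<le>n. herm (chain_solution g r \<beta> d U i) (\<beta> k (Suc n - i))) = U k (Suc n)"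
proof -
  let ?c = "\<lambda>k. U k (Suc n) - (\<Sum>i<n. herm (chain_solution g r \<beta> d U i) (\<beta> k (Suc n - i)))"
  have "herm (chain_solution g r \<beta> d U n) (\<beta> k 1)
      = (\<Sum>k'\<in>{k' \<in> {1..g}. n < r k'}. ?c k' * (if k' = k then 1 else 0))"
    by (subst chain_solution.simps)
       (use d[OF _ k(1)] in \<open>auto simp: herm_sum_left herm_scale_left herm_diff_left intro!: sum.cong\<close>)
  also have "\<dots> = ?c k"
    using k by (simp add: if_distrib[where f = "\<lambda>x. _ * x"] cong: if_cong)
  finally show ?thesis
    by (simp add: lessThan_Suc_atMost[symmetric])
qed

text \<open>
  \<open>C\<close> depends on the chains and on the dual family, but not on the right-hand side; this is what
  makes the final estimate uniform in \<open>m\<close> and in the initial data.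
\<close>

lemma chain_solution_bound:
  fixes \<beta> :: "nat \<Rightarrow> nat \<Rightarrow> complex ^ 'l"
  shows "\<exists>C\<ge>0. \<forall>U E. 0 \<le> E \<longrightarrow> (\<forall>k\<in>{1..g}. \<forall>s\<in>{1..r k}. norm (U k s) \<le> E) \<longrightarrow>
           (\<forall>n<\<nu>. norm (chain_solution g r \<beta> d U n) \<le> C * E)"
proof (induction \<nu>)
  case 0
  then show ?case by (intro exI[of _ 0]) auto
next
  case (Suc \<nu>)
  then obtain C where C: "C \<ge> 0" "\<And>U E n. 0 \<le> E \<Longrightarrow> (\<forall>k\<in>{1..g}. \<forall>s\<in>{1..r k}. norm (U k s) \<le> E)
      \<Longrightarrow> n < \<nu> \<Longrightarrow> norm (chain_solution g r \<beta> d U n) \<le> C * E"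
    by metis
  let ?b = "\<lambda>k i. \<Sum>l\<in>UNIV. norm (\<beta> k (Suc \<nu> - i) $ l)"
  define C' where "C' = (\<Sum>k\<in>{k \<in> {1..g}. \<nu> < r k}. (1 + (\<Sum>i<\<nu>. ?b k i * C)) * norm (d k))"
  have b: "0 \<le> ?b k i" for k i by (simp add: sum_nonneg)
  have C': "0 \<le> C'"
    unfolding C'_def using C(1) b by (intro sum_nonneg mult_nonneg_nonneg add_nonneg_nonneg) auto
  have new: "norm (chain_solution g r \<beta> d U \<nu>) \<le> C' * E"
    if "0 \<le> E" and U: "\<forall>k\<in>{1..g}. \<forall>s\<in>{1..r k}. norm (U k s) \<le> E" for U E
  proof -
    have "norm (chain_solution g r \<beta> d U \<nu>) \<le> (\<Sum>k\<in>{k \<in> {1..g}. \<nu> < r k}.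
        norm ((U k (Suc \<nu>) - (\<Sum>i<\<nu>. herm (chain_solution g r \<beta> d U i) (\<beta> k (Suc \<nu> - i)))) *s d k))"
      by (subst chain_solution.simps) (rule norm_sum)
    also have "\<dots> \<le> (\<Sum>k\<in>{k \<in> {1..g}. \<nu> < r k}. (E + (\<Sum>i<\<nu>. ?b k i * (C * E))) * norm (d k))"
    proof (rule sum_mono)
      fix k assume k: "k \<in> {k \<in> {1..g}. \<nu> < r k}"
      have "norm (herm (chain_solution g r \<beta> d U i) (\<beta> k (Suc \<nu> - i))) \<le> ?b k i * (C * E)"
        if "i < \<nu>" for i
        by (rule order.trans[OF norm_herm_le]) (intro mult_left_mono C(2)[OF \<open>0 \<le> E\<close> U that] b)
      then have "norm (\<Sum>i<\<nu>. herm (chain_solution g r \<beta> d U i) (\<beta> k (Suc \<nu> - i)))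
          \<le> (\<Sum>i<\<nu>. ?b k i * (C * E))"
        by (intro order.trans[OF norm_sum] sum_mono) auto
      moreover have "norm (U k (Suc \<nu>)) \<le> E" using U k by auto
      ultimately have "norm (U k (Suc \<nu>) - (\<Sum>i<\<nu>. herm (chain_solution g r \<beta> d U i) (\<beta> k (Suc \<nu> - i))))
          \<le> E + (\<Sum>i<\<nu>. ?b k i * (C * E))"
        by (intro order.trans[OF norm_triangle_ineq4] add_mono)
      then show "norm ((U k (Suc \<nu>) - (\<Sum>i<\<nu>. herm (chain_solution g r \<beta> d U i) (\<beta> k (Suc \<nu> - i)))) *s d k)
          \<le> (E + (\<Sum>i<\<nu>. ?b k i * (C * E))) * norm (d k)"
        unfolding norm_scale_complex by (rule mult_right_mono) simp
    qed
    also have "\<dots> = C' * E"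
      by (simp add: C'_def sum_distrib_left sum_distrib_right algebra_simps)
    finally show ?thesis .
  qed
  have "norm (chain_solution g r \<beta> d U n) \<le> max C C' * E"
    if "0 \<le> E" "\<forall>k\<in>{1..g}. \<forall>s\<in>{1..r k}. norm (U k s) \<le> E" "n < Suc \<nu>" for U E n
  proof (cases "n = \<nu>")
    case True
    then show ?thesis
      using new[OF that(1,2)] mult_right_mono[OF max.cobounded2 that(1)] by (auto intro: order.trans)
  next
    case False
    then show ?thesis
      using C(2)[OF that(1,2), of n] that(3) mult_right_mono[OF max.cobounded1 that(1), of C C']
      by auto
  qed
  then show ?case using C(1) by (intro exI[of _ "max C C'"]) auto
qed

lemma chain_solution_holomorphic:
  assumes U: "\<And>k s. (\<lambda>z. U z k s) holomorphic_on S"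
  shows "(\<lambda>z. chain_solution g r \<beta> d (U z) n $ l) holomorphic_on S"
proof (induction n arbitrary: l rule: less_induct)
  case (less n)
  show ?case
    by (subst chain_solution.simps)
       (auto simp: herm_def intro!: holomorphic_intros U less)
qed

section \<open>Order of vanishing at the temporal roots\<close>

lemma char_poly_factor:
  "char_poly \<rho> \<gamma> m z = (z - temporal_root \<rho> \<gamma> m Plus) * (z - temporal_root \<rho> \<gamma> m Minus)"
proof -
  define c where "c = csqrt (of_real \<rho> ^ 2 * of_nat m ^ 4 - 4 * (of_nat m ^ 4 + \<gamma>))"
  have "c\<^sup>2 = of_real \<rho> ^ 2 * of_nat m ^ 4 - 4 * (of_nat m ^ 4 + \<gamma>)"
    by (simp add: c_def)
  then show ?thesis
    unfolding char_poly_def temporal_root.simps c_def[symmetric]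
    by (simp add: field_simps power2_eq_square) (simp add: algebra_simps power4_eq_xxxx)
qed

lemma critical_roots:
  assumes "Crit \<in> root_labels \<rho> \<gamma> m"
  shows "temporal_root \<rho> \<gamma> m Plus = temporal_root \<rho> \<gamma> m Crit"
    "temporal_root \<rho> \<gamma> m Minus = temporal_root \<rho> \<gamma> m Crit"
proof -
  have eq: "temporal_root \<rho> \<gamma> m Plus = temporal_root \<rho> \<gamma> m Minus"
    using assms by (auto simp: root_labels_def split: if_splits)
  then show "temporal_root \<rho> \<gamma> m Plus = temporal_root \<rho> \<gamma> m Crit"
    by (simp add: field_simps)
  then show "temporal_root \<rho> \<gamma> m Minus = temporal_root \<rho> \<gamma> m Crit"
    using eq by simp
qed

lemma char_poly_critical:
  assumes "Crit \<in> root_labels \<rho> \<gamma> m"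
  shows "char_poly \<rho> \<gamma> m z = (z - temporal_root \<rho> \<gamma> m Crit)\<^sup>2"
  using char_poly_factor[of \<rho> \<gamma> m z] critical_roots[OF assms] by (simp add: power2_eq_square)

lemma char_poly_root:
  assumes "\<sigma> \<in> root_labels \<rho> \<gamma> m"
  shows "char_poly \<rho> \<gamma> m (temporal_root \<rho> \<gamma> m \<sigma>) = 0"
  using assms char_poly_factor[of \<rho> \<gamma> m "temporal_root \<rho> \<gamma> m \<sigma>"] char_poly_critical[of \<rho> \<gamma> m]
  by (cases \<sigma>) auto

lemma isCont_imp_bigo_1:
  fixes f :: "complex \<Rightarrow> complex"
  assumes "isCont f \<mu>"
  shows "f \<in> O[at \<mu>](\<lambda>_. 1)"
proof (rule bigoI_tendsto)
  show "((\<lambda>z. f z / 1) \<longlongrightarrow> f \<mu>) (at \<mu>)" using assms by (simp add: isCont_def)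
qed simp

text \<open>
  The number of moments prescribed at a root is the order of vanishing of \<open>p\<^sup>\<nu>\<close> there: \<open>\<nu>\<close> at each of two
  simple roots, \<open>2 \<nu>\<close> at a double root.
\<close>

lemma char_poly_order:
  assumes "\<sigma> \<in> root_labels \<rho> \<gamma> m"
  shows "(\<lambda>z. (z - temporal_root \<rho> \<gamma> m \<sigma>) ^ moment_count \<nu> \<sigma>)
    \<in> O[at (temporal_root \<rho> \<gamma> m \<sigma>)](\<lambda>z. char_poly \<rho> \<gamma> m z ^ \<nu>)"
proof -
  let ?P = "temporal_root \<rho> \<gamma> m Plus" and ?M = "temporal_root \<rho> \<gamma> m Minus"
  have simple: "(\<lambda>z. (z - \<mu>) ^ \<nu>) \<in> O[at \<mu>](\<lambda>z. ((z - \<mu>) * (z - \<mu>')) ^ \<nu>)"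
    if "\<mu> \<noteq> \<mu>'" for \<mu> \<mu>' :: complex
  proof -
    have "(\<lambda>z. 1 / (z - \<mu>')) \<in> O[at \<mu>](\<lambda>_. 1)"
      using that by (intro isCont_imp_bigo_1 continuous_intros) auto
    moreover have "eventually (\<lambda>z. z \<noteq> \<mu>') (at \<mu>)"
      using that by (metis eventually_at_topological eventually_neq_at_within)
    ultimately have "(\<lambda>z. (z - \<mu>) * 1) \<in> O[at \<mu>](\<lambda>z. (z - \<mu>) * (z - \<mu>'))"
      by (intro landau_o.big.mult_left) (simp add: landau_divide_simps eventually_mono)
    then show ?thesis by (intro landau_o.big_power) simp
  qed
  show ?thesis
  proof (cases \<sigma>)
    case Plus
    then have "?P \<noteq> ?M" using assms by (auto simp: root_labels_def split: if_splits)
    from simple[OF this] show ?thesis unfolding Plus char_poly_factor by simp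
  next
    case Minus
    then have "?M \<noteq> ?P" using assms by (auto simp: root_labels_def split: if_splits)
    from simple[OF this] show ?thesis unfolding Minus char_poly_factor by (simp add: mult.commute)
  next
    case Crit
    then show ?thesis
      using assms by (simp add: char_poly_critical power_mult del: temporal_root.simps)
  qed
qed

text \<open>
  A polynomial of degree at most one that vanishes at the roots of a quadratic, with multiplicity, is zero.
  At a double root \<open>\<mu>\<close> the first-order vanishing leaves \<open>(z - \<mu>) c0\<close>, which is \<open>O((z - \<mu>)\<^sup>2)\<close> only if
  \<open>c0 = 0\<close>.
\<close>

lemma state_symbol_eq_0:
  assumes small: "\<And>\<sigma>. \<sigma> \<in> root_labels \<rho> \<gamma> m \<Longrightarrow>
      state_symbol \<rho> m c0 c1 \<in> O[at (temporal_root \<rho> \<gamma> m \<sigma>)](char_poly \<rho> \<gamma> m)"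
  shows "c0 = 0 \<and> c1 = 0"
proof -
  have lim0: "(h \<longlongrightarrow> 0) (at \<mu>)" if h: "h \<in> O[at \<mu>](k)" and k: "(k \<longlongrightarrow> 0) (at \<mu>)" for h k :: "complex \<Rightarrow> complex" and \<mu>
  proof -
    obtain c where "eventually (\<lambda>z. norm (h z) \<le> c * norm (k z)) (at \<mu>)"
      using landau_o.bigE[OF h] by blast
    then show ?thesis
      by (intro tendsto_0_le[OF k, of _ c]) (simp add: mult.commute)
  qed
  have vanish: "state_symbol \<rho> m c0 c1 (temporal_root \<rho> \<gamma> m \<sigma>) = 0" if "\<sigma> \<in> root_labels \<rho> \<gamma> m" for \<sigma>
  proof -
    let ?\<mu> = "temporal_root \<rho> \<gamma> m \<sigma>"
    have "(char_poly \<rho> \<gamma> m \<longlongrightarrow> char_poly \<rho> \<gamma> m ?\<mu>) (at ?\<mu>)"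
      unfolding char_poly_def by (intro tendsto_intros)
    then have "(state_symbol \<rho> m c0 c1 \<longlongrightarrow> 0) (at ?\<mu>)"
      using small[OF that] char_poly_root[OF that] lim0 by metis
    moreover have "(state_symbol \<rho> m c0 c1 \<longlongrightarrow> state_symbol \<rho> m c0 c1 ?\<mu>) (at ?\<mu>)"
      unfolding state_symbol_def by (intro tendsto_intros)
    ultimately show ?thesis using tendsto_unique[OF at_neq_bot] by blast
  qed
  have c0: "c0 = 0"
  proof (cases "Crit \<in> root_labels \<rho> \<gamma> m")
    case True
    let ?\<mu> = "temporal_root \<rho> \<gamma> m Crit"
    have "state_symbol \<rho> m c0 c1 = (\<lambda>z. (z - ?\<mu>) * c0)"
      using vanish[OF True] by (auto simp: state_symbol_def algebra_simps fun_eq_iff simp del: temporal_root.simps)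
    moreover have "char_poly \<rho> \<gamma> m = (\<lambda>z. (z - ?\<mu>) * (z - ?\<mu>))"
      using char_poly_critical[OF True] by (simp add: power2_eq_square fun_eq_iff)
    ultimately have "(\<lambda>z. (z - ?\<mu>) * c0) \<in> O[at ?\<mu>](\<lambda>z. (z - ?\<mu>) * (z - ?\<mu>))"
      using small[OF True] by (simp only:)
    then have "(\<lambda>z. c0) \<in> O[at ?\<mu>](\<lambda>z. z - ?\<mu>)"
      by (subst (asm) landau_o.big.mult_cancel_left)
         (auto simp: eventually_at_filter simp del: temporal_root.simps)
    moreover have "((\<lambda>z. z - ?\<mu>) \<longlongrightarrow> 0) (at ?\<mu>)"
      by (auto intro!: tendsto_eq_intros simp del: temporal_root.simps)
    ultimately have "((\<lambda>z. c0) \<longlongrightarrow> 0) (at ?\<mu>)" by (rule lim0)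
    then show ?thesis by (simp add: tendsto_const_iff)
  next
    case False
    then have labels: "root_labels \<rho> \<gamma> m = {Plus, Minus}"
      and ne: "temporal_root \<rho> \<gamma> m Plus \<noteq> temporal_root \<rho> \<gamma> m Minus"
      by (auto simp: root_labels_def split: if_splits)
    have "(temporal_root \<rho> \<gamma> m Plus - temporal_root \<rho> \<gamma> m Minus) * c0
        = state_symbol \<rho> m c0 c1 (temporal_root \<rho> \<gamma> m Plus)
          - state_symbol \<rho> m c0 c1 (temporal_root \<rho> \<gamma> m Minus)"
      by (simp add: state_symbol_def algebra_simps del: temporal_root.simps)
    also have "\<dots> = 0"
      using vanish[of Plus] vanish[of Minus] labels by (simp del: temporal_root.simps)
    finally have "temporal_root \<rho> \<gamma> m Plus = temporal_root \<rho> \<gamma> m Minus \<or> c0 = 0"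
      by (simp del: temporal_root.simps)
    then show ?thesis using ne by blast
  qed
  moreover obtain \<sigma> where "\<sigma> \<in> root_labels \<rho> \<gamma> m" unfolding root_labels_def by (metis insertI1)
  from vanish[OF this] have "c1 = 0" using c0 by (simp add: state_symbol_def)
  ultimately show ?thesis by simp
qed

section \<open>The prescribed function and the telescoping argument\<close>

text \<open>
  Collecting the powers \<open>P\<^sup>l\<close> with \<open>l < s\<close> leaves a remainder divisible by \<open>P\<^sup>s\<close>. The remainder is kept
  explicit because its boundedness near a root is needed.
\<close>

lemma truncated_convolution:
  fixes P :: "'a::comm_ring_1"
  assumes "s \<le> \<nu>"
  shows "(\<Sum>i<s. \<Sum>n<\<nu>. P ^ (i + n) * c i n)
      = (\<Sum>l<s. P ^ l * (\<Sum>n\<le>l. c (l - n) n)) + P ^ s * (\<Sum>i<s. \<Sum>n\<in>{s - i..<\<nu>}. P ^ (i + n - s) * c i n)"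
proof -
  have "(\<Sum>n<\<nu>. P ^ (i + n) * c i n)
      = (\<Sum>n<s - i. P ^ (i + n) * c i n) + P ^ s * (\<Sum>n\<in>{s - i..<\<nu>}. P ^ (i + n - s) * c i n)"
    if "i < s" for i
  proof -
    have "{..<\<nu>} = {..<s - i} \<union> {s - i..<\<nu>}" using assms by auto
    then have "(\<Sum>n<\<nu>. P ^ (i + n) * c i n)
        = (\<Sum>n<s - i. P ^ (i + n) * c i n) + (\<Sum>n\<in>{s - i..<\<nu>}. P ^ (i + n) * c i n)"
      by (simp add: sum.union_disjoint ivl_disj_int)
    also have "(\<Sum>n\<in>{s - i..<\<nu>}. P ^ (i + n) * c i n) = P ^ s * (\<Sum>n\<in>{s - i..<\<nu>}. P ^ (i + n - s) * c i n)"
      unfolding sum_distrib_left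
      by (intro sum.cong refl) (auto simp: mult.assoc[symmetric] power_add[symmetric])
    finally show ?thesis .
  qed
  then have "(\<Sum>i<s. \<Sum>n<\<nu>. P ^ (i + n) * c i n)
      = (\<Sum>i<s. \<Sum>n<s - i. P ^ (i + n) * c i n)
        + P ^ s * (\<Sum>i<s. \<Sum>n\<in>{s - i..<\<nu>}. P ^ (i + n - s) * c i n)"
    by (simp add: sum.distrib sum_distrib_left)
  also have "(\<Sum>i<s. \<Sum>n<s - i. P ^ (i + n) * c i n) = (\<Sum>l<s. P ^ l * (\<Sum>n\<le>l. c (l - n) n))"
    unfolding sum_distrib_left sum.Sigma[OF finite_lessThan ballI[OF finite_lessThan]]
      sum.Sigma[OF finite_lessThan ballI[OF finite_atMost]]
    by (rule sum.reindex_bij_witness[of _ "\<lambda>(l, n). (l - n, n)" "\<lambda>(i, n). (i + n, n)"]) auto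
  finally show ?thesis .
qed

text \<open>
  The function whose derivatives at the temporal roots are prescribed as moments. The first factor is
  \<open>S / (S - p)\<close> with \<open>S = z\<^sup>2 + \<gamma>\<close> and \<open>p\<close> the characteristic polynomial. It absorbs the coupling to \<open>f\<close>
  itself: the transform of \<open>f\<close> is \<open>1 / S\<close> times that of \<open>f'' + \<gamma> f\<close>, and after an index shift its
  contribution turns the factor \<open>1\<close> into \<open>1 - p / S\<close>. The sum carries the solution \<open>Y\<close> of the triangular
  system for the initial data.
\<close>

definition moment_symbol ::
  "real \<Rightarrow> real \<Rightarrow> complex \<Rightarrow> nat \<Rightarrow> nat \<Rightarrow> (complex \<Rightarrow> nat \<Rightarrow> complex ^ 'l) \<Rightarrow> complex \<Rightarrow> complex ^ 'l" where
  "moment_symbol T \<rho> \<gamma> m \<nu> Y z =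
     (- (z\<^sup>2 + \<gamma>) / (of_real \<rho> * of_nat m ^ 2 * z + of_nat m ^ 4)
        * (exp (z * of_real T) / of_real (lift_coeff m)))
     *s (\<Sum>n<\<nu>. (- char_poly \<rho> \<gamma> m z) ^ n *s Y z n)"

definition moment_target ::
  "real \<Rightarrow> real \<Rightarrow> complex \<Rightarrow> nat \<Rightarrow> nat \<Rightarrow> (complex \<Rightarrow> nat \<Rightarrow> complex ^ 'l) \<Rightarrow> nat \<Rightarrow> root_label \<Rightarrow> complex ^ 'l" where
  "moment_target T \<rho> \<gamma> m \<nu> Y q \<sigma> =
     (\<chi> l. (deriv ^^ q) (\<lambda>z. moment_symbol T \<rho> \<gamma> m \<nu> Y z $ l) (temporal_root \<rho> \<gamma> m \<sigma>))"

text \<open>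
  The prescribed function cancels the data modulo \<open>p\<^sup>s\<close>. Shifting the index in the sum that contains
  \<open>herm G (\<beta> i) / S\<close> (possible as \<open>\<beta> 0 = 0\<close>) merges it with the other control term into the factor
  \<open>1 - p / S\<close>, which undoes the factor \<open>S / q\<close> of \<open>G\<close>; here \<open>q = S - p\<close>. What remains is a product of two
  polynomials in \<open>-p\<close>, whose low-order coefficients are the data by the choice of \<open>Y\<close>.
\<close>

lemma chain_identity:
  fixes \<beta> :: "nat \<Rightarrow> complex ^ 'l"
  assumes "p + q = S" "S \<noteq> 0" "q \<noteq> 0" "\<beta> 0 = 0" "s \<le> \<nu>" "x \<noteq> 0"
    and Y: "\<And>n. n < s \<Longrightarrow> (\<Sum>i\<le>n. herm (Y i) (\<beta> (Suc n - i))) = U (Suc n)"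
    and G: "G = (S / q * (e / x)) *s (\<Sum>n<\<nu>. (- p) ^ n *s Y n)"
  shows "(\<Sum>i<s. (- p) ^ i * (e * U (Suc i) - x * (herm G (\<beta> (Suc i)) + herm G (\<beta> i) / S)))
    = (- p) ^ s * (- (e * (\<Sum>i<s. \<Sum>n\<in>{s - i..<\<nu>}. (- p) ^ (i + n - s) * herm (Y n) (\<beta> (Suc i))))
        + e / q * (\<Sum>n<\<nu>. (- p) ^ n * herm (Y n) (\<beta> s)))"
proof -
  define V where "V k = (\<Sum>n<\<nu>. (- p) ^ n * herm (Y n) (\<beta> k))" for k
  have hG: "herm G (\<beta> k) = S / q * (e / x) * V k" for k
    by (simp add: G V_def herm_scale_left herm_sum_left)
  have shift: "(\<Sum>i<s. (- p) ^ i * V i) = (\<Sum>i<s. (- p) ^ Suc i * V (Suc i)) - (- p) ^ s * V s"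
  proof -
    have "V 0 = 0" by (simp add: V_def \<open>\<beta> 0 = 0\<close> herm_def)
    have "(\<Sum>i<s. (- p) ^ i * V i) + (- p) ^ s * V s = (\<Sum>i<Suc s. (- p) ^ i * V i)" by simp
    also have "\<dots> = (\<Sum>i<s. (- p) ^ Suc i * V (Suc i))"
      using \<open>V 0 = 0\<close> by (simp add: sum.lessThan_Suc_shift del: sum.lessThan_Suc)
    finally show ?thesis by (simp add: algebra_simps)
  qed
  have conv: "(\<Sum>i<s. (- p) ^ i * V (Suc i)) = (\<Sum>l<s. (- p) ^ l * U (Suc l))
      + (- p) ^ s * (\<Sum>i<s. \<Sum>n\<in>{s - i..<\<nu>}. (- p) ^ (i + n - s) * herm (Y n) (\<beta> (Suc i)))"
  proof -
    have "(\<Sum>i<s. (- p) ^ i * V (Suc i)) = (\<Sum>i<s. \<Sum>n<\<nu>. (- p) ^ (i + n) * herm (Y n) (\<beta> (Suc i)))"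
      by (simp add: V_def sum_distrib_left power_add mult.assoc)
    also have "\<dots> = (\<Sum>l<s. (- p) ^ l * (\<Sum>n\<le>l. herm (Y n) (\<beta> (Suc (l - n)))))
      + (- p) ^ s * (\<Sum>i<s. \<Sum>n\<in>{s - i..<\<nu>}. (- p) ^ (i + n - s) * herm (Y n) (\<beta> (Suc i)))"
      by (rule truncated_convolution[OF \<open>s \<le> \<nu>\<close>])
    also have "(\<Sum>l<s. (- p) ^ l * (\<Sum>n\<le>l. herm (Y n) (\<beta> (Suc (l - n))))) = (\<Sum>l<s. (- p) ^ l * U (Suc l))"
    proof (intro sum.cong refl)
      fix l assume "l \<in> {..<s}"
      then have "(\<Sum>n\<le>l. herm (Y n) (\<beta> (Suc (l - n)))) = (\<Sum>n\<le>l. herm (Y n) (\<beta> (Suc l - n)))"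
        by (intro sum.cong refl) (simp add: Suc_diff_le)
      then show "(- p) ^ l * (\<Sum>n\<le>l. herm (Y n) (\<beta> (Suc (l - n)))) = (- p) ^ l * U (Suc l)"
        using Y \<open>l \<in> {..<s}\<close> by simp
    qed
    finally show ?thesis .
  qed
  have summand: "(- p) ^ i * (e * U (Suc i) - x * (herm G (\<beta> (Suc i)) + herm G (\<beta> i) / S))
      = e * ((- p) ^ i * U (Suc i)) - S * e / q * ((- p) ^ i * V (Suc i)) - e / q * ((- p) ^ i * V i)" for i
    using \<open>S \<noteq> 0\<close> \<open>x \<noteq> 0\<close> \<open>q \<noteq> 0\<close> by (simp add: hG field_simps)
  have "(\<Sum>i<s. (- p) ^ i * (e * U (Suc i) - x * (herm G (\<beta> (Suc i)) + herm G (\<beta> i) / S)))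
      = e * (\<Sum>i<s. (- p) ^ i * U (Suc i)) - S * e / q * (\<Sum>i<s. (- p) ^ i * V (Suc i))
        - e / q * (\<Sum>i<s. (- p) ^ i * V i)"
    unfolding summand by (simp add: sum_subtractf sum_distrib_left)
  also have "(\<Sum>i<s. (- p) ^ i * V i) = - p * (\<Sum>i<s. (- p) ^ i * V (Suc i)) - (- p) ^ s * V s"
    unfolding shift by (simp add: sum_distrib_left mult.assoc sum_negf)
  also have "e * (\<Sum>i<s. (- p) ^ i * U (Suc i)) - S * e / q * (\<Sum>i<s. (- p) ^ i * V (Suc i))
        - e / q * (- p * (\<Sum>i<s. (- p) ^ i * V (Suc i)) - (- p) ^ s * V s)
      = e * (\<Sum>i<s. (- p) ^ i * U (Suc i)) - e * (\<Sum>i<s. (- p) ^ i * V (Suc i)) + e / q * (- p) ^ s * V s"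
    using \<open>q \<noteq> 0\<close> \<open>p + q = S\<close>[symmetric] by (simp add: field_simps)
  also have "\<dots> = (- p) ^ s * (- (e * (\<Sum>i<s. \<Sum>n\<in>{s - i..<\<nu>}. (- p) ^ (i + n - s) * herm (Y n) (\<beta> (Suc i))))
        + e / q * V s)"
    unfolding conv by (simp add: algebra_simps)
  finally show ?thesis unfolding V_def .
qed

lemma telescoped_chain:
  fixes w \<omega> R :: "nat \<Rightarrow> complex"
  assumes "w 0 = 0"
    and eq: "\<And>i. i < s \<Longrightarrow> p * w (Suc i) = - w i + R i - \<omega> (Suc i)"
    and \<omega>: "\<And>i. Suc i < s \<Longrightarrow> \<omega> (Suc i) = 0" and "0 < s"
  shows "(- p) ^ (s - 1) * \<omega> s = (- p) ^ s * w s + (\<Sum>i<s. (- p) ^ i * R i)"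
proof -
  have "(\<Sum>i<s'. (- p) ^ i * (R i - \<omega> (Suc i))) = - ((- p) ^ s' * w s')" if "s' \<le> s" for s'
    using that
  proof (induction s')
    case 0
    then show ?case using \<open>w 0 = 0\<close> by simp
  next
    case (Suc s')
    then have "(\<Sum>i<Suc s'. (- p) ^ i * (R i - \<omega> (Suc i)))
        = - ((- p) ^ s' * w s') + (- p) ^ s' * (p * w (Suc s') + w s')"
      using eq[of s'] by simp
    then show ?case by (simp add: algebra_simps)
  qed
  from this[OF order_refl]
  have "(\<Sum>i<s. (- p) ^ i * R i) = - ((- p) ^ s * w s) + (\<Sum>i<s. (- p) ^ i * \<omega> (Suc i))"
    by (simp add: right_diff_distrib sum_subtractf algebra_simps)
  also have "(\<Sum>i<s. (- p) ^ i * \<omega> (Suc i)) = (- p) ^ (s - 1) * \<omega> s"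
  proof -
    obtain s' where "s = Suc s'" using \<open>0 < s\<close> by (cases s) auto
    then show ?thesis using \<omega> by simp
  qed
  finally show ?thesis by simp
qed

lemma isCont_herm:
  fixes v :: "complex \<Rightarrow> complex ^ 'l"
  assumes "\<And>l. isCont (\<lambda>z. v z $ l) \<mu>"
  shows "isCont (\<lambda>z. herm (v z) u) \<mu>"
  unfolding herm_def by (intro continuous_intros assms)

lemma bigo_herm:
  fixes v :: "complex \<Rightarrow> complex ^ 'l"
  assumes "\<And>l. (\<lambda>z. v z $ l) \<in> O[F](h)"
  shows "(\<lambda>z. herm (v z) u) \<in> O[F](h)"
  unfolding herm_def using assms by (intro big_sum_in_bigo) auto

lemma char_poly_add: "char_poly \<rho> \<gamma> m z + - (of_real \<rho> * of_nat m ^ 2 * z + of_nat m ^ 4) = z\<^sup>2 + \<gamma>"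
  by (simp add: char_poly_def)

text \<open>
  One step of the induction along a Jordan chain, near one root \<open>\<mu>\<close>. In the telescoped identity,
  \<open>\<omega> s\<close> is multiplied by \<open>(-p)\<^sup>s\<^sup>-\<^sup>1\<close> and every other term is \<open>O(p\<^sup>s)\<close>: the transform \<open>w s\<close> is bounded
  and carries \<open>(-p)\<^sup>s\<close>, the prescribed function contributes \<open>O(p\<^sup>s)\<close> by \<open>chain_identity\<close>, and the error
  \<open>\<Delta>\<close> of the jets is \<open>O(p\<^sup>\<nu>)\<close> with \<open>\<nu> \<ge> s\<close>. Dividing by \<open>p\<^sup>s\<^sup>-\<^sup>1\<close> gives the claim.
\<close>

lemma terminal_symbol_bigo:
  fixes \<beta> :: "nat \<Rightarrow> complex ^ 'l" and Y :: "complex \<Rightarrow> nat \<Rightarrow> complex ^ 'l"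
    and Fh fh :: "complex \<Rightarrow> complex ^ 'l" and \<rho> T :: real and \<gamma> :: complex and m \<nu> :: nat
    and w U \<omega> :: "nat \<Rightarrow> complex \<Rightarrow> complex"
  defines "p \<equiv> char_poly \<rho> \<gamma> m"
  assumes "1 \<le> m" and root: "p \<mu> = 0" and nonres: "\<mu>\<^sup>2 + \<gamma> \<noteq> 0"
    and "\<beta> 0 = 0" "0 < s" "s \<le> \<nu>"
    and contY: "\<And>n l. isCont (\<lambda>z. Y z n $ l) \<mu>"
    and Y: "\<And>z n. n < s \<Longrightarrow> (\<Sum>i\<le>n. herm (Y z i) (\<beta> (Suc n - i))) = U (Suc n) z"
    and w0: "\<And>z. w 0 z = 0" and wbd: "w s \<in> O[at \<mu>](\<lambda>_. 1)"
    and eq: "\<And>i z. i < s \<Longrightarrow> p z * w (Suc i) z = - w i z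
        - of_real (lift_coeff m) * (herm (Fh z) (\<beta> (Suc i)) + herm (fh z) (\<beta> i))
        + exp (z * of_real T) * U (Suc i) z - \<omega> (Suc i) z"
    and \<omega>: "\<And>i z. Suc i < s \<Longrightarrow> \<omega> (Suc i) z = 0"
    and Ff: "\<And>z. Fh z = (z\<^sup>2 + \<gamma>) *s fh z"
    and jet: "\<And>l. (\<lambda>z. Fh z $ l - moment_symbol T \<rho> \<gamma> m \<nu> Y z $ l) \<in> O[at \<mu>](\<lambda>z. p z ^ \<nu>)"
  shows "\<omega> s \<in> O[at \<mu>](p)"
proof -
  define x where "x = complex_of_real (lift_coeff m)"
  have "x \<noteq> 0" using \<open>1 \<le> m\<close> by (simp add: x_def lift_coeff_def)
  define S where "S z = z\<^sup>2 + \<gamma>" for z :: complex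
  define q where "q z = - (of_real \<rho> * of_nat m ^ 2 * z + of_nat m ^ 4)" for z :: complex
  define e where "e z = exp (z * of_real T)" for z :: complex
  define \<Delta> where "\<Delta> z = Fh z - moment_symbol T \<rho> \<gamma> m \<nu> Y z" for z
  (* The cofactor of (-p)^s in chain_identity: continuous at the root, since q does not vanish there. *)
  define K where "K z = - (e z * (\<Sum>i<s. \<Sum>n\<in>{s - i..<\<nu>}. (- p z) ^ (i + n - s) * herm (Y z n) (\<beta> (Suc i))))
        + e z / q z * (\<Sum>n<\<nu>. (- p z) ^ n * herm (Y z n) (\<beta> s))" for z
  have pqS: "p z + q z = S z" for z
    unfolding p_def q_def S_def by (rule char_poly_add)
  have cont_p: "isCont p \<mu>"
    unfolding p_def char_poly_def by (intro continuous_intros)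
  have cont_S: "isCont S \<mu>" and cont_q: "isCont q \<mu>" and cont_e: "isCont e \<mu>"
    unfolding S_def q_def e_def by (intro continuous_intros)+
  have "S \<mu> \<noteq> 0" using nonres by (simp add: S_def)
  have "q \<mu> \<noteq> 0" using pqS[of \<mu>] root \<open>S \<mu> \<noteq> 0\<close> by simp
  have ev_S: "eventually (\<lambda>z. S z \<noteq> 0) (at \<mu>)" and ev_q: "eventually (\<lambda>z. q z \<noteq> 0) (at \<mu>)"
    using tendsto_imp_eventually_ne[OF cont_S[unfolded isCont_def] \<open>S \<mu> \<noteq> 0\<close>]
      tendsto_imp_eventually_ne[OF cont_q[unfolded isCont_def] \<open>q \<mu> \<noteq> 0\<close>] by auto
  have ev_p: "eventually (\<lambda>z. p z \<noteq> 0) (at \<mu>)"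
  proof -
    let ?X = "- ({temporal_root \<rho> \<gamma> m Plus, temporal_root \<rho> \<gamma> m Minus} - {\<mu>})"
    have "open ?X" by (intro open_Compl finite_imp_closed) simp
    then have "eventually (\<lambda>z. z \<in> ?X - {\<mu>}) (at \<mu>)" by (intro eventually_at_in_open) auto
    then show ?thesis
      by eventually_elim (auto simp: p_def char_poly_factor simp del: temporal_root.simps)
  qed
  have main: "(- p z) ^ (s - 1) * \<omega> s z = (- p z) ^ s * (w s z + K z)
      - x * (\<Sum>i<s. (- p z) ^ i * (herm (\<Delta> z) (\<beta> (Suc i)) + herm (\<Delta> z) (\<beta> i) * (1 / S z)))"
    if "S z \<noteq> 0" "q z \<noteq> 0" for z
  proof -
    define G where "G = moment_symbol T \<rho> \<gamma> m \<nu> Y z"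
    have G: "G = (S z / q z * (e z / x)) *s (\<Sum>n<\<nu>. (- p z) ^ n *s Y z n)"
      unfolding G_def moment_symbol_def S_def q_def e_def x_def p_def
      by (simp only: minus_divide_left[symmetric] minus_divide_right[symmetric])
    have Fh: "herm (Fh z) u = herm G u + herm (\<Delta> z) u" for u
      by (simp add: \<Delta>_def G_def herm_diff_left)
    have fh: "herm (fh z) u = (herm G u + herm (\<Delta> z) u) / S z" for u
    proof -
      have "herm (Fh z) u = S z * herm (fh z) u"
        by (simp only: Ff S_def herm_scale_left)
      then show ?thesis using that(1) Fh[of u] by simp
    qed
    have "(- p z) ^ (s - 1) * \<omega> s z = (- p z) ^ s * w s z + (\<Sum>i<s. (- p z) ^ i *
        (e z * U (Suc i) z - x * (herm (Fh z) (\<beta> (Suc i)) + herm (fh z) (\<beta> i))))"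
      by (rule telescoped_chain) (use w0 eq \<omega> \<open>0 < s\<close> in \<open>simp_all add: x_def e_def\<close>)
    also have "(\<Sum>i<s. (- p z) ^ i * (e z * U (Suc i) z - x * (herm (Fh z) (\<beta> (Suc i)) + herm (fh z) (\<beta> i))))
      = (\<Sum>i<s. (- p z) ^ i * (e z * U (Suc i) z - x * (herm G (\<beta> (Suc i)) + herm G (\<beta> i) / S z)))
        - x * (\<Sum>i<s. (- p z) ^ i * (herm (\<Delta> z) (\<beta> (Suc i)) + herm (\<Delta> z) (\<beta> i) * (1 / S z)))"
      unfolding Fh fh sum_distrib_left sum_subtractf[symmetric]
      by (intro sum.cong refl) (simp add: algebra_simps add_divide_distrib)
    also have "(\<Sum>i<s. (- p z) ^ i * (e z * U (Suc i) z - x * (herm G (\<beta> (Suc i)) + herm G (\<beta> i) / S z)))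
        = (- p z) ^ s * K z"
      unfolding K_def
      by (rule chain_identity[OF pqS that \<open>\<beta> 0 = 0\<close> \<open>s \<le> \<nu>\<close> \<open>x \<noteq> 0\<close> Y G])
    finally show ?thesis by (simp add: algebra_simps)
  qed
  have cont_K: "isCont K \<mu>"
    unfolding K_def
    by (intro continuous_intros cont_e cont_q cont_p isCont_herm contY \<open>q \<mu> \<noteq> 0\<close>)
  (* The jets match to order nu, which is at least the order s needed at this step. *)
  have p_pow: "(\<lambda>z. p z ^ \<nu>) \<in> O[at \<mu>](\<lambda>z. p z ^ s)"
  proof -
    have "(\<lambda>z. p z ^ (\<nu> - s) * p z ^ s) \<in> O[at \<mu>](\<lambda>z. 1 * p z ^ s)"
      by (intro landau_o.big.mult isCont_imp_bigo_1 continuous_intros cont_p) simp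
    then show ?thesis using \<open>s \<le> \<nu>\<close> by (simp flip: power_add)
  qed
  have \<Delta>: "(\<lambda>z. herm (\<Delta> z) u) \<in> O[at \<mu>](\<lambda>z. p z ^ s)" for u
    using landau_o.big_trans[OF jet p_pow] by (intro bigo_herm) (simp add: \<Delta>_def)
  have "(\<lambda>z. (- p z) ^ i * (herm (\<Delta> z) (\<beta> (Suc i)) + herm (\<Delta> z) (\<beta> i) * (1 / S z)))
      \<in> O[at \<mu>](\<lambda>z. p z ^ s)" for i
  proof -
    have "(\<lambda>z. herm (\<Delta> z) (\<beta> i) * (1 / S z)) \<in> O[at \<mu>](\<lambda>z. p z ^ s * 1)"
      by (intro landau_o.big.mult \<Delta> isCont_imp_bigo_1 continuous_intros cont_S \<open>S \<mu> \<noteq> 0\<close>)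
    then have "(\<lambda>z. (- p z) ^ i * (herm (\<Delta> z) (\<beta> (Suc i)) + herm (\<Delta> z) (\<beta> i) * (1 / S z)))
      \<in> O[at \<mu>](\<lambda>z. 1 * p z ^ s)"
      by (intro landau_o.big.mult sum_in_bigo \<Delta> isCont_imp_bigo_1 continuous_intros cont_p) simp_all
    then show ?thesis by simp
  qed
  then have rest: "(\<lambda>z. x * (\<Sum>i<s. (- p z) ^ i * (herm (\<Delta> z) (\<beta> (Suc i)) + herm (\<Delta> z) (\<beta> i) * (1 / S z))))
      \<in> O[at \<mu>](\<lambda>z. p z ^ s)"
    by (intro landau_o.big.cmult_in_iff[THEN iffD2] big_sum_in_bigo) (simp_all add: \<open>x \<noteq> 0\<close>)
  have "(\<lambda>z. (- p z) ^ s * (w s z + K z)) \<in> O[at \<mu>](\<lambda>z. p z ^ s * 1)"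
  proof (intro landau_o.big.mult sum_in_bigo wbd isCont_imp_bigo_1 cont_K)
    show "(\<lambda>z. (- p z) ^ s) \<in> O[at \<mu>](\<lambda>z. p z ^ s)"
      by (intro landau_o.big_power) simp
  qed
  then have "(\<lambda>z. (- p z) ^ s * (w s z + K z)
      - x * (\<Sum>i<s. (- p z) ^ i * (herm (\<Delta> z) (\<beta> (Suc i)) + herm (\<Delta> z) (\<beta> i) * (1 / S z))))
      \<in> O[at \<mu>](\<lambda>z. p z ^ s)"
    using rest by (intro sum_in_bigo) simp_all
  moreover have "eventually (\<lambda>z. (- p z) ^ s * (w s z + K z)
      - x * (\<Sum>i<s. (- p z) ^ i * (herm (\<Delta> z) (\<beta> (Suc i)) + herm (\<Delta> z) (\<beta> i) * (1 / S z)))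
      = (- p z) ^ (s - 1) * \<omega> s z) (at \<mu>)"
    using ev_S ev_q by eventually_elim (rule main[symmetric])
  ultimately have "(\<lambda>z. (- p z) ^ (s - 1) * \<omega> s z) \<in> O[at \<mu>](\<lambda>z. p z ^ s)"
    by (simp add: landau_o.big.in_cong)
  also have "(\<lambda>z. p z ^ s) = (\<lambda>z. p z ^ (s - 1) * p z)"
    using \<open>0 < s\<close> by (simp add: power_eq_if mult.commute)
  finally show ?thesis
  proof (subst (asm) landau_o.big.mult_cancel_left)
    have "(\<lambda>z. (- 1) ^ (s - 1) * p z ^ (s - 1)) \<in> \<Theta>[at \<mu>](\<lambda>z. p z ^ (s - 1))"
      by simp
    moreover have "(- p z) ^ (s - 1) = (- 1) ^ (s - 1) * p z ^ (s - 1)" for z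
      by (rule power_minus)
    ultimately show "(\<lambda>z. (- p z) ^ (s - 1)) \<in> \<Theta>[at \<mu>](\<lambda>z. p z ^ (s - 1))"
      by (simp only:)
  qed (use ev_p in \<open>auto simp: frequently_def elim: eventually_mono\<close>)
qed

section \<open>Terminal conditions for a single mode\<close>

lemma L2_on_component:
  fixes f :: "real \<Rightarrow> complex ^ 'l"
  assumes "L2_on S f"
  shows "L2_on S (\<lambda>x. f x $ l)"
proof -
  have meas: "(\<lambda>x. f x $ l) \<in> borel_measurable (lebesgue_on S)"
  proof (rule measurable_compose[where f = f and g = "\<lambda>v. v $ l"])
    show "f \<in> borel_measurable (lebesgue_on S)" using assms by (simp add: L2_on_def)
    show "(\<lambda>v :: complex ^ 'l. v $ l) \<in> borel_measurable borel"
      by (intro borel_measurable_continuous_onI continuous_intros)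
  qed
  moreover have "integrable (lebesgue_on S) (\<lambda>x. (norm (f x $ l))\<^sup>2)"
  proof (rule Bochner_Integration.integrable_bound)
    show "integrable (lebesgue_on S) (\<lambda>x. (norm (f x))\<^sup>2)"
      using assms by (simp add: L2_on_def)
    show "AE x in lebesgue_on S. norm ((norm (f x $ l))\<^sup>2) \<le> norm ((norm (f x))\<^sup>2)"
      by (simp add: Finite_Cartesian_Product.norm_nth_le power_mono)
  qed (use meas in auto)
  ultimately show ?thesis by (simp add: L2_on_def)
qed

lemma integral_vec_component:
  fixes F :: "real \<Rightarrow> complex ^ 'l"
  assumes "\<And>l. integrable M (\<lambda>t. F t $ l)"
  shows "(LINT t|M. F t) $ l = (LINT t|M. F t $ l)"
proof -
  have lin: "bounded_linear (\<lambda>c::complex. c *s (axis i 1 :: complex ^ 'l))" for i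
    by (rule linear_conv_bounded_linear[THEN iffD1])
       (auto intro!: linearI simp: vec_eq_iff algebra_simps)
  have "integrable M (\<lambda>t. F t $ i *s (axis i 1 :: complex ^ 'l))" for i
    by (rule integrable_bounded_linear[OF lin assms])
  then have "integrable M (\<lambda>t. \<Sum>i\<in>UNIV. F t $ i *s (axis i 1 :: complex ^ 'l))"
    by (intro Bochner_Integration.integrable_sum)
  then have "integrable M F"
    by (simp add: basis_expansion)
  then show ?thesis
    by (rule integral_bounded_linear[OF bounded_linear_vec_nth, symmetric])
qed

lemma H20_derivs_component:
  fixes f :: "real \<Rightarrow> complex ^ 'l"
  assumes "H20_derivs T f f1 f2"
  shows "H20_derivs T (\<lambda>t. f t $ l) (\<lambda>t. f1 t $ l) (\<lambda>t. f2 t $ l)"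
proof -
  have H2: "L2_on {0..T} f2" "\<And>t. t \<in> {0..T} \<Longrightarrow> f1 t = f1 0 + (LINT \<tau>|lebesgue_on {0..t}. f2 \<tau>)"
    "\<And>t. t \<in> {0..T} \<Longrightarrow> (f has_vector_derivative f1 t) (at t within {0..T})"
    using assms unfolding H20_derivs_def H2_derivs_def by blast+
  have comp: "integrable (lebesgue_on {0..T}) (\<lambda>t. f2 t $ l)" for l
    by (intro L2_on_imp_integrable L2_on_component H2)
  have "f1 t $ l = f1 0 $ l + (LINT \<tau>|lebesgue_on {0..t}. f2 \<tau> $ l)" if "t \<in> {0..T}" for t
  proof -
    have "integrable (lebesgue_on {0..t}) (\<lambda>t. f2 t $ l)" for l
      using that by (intro integrable_subinterval[OF comp]) auto
    from integral_vec_component[OF this] show ?thesis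
      by (subst H2(2)[OF that]) simp
  qed
  moreover have "((\<lambda>t. f t $ l) has_vector_derivative f1 t $ l) (at t within {0..T})" if "t \<in> {0..T}" for t
    by (rule bounded_linear.has_vector_derivative[OF bounded_linear_vec_nth H2(3)[OF that]])
  ultimately have "H2_derivs T (\<lambda>t. f t $ l) (\<lambda>t. f1 t $ l) (\<lambda>t. f2 t $ l)"
    unfolding H2_derivs_def using L2_on_component[OF H2(1)] by blast
  then show ?thesis using assms by (simp add: H20_derivs_def)
qed

text \<open>
  All boundary terms vanish for controls in \<open>H\<^sub>0\<^sup>2(0, T)\<close>.
\<close>

lemma exp_moment_control:
  assumes "0 \<le> T" and H: "H20_derivs T f f1 f2"
  shows "exp_moment T (\<lambda>t. f2 t + \<gamma> * f t) z = (z\<^sup>2 + \<gamma>) * exp_moment T f z"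
proof -
  have H2: "H2_derivs T f f1 f2" and zero: "f 0 = 0" "f1 0 = 0" "f T = 0" "f1 T = 0"
    using H by (auto simp: H20_derivs_def)
  note int = H2_derivs_integrable[OF H2]
  have "exp_moment T (\<lambda>t. f2 t + \<gamma> * f t) z = exp_moment T f2 z + \<gamma> * exp_moment T f z"
    by (simp add: exp_moment_add exp_moment_mult int)
  then show ?thesis
    unfolding exp_moment_H2_derivs[OF \<open>0 \<le> T\<close> H2] zero by (simp add: algebra_simps power2_eq_square)
qed

lemma exp_moment_herm:
  fixes F :: "real \<Rightarrow> complex ^ 'l"
  assumes "\<And>l. integrable (lebesgue_on {0..T}) (\<lambda>t. F t $ l)"
  shows "exp_moment T (\<lambda>t. herm (F t) u) z = herm (\<chi> l. exp_moment T (\<lambda>t. F t $ l) z) u"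
    and "integrable (lebesgue_on {0..T}) (\<lambda>t. herm (F t) u)"
proof -
  have int: "integrable (lebesgue_on {0..T}) (\<lambda>t. cnj (u $ l) * F t $ l)" for l
    using assms by simp
  show "integrable (lebesgue_on {0..T}) (\<lambda>t. herm (F t) u)"
    unfolding herm_def using assms by (intro Bochner_Integration.integrable_sum) simp
  show "exp_moment T (\<lambda>t. herm (F t) u) z = herm (\<chi> l. exp_moment T (\<lambda>t. F t $ l) z) u"
    using exp_moment_sum[of UNIV T "\<lambda>l t. cnj (u $ l) * F t $ l" z] int
    by (simp add: herm_def exp_moment_mult mult.commute)
qed

lemma lift_coeff_nonzero: "1 \<le> m \<Longrightarrow> lift_coeff m \<noteq> 0"
  by (simp add: lift_coeff_def)

lemma moment_symbol_component:
  fixes Y :: "complex \<Rightarrow> nat \<Rightarrow> complex ^ 'l"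
  shows "moment_symbol T \<rho> \<gamma> m \<nu> Y z $ l =
     - (z\<^sup>2 + \<gamma>) / (of_real \<rho> * of_nat m ^ 2 * z + of_nat m ^ 4)
        * (exp (z * of_real T) / of_real (lift_coeff m))
     * (\<Sum>n<\<nu>. (- char_poly \<rho> \<gamma> m z) ^ n * Y z n $ l)"
  by (simp add: moment_symbol_def)

lemma moment_symbol_holomorphic:
  fixes Y :: "complex \<Rightarrow> nat \<Rightarrow> complex ^ 'l"
  assumes "1 \<le> m" and Y: "\<And>n l. (\<lambda>z. Y z n $ l) holomorphic_on S"
    and pole: "\<And>z. z \<in> S \<Longrightarrow> of_real \<rho> * of_nat m ^ 2 * z + of_nat m ^ 4 \<noteq> 0"
  shows "(\<lambda>z. moment_symbol T \<rho> \<gamma> m \<nu> Y z $ l) holomorphic_on S"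
  unfolding moment_symbol_component char_poly_def
  by (intro holomorphic_intros Y pole) (simp_all add: lift_coeff_nonzero \<open>1 \<le> m\<close>)

text \<open>
  At a root, \<open>z\<^sup>2 + \<gamma>\<close> and \<open>\<rho> m\<^sup>2 z + m\<^sup>4\<close> are opposite numbers, so nonresonance says that
  \<open>moment_symbol\<close> has no pole there.
\<close>

lemma pole_not_root:
  assumes "\<sigma> \<in> root_labels \<rho> \<gamma> m" "(temporal_root \<rho> \<gamma> m \<sigma>)\<^sup>2 + \<gamma> \<noteq> 0"
  shows "of_real \<rho> * of_nat m ^ 2 * temporal_root \<rho> \<gamma> m \<sigma> + of_nat m ^ 4 \<noteq> 0"
  using char_poly_add[of \<rho> \<gamma> m "temporal_root \<rho> \<gamma> m \<sigma>"] char_poly_root[OF assms(1)] assms(2)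
  by (metis add_0 neg_equal_0_iff_equal)

text \<open>
  The moment equations make the transform of \<open>F\<close> agree with \<open>moment_symbol\<close> to the order of \<open>p\<^sup>\<nu>\<close> at every
  root. Induction along the chain then removes the terminal states one after the other, by
  \<open>terminal_symbol_bigo\<close> and \<open>state_symbol_eq_0\<close>.
\<close>

lemma terminal_conditions:
  fixes \<beta> :: "nat \<Rightarrow> nat \<Rightarrow> complex ^ 'l" and f f1 f2 :: "real \<Rightarrow> complex ^ 'l"
    and d :: "nat \<Rightarrow> complex ^ 'l" and g m :: nat and r :: "nat \<Rightarrow> nat" and \<rho> :: real
    and a a1 b b1 :: "nat \<Rightarrow> nat \<Rightarrow> real \<Rightarrow> complex" and \<gamma> :: complex and c0 c1 :: "nat \<Rightarrow> nat \<Rightarrow> complex"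
  defines "Y \<equiv> \<lambda>z. chain_solution g r \<beta> d (\<lambda>k s. state_symbol \<rho> m (c0 k s) (c1 k s) z)"
  defines "F \<equiv> \<lambda>t. f2 t + \<gamma> *s f t"
  assumes "0 \<le> T" "1 \<le> m"
    and nonres: "\<And>\<sigma>. \<sigma> \<in> root_labels \<rho> \<gamma> m \<Longrightarrow> (temporal_root \<rho> \<gamma> m \<sigma>)\<^sup>2 + \<gamma> \<noteq> 0"
    and dual: "\<And>k k'. k \<in> {1..g} \<Longrightarrow> k' \<in> {1..g} \<Longrightarrow> herm (d k) (\<beta> k' 1) = (if k = k' then 1 else 0)"
    and k: "k \<in> {1..g}" and "\<beta> k 0 = 0" "r k \<le> \<nu>"
    and H: "H20_derivs T f f1 f2"
    and moments: "\<And>\<sigma> q. \<sigma> \<in> root_labels \<rho> \<gamma> m \<Longrightarrow> q < moment_count \<nu> \<sigma> \<Longrightarrow>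
      (LINT t|lebesgue_on {0..T}. moment_fun T (temporal_root \<rho> \<gamma> m \<sigma>) q t *s F t)
        = moment_target T \<rho> \<gamma> m \<nu> Y q \<sigma>"
    and a0: "\<And>t. t \<in> {0..T} \<Longrightarrow> a k 0 t = 0" and b0: "\<And>t. t \<in> {0..T} \<Longrightarrow> b k 0 t = 0"
    and a: "\<And>s. s \<in> {1..r k} \<Longrightarrow> modal_ivp T \<rho> \<gamma> m
        (\<lambda>t. - a k (s - 1) t - of_real (lift_coeff m) * (herm (F t) (\<beta> k s) + herm (f t) (\<beta> k (s - 1))))
        0 0 (a k s) (a1 k s)"
    and b: "\<And>s. s \<in> {1..r k} \<Longrightarrow> modal_ivp T \<rho> \<gamma> m (\<lambda>t. - b k (s - 1) t) (c0 k s) (c1 k s) (b k s) (b1 k s)"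
    and s: "s \<in> {1..r k}"
  shows "a k s T = - b k s T \<and> a1 k s T = - b1 k s T"
proof -
  let ?x = "complex_of_real (lift_coeff m)"
  have compF: "H20_derivs T (\<lambda>t. f t $ l) (\<lambda>t. f1 t $ l) (\<lambda>t. f2 t $ l)" for l
    by (rule H20_derivs_component[OF H])
  then have int_f: "integrable (lebesgue_on {0..T}) (\<lambda>t. f t $ l)"
    and int_F: "integrable (lebesgue_on {0..T}) (\<lambda>t. F t $ l)" for l
    using H2_derivs_integrable(1,3)[of T "\<lambda>t. f t $ l" "\<lambda>t. f1 t $ l" "\<lambda>t. f2 t $ l"]
    by (simp_all add: H20_derivs_def F_def)
  define Fh where "Fh z = (\<chi> l. exp_moment T (\<lambda>t. F t $ l) z)" for z
  define fh where "fh z = (\<chi> l. exp_moment T (\<lambda>t. f t $ l) z)" for z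
  have Ff: "Fh z = (z\<^sup>2 + \<gamma>) *s fh z" for z
    using exp_moment_control[OF \<open>0 \<le> T\<close> compF]
    by (simp add: Fh_def fh_def F_def vec_eq_iff distrib_right)
  (* Transform and terminal symbol of the full solution a + b. *)
  define w where "w s z = exp_moment T (a k s) z + exp_moment T (b k s) z" for s z
  define \<omega> where "\<omega> s = state_symbol \<rho> m (a k s T + b k s T) (a1 k s T + b1 k s T)" for s
  have int_ab: "integrable (lebesgue_on {0..T}) (a k s) \<and> integrable (lebesgue_on {0..T}) (b k s)"
    if "s \<le> r k" for s
  proof (cases "s = 0")
    case True
    have "integrable (lebesgue_on {0..T}) h" if "\<And>t. t \<in> {0..T} \<Longrightarrow> h t = 0" for h :: "real \<Rightarrow> complex"
      using Bochner_Integration.integrable_cong[of "lebesgue_on {0..T}" "lebesgue_on {0..T}" h "\<lambda>_. 0"] that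
      by simp
    then show ?thesis
      using a0 b0 unfolding True by blast
  next
    case False
    then show ?thesis
      using that a[of s] b[of s] H2_derivs_integrable(1) unfolding modal_ivp_def
      by (metis One_nat_def Suc_leI atLeastAtMost_iff not_gr_zero)
  qed
  have eq: "char_poly \<rho> \<gamma> m z * w (Suc i) z = - w i z
        - ?x * (herm (Fh z) (\<beta> k (Suc i)) + herm (fh z) (\<beta> k i))
        + exp (z * of_real T) * state_symbol \<rho> m (c0 k (Suc i)) (c1 k (Suc i)) z - \<omega> (Suc i) z"
    if "Suc i \<le> r k" for i z
  proof -
    have int_i: "integrable (lebesgue_on {0..T}) (a k i)" "integrable (lebesgue_on {0..T}) (b k i)"
      using int_ab[of i] that by auto
    note int_h = exp_moment_herm(2)[of T F, OF int_F] exp_moment_herm(2)[of T f, OF int_f]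
    have h_eq: "exp_moment T (\<lambda>t. - a k i t - ?x * (herm (F t) (\<beta> k (Suc i)) + herm (f t) (\<beta> k i))) z
        = - exp_moment T (a k i) z - ?x * (herm (Fh z) (\<beta> k (Suc i)) + herm (fh z) (\<beta> k i))"
      by (simp add: exp_moment_diff exp_moment_minus exp_moment_mult exp_moment_add int_i int_h
          exp_moment_herm(1)[of T F, OF int_F] exp_moment_herm(1)[of T f, OF int_f] Fh_def fh_def)
    have a_eq: "char_poly \<rho> \<gamma> m z * exp_moment T (a k (Suc i)) z
        = exp_moment T (\<lambda>t. - a k i t - ?x * (herm (F t) (\<beta> k (Suc i)) + herm (f t) (\<beta> k i))) z
          - state_symbol \<rho> m (a k (Suc i) T) (a1 k (Suc i) T) z
          + exp (z * of_real T) * state_symbol \<rho> m 0 0 z"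
      using a[of "Suc i"] that
      by (intro exp_moment_modal_ivp(1)[OF \<open>0 \<le> T\<close>]) (simp_all add: int_i int_h)
    have b_eq: "char_poly \<rho> \<gamma> m z * exp_moment T (b k (Suc i)) z
        = exp_moment T (\<lambda>t. - b k i t) z
          - state_symbol \<rho> m (b k (Suc i) T) (b1 k (Suc i) T) z
          + exp (z * of_real T) * state_symbol \<rho> m (c0 k (Suc i)) (c1 k (Suc i)) z"
      using b[of "Suc i"] that
      by (intro exp_moment_modal_ivp(1)[OF \<open>0 \<le> T\<close>]) (simp_all add: int_i)
    have \<omega>_eq: "\<omega> (Suc i) z = state_symbol \<rho> m (a k (Suc i) T) (a1 k (Suc i) T) z
        + state_symbol \<rho> m (b k (Suc i) T) (b1 k (Suc i) T) z"
      by (simp add: \<omega>_def state_symbol_def algebra_simps)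
    show ?thesis
      unfolding w_def distrib_left[of "char_poly \<rho> \<gamma> m z"] a_eq b_eq h_eq \<omega>_eq exp_moment_minus
      by (simp add: state_symbol_def[of _ _ 0 0] distrib_left)
  qed
  have w0: "w 0 z = 0" for z
  proof -
    have "exp_moment T (a k 0) z = exp_moment T (\<lambda>t. 0) z" "exp_moment T (b k 0) z = exp_moment T (\<lambda>t. 0) z"
      using a0 b0 by (intro exp_moment_cong; simp)+
    then show ?thesis by (simp add: w_def exp_moment_def)
  qed
  have Y_holo: "(\<lambda>z. Y z n $ l) holomorphic_on S" for n l S
    unfolding Y_def state_symbol_def by (intro chain_solution_holomorphic holomorphic_intros)
  have jet: "(\<lambda>z. Fh z $ l - moment_symbol T \<rho> \<gamma> m \<nu> Y z $ l)
      \<in> O[at (temporal_root \<rho> \<gamma> m \<sigma>)](\<lambda>z. char_poly \<rho> \<gamma> m z ^ \<nu>)"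
    if \<sigma>: "\<sigma> \<in> root_labels \<rho> \<gamma> m" for \<sigma> l
  proof -
    let ?\<mu> = "temporal_root \<rho> \<gamma> m \<sigma>" and ?n = "moment_count \<nu> \<sigma>"
    let ?G = "\<lambda>z. moment_symbol T \<rho> \<gamma> m \<nu> Y z $ l"
    let ?D = "{z. of_real \<rho> * of_nat m ^ 2 * z + of_nat m ^ 4 \<noteq> (0::complex)}"
    have "open ?D"
      by (intro open_Collect_neq continuous_intros)
    moreover have "?\<mu> \<in> ?D"
      using pole_not_root[OF \<sigma> nonres[OF \<sigma>]] by simp
    moreover have "?G holomorphic_on ?D"
      by (intro moment_symbol_holomorphic Y_holo \<open>1 \<le> m\<close>) auto
    ultimately have G: "(\<lambda>z. ?G z - (\<Sum>q<?n. (deriv ^^ q) ?G ?\<mu> / fact q * (z - ?\<mu>) ^ q))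
        \<in> O[at ?\<mu>](\<lambda>z. (z - ?\<mu>) ^ ?n)"
      by (intro analytic_jet)
    have mom: "(LINT t|lebesgue_on {0..T}. moment_fun T ?\<mu> q t * F t $ l) = (deriv ^^ q) ?G ?\<mu>"
      if "q < ?n" for q
    proof -
      have "continuous_on {0..T} (moment_fun T ?\<mu> q)"
        unfolding moment_fun_def by (intro continuous_intros)
      then have "integrable (lebesgue_on {0..T}) (\<lambda>t. (moment_fun T ?\<mu> q t *s F t) $ l)" for l
        using int_F by (simp add: integrable_continuous_mult)
      from integral_vec_component[OF this, of l] show ?thesis
        unfolding moments[OF \<sigma> that] moment_target_def by simp
    qed
    have poly: "(\<Sum>q<?n. (LINT t|lebesgue_on {0..T}. moment_fun T ?\<mu> q t * F t $ l) / fact q * (z - ?\<mu>) ^ q)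
        = (\<Sum>q<?n. (deriv ^^ q) ?G ?\<mu> / fact q * (z - ?\<mu>) ^ q)" for z
      by (intro sum.cong refl) (simp add: mom)
    have "(\<lambda>z. Fh z $ l - (\<Sum>q<?n. (LINT t|lebesgue_on {0..T}. moment_fun T ?\<mu> q t * F t $ l) / fact q
        * (z - ?\<mu>) ^ q)) \<in> O[at ?\<mu>](\<lambda>z. (z - ?\<mu>) ^ ?n)"
      using exp_moment_jet[OF \<open>0 \<le> T\<close> int_F[of l], where \<mu> = ?\<mu> and n = ?n] by (simp add: Fh_def)
    then have "(\<lambda>z. Fh z $ l - (\<Sum>q<?n. (deriv ^^ q) ?G ?\<mu> / fact q * (z - ?\<mu>) ^ q))
        \<in> O[at ?\<mu>](\<lambda>z. (z - ?\<mu>) ^ ?n)"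
      by (simp only: poly)
    from sum_in_bigo(2)[OF this G]
    have "(\<lambda>z. Fh z $ l - ?G z) \<in> O[at ?\<mu>](\<lambda>z. (z - ?\<mu>) ^ ?n)" by simp
    then show ?thesis by (rule landau_o.big_trans[OF _ char_poly_order[OF \<sigma>]])
  qed
  have "a k s T + b k s T = 0 \<and> a1 k s T + b1 k s T = 0" if "s \<in> {1..r k}" for s
    using that
  proof (induction s rule: less_induct)
    case (less s)
    have "\<omega> s \<in> O[at (temporal_root \<rho> \<gamma> m \<sigma>)](char_poly \<rho> \<gamma> m)" if \<sigma>: "\<sigma> \<in> root_labels \<rho> \<gamma> m" for \<sigma>
    proof (rule terminal_symbol_bigo[where \<beta> = "\<beta> k" and Y = Y and w = w and \<omega> = \<omega> and Fh = Fh and fh = fh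
          and \<nu> = \<nu> and U = "\<lambda>s. state_symbol \<rho> m (c0 k s) (c1 k s)", OF \<open>1 \<le> m\<close> char_poly_root[OF \<sigma>]
          nonres[OF \<sigma>] \<open>\<beta> k 0 = 0\<close> _ _ _ _ w0 _ _ _ Ff jet[OF \<sigma>]])
      show "0 < s" "s \<le> \<nu>" using less.prems \<open>r k \<le> \<nu>\<close> by auto
      show "isCont (\<lambda>z. Y z n $ l) (temporal_root \<rho> \<gamma> m \<sigma>)" for n l
        using holomorphic_on_imp_continuous_on[OF Y_holo[of n l UNIV]] continuous_on_eq_continuous_at by blast
      show "(\<Sum>i\<le>n. herm (Y z i) (\<beta> k (Suc n - i))) = state_symbol \<rho> m (c0 k (Suc n)) (c1 k (Suc n)) z"
        if "n < s" for z n
        unfolding Y_def using that less.prems by (intro chain_solution_correct dual k) auto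
      show "w s \<in> O[at (temporal_root \<rho> \<gamma> m \<sigma>)](\<lambda>_. 1)"
        unfolding w_def using int_ab[of s] less.prems
        by (intro sum_in_bigo exp_moment_bounded \<open>0 \<le> T\<close>) auto
      show "char_poly \<rho> \<gamma> m z * w (Suc i) z = - w i z
        - ?x * (herm (Fh z) (\<beta> k (Suc i)) + herm (fh z) (\<beta> k i))
        + exp (z * of_real T) * state_symbol \<rho> m (c0 k (Suc i)) (c1 k (Suc i)) z - \<omega> (Suc i) z" if "i < s" for i z
        using that less.prems by (intro eq) auto
      show "\<omega> (Suc i) z = 0" if "Suc i < s" for i z
        using less.IH[OF that] that less.prems by (simp add: \<omega>_def state_symbol_def)
    qed
    then show ?case
      unfolding \<omega>_def by (rule state_symbol_eq_0)
  qed
  from this[OF s] show ?thesis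
    by (simp add: eq_neg_iff_add_eq_0)
qed

section \<open>Location of the temporal roots\<close>

text \<open>
  For \<open>\<rho> < 2\<close> the real part of the discriminant is at most \<open>4 \<bar>\<gamma>\<bar>\<close> and its imaginary part does not depend
  on \<open>m\<close>, so the square root is imaginary up to a real part that is bounded uniformly in \<open>m\<close>.
\<close>

lemma temporal_root_Re_le:
  assumes "0 < \<rho>" "\<rho> < 2"
  shows "Re (temporal_root \<rho> \<gamma> m \<sigma>) \<le> - (\<rho> / 2) * (real m)\<^sup>2 + sqrt (6 * norm \<gamma>)"
proof -
  define D where "D = of_real \<rho> ^ 2 * of_nat m ^ 4 - 4 * (of_nat m ^ 4 + \<gamma>)"
  have D: "D = of_real ((\<rho>\<^sup>2 - 4) * real m ^ 4) - 4 * \<gamma>"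
    by (simp add: D_def algebra_simps)
  have "\<rho>\<^sup>2 \<le> 2\<^sup>2" using assms by (intro power_mono) auto
  then have "(\<rho>\<^sup>2 - 4) * real m ^ 4 \<le> 0" by (intro mult_nonpos_nonneg) auto
  then have "Re D \<le> 4 * norm \<gamma>" "\<bar>Im D\<bar> \<le> 4 * norm \<gamma>"
    using abs_Re_le_cmod[of \<gamma>] abs_Im_le_cmod[of \<gamma>] unfolding D by (auto simp: abs_mult)
  then have "norm D + Re D \<le> 12 * norm \<gamma>"
    using cmod_le[of D] norm_ge_zero[of \<gamma>] by linarith
  then have Re: "0 \<le> Re (csqrt D)" "Re (csqrt D) \<le> sqrt (6 * norm \<gamma>)"
    by (auto simp: Re_csqrt intro!: real_sqrt_le_mono simp del: csqrt.simps) (simp add: real_sqrt_le_mono)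
  have sq: "Re (of_real \<rho> * of_nat m ^ 2) = \<rho> * (real m)\<^sup>2"
    by (simp flip: of_nat_power)
  show ?thesis
  proof (cases \<sigma>)
    case Plus
    show ?thesis unfolding Plus temporal_root.simps D_def[symmetric]
      using Re sq by (simp del: csqrt.simps)
  next
    case Minus
    show ?thesis unfolding Minus temporal_root.simps D_def[symmetric]
      using Re sq by (simp del: csqrt.simps)
  next
    case Crit
    show ?thesis unfolding Crit temporal_root.simps
      using sq by simp
  qed
qed

lemma temporal_root_norm_le:
  assumes "0 < \<rho>"
  shows "norm (temporal_root \<rho> \<gamma> m \<sigma>) \<le> (6 + \<rho> + \<rho>\<^sup>2 + 4 * norm \<gamma>) * (1 + real m) ^ 4"
proof -
  define D where "D = of_real \<rho> ^ 2 * of_nat m ^ 4 - 4 * (of_nat m ^ 4 + \<gamma>)"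
  define X where "X = 1 + real m"
  have X: "1 \<le> X ^ 4" "real m ^ 4 \<le> X ^ 4" "(real m)\<^sup>2 \<le> X ^ 4"
  proof -
    show "1 \<le> X ^ 4" "real m ^ 4 \<le> X ^ 4"
      by (auto simp: X_def intro!: power_mono one_le_power)
    have "(real m)\<^sup>2 \<le> X\<^sup>2" "X\<^sup>2 \<le> X ^ 4"
      by (auto simp: X_def intro!: power_mono power_increasing)
    then show "(real m)\<^sup>2 \<le> X ^ 4" by linarith
  qed
  have "norm D \<le> norm (of_real \<rho> ^ 2 * of_nat m ^ 4 :: complex) + norm (4 * (of_nat m ^ 4 + \<gamma>))"
    unfolding D_def by (rule norm_triangle_ineq4)
  also have "\<dots> \<le> \<rho>\<^sup>2 * real m ^ 4 + 4 * (real m ^ 4 + norm \<gamma>)"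
  proof -
    have "norm (4 * (of_nat m ^ 4 + \<gamma>)) = 4 * norm (of_nat m ^ 4 + \<gamma>)"
      by (simp only: norm_mult norm_numeral)
    then show ?thesis
      using norm_triangle_ineq[of "of_nat m ^ 4" \<gamma>] by (simp add: norm_mult norm_power del: distrib_left_numeral)
  qed
  also have "\<dots> \<le> \<rho>\<^sup>2 * X ^ 4 + 4 * (X ^ 4 + norm \<gamma> * X ^ 4)"
    using X mult_left_mono[OF X(1), of "norm \<gamma>"] by (intro add_mono mult_left_mono) auto
  finally have D: "norm D \<le> (\<rho>\<^sup>2 + 4 + 4 * norm \<gamma>) * X ^ 4"
    by (simp add: algebra_simps)
  have "sqrt (norm D) \<le> 1 + norm D"
    by (rule real_le_lsqrt) (auto simp: power2_eq_square algebra_simps)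
  then have sqrtD: "norm (csqrt D) \<le> (\<rho>\<^sup>2 + 5 + 4 * norm \<gamma>) * X ^ 4"
    using D X(1) by (simp add: algebra_simps)
  have lin: "norm (of_real \<rho> * of_nat m ^ 2 :: complex) \<le> \<rho> * X ^ 4"
    using X(3) assms by (simp add: norm_mult norm_power)
  have "norm (temporal_root \<rho> \<gamma> m \<sigma>) \<le> norm (of_real \<rho> * of_nat m ^ 2 :: complex) + norm (csqrt D)"
  proof -
    have half: "norm (z / 2) \<le> u + v" if "norm z \<le> u + v" for z :: complex and u v
      by (simp add: norm_divide) (use that norm_ge_zero[of z] in linarith)
    show ?thesis
    proof (cases \<sigma>)
      case Plus
      show ?thesis unfolding Plus temporal_root.simps D_def[symmetric]
        by (intro half order.trans[OF norm_triangle_ineq]) simp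
    next
      case Minus
      show ?thesis unfolding Minus temporal_root.simps D_def[symmetric]
        by (intro half order.trans[OF norm_triangle_ineq4]) simp
    next
      case Crit
      show ?thesis unfolding Crit temporal_root.simps
        by (intro half) simp
    qed
  qed
  also have "\<dots> \<le> \<rho> * X ^ 4 + (\<rho>\<^sup>2 + 5 + 4 * norm \<gamma>) * X ^ 4"
    by (intro add_mono lin sqrtD)
  also have "\<dots> \<le> (6 + \<rho> + \<rho>\<^sup>2 + 4 * norm \<gamma>) * X ^ 4"
    using X(1) by (simp add: algebra_simps)
  finally show ?thesis unfolding X_def .
qed

lemma finite_root_labels: "finite (root_labels \<rho> \<gamma> m)"
  by (simp add: root_labels_def)

text \<open>
  If \<open>\<rho> \<lambda> = e - m\<^sup>2\<close> with \<open>\<bar>e\<bar> < 1\<close>, exactly one term \<open>m\<^sup>4\<close> survives in \<open>\<rho>\<^sup>2 p(\<lambda>) = 0\<close>, so it equals an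
  expression of order \<open>m\<^sup>2\<close>. Hence the pole can approach a root only for finitely many \<open>m\<close>.
\<close>

lemma pole_gap_large:
  assumes "1 \<le> m" "\<sigma> \<in> root_labels \<rho> \<gamma> m"
    and "norm (of_real \<rho> * temporal_root \<rho> \<gamma> m \<sigma> + of_nat m ^ 2) < 1"
  shows "real m \<le> 3 + \<rho>\<^sup>2 + \<rho>\<^sup>2 * norm \<gamma>"
proof -
  define M where "M = (of_nat m ^ 2 :: complex)"
  define e where "e = of_real \<rho> * temporal_root \<rho> \<gamma> m \<sigma> + M"
  have e: "norm e \<le> 1" using assms(3) by (simp add: e_def M_def)
  have "of_real \<rho> ^ 2 * char_poly \<rho> \<gamma> m (temporal_root \<rho> \<gamma> m \<sigma>) = 0"
    by (simp add: char_poly_root[OF assms(2)])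
  moreover have "of_real \<rho> ^ 2 * char_poly \<rho> \<gamma> m (temporal_root \<rho> \<gamma> m \<sigma>)
      = (e - M)\<^sup>2 + of_real \<rho> ^ 2 * M * (e - M) + of_real \<rho> ^ 2 * M\<^sup>2 + of_real \<rho> ^ 2 * \<gamma>"
    unfolding char_poly_def e_def M_def
    by (simp add: power2_eq_square power4_eq_xxxx algebra_simps)
  ultimately have "(e - M)\<^sup>2 + of_real \<rho> ^ 2 * M * (e - M) + of_real \<rho> ^ 2 * M\<^sup>2 + of_real \<rho> ^ 2 * \<gamma> = 0"
    by (simp only:)
  then have "M\<^sup>2 = 2 * e * M - e\<^sup>2 - of_real \<rho> ^ 2 * M * e - of_real \<rho> ^ 2 * \<gamma>"
    by (simp add: power2_eq_square algebra_simps)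
  then have "norm (M\<^sup>2) = norm (2 * e * M - e\<^sup>2 - of_real \<rho> ^ 2 * M * e - of_real \<rho> ^ 2 * \<gamma>)"
    by simp
  also have "\<dots> \<le> norm (2 * e * M) + norm (e\<^sup>2) + norm (of_real \<rho> ^ 2 * M * e) + norm (of_real \<rho> ^ 2 * \<gamma>)"
    by (meson norm_triangle_ineq4 order.trans add_right_mono)
  also have "\<dots> \<le> 2 * norm M + 1 + \<rho>\<^sup>2 * norm M + \<rho>\<^sup>2 * norm \<gamma>"
  proof (intro add_mono)
    show "norm (2 * e * M) \<le> 2 * norm M"
      using mult_right_mono[OF e norm_ge_zero[of M]] by (simp add: norm_mult)
    show "norm (e\<^sup>2) \<le> 1"
      using e by (simp add: norm_power power_le_one)
    show "norm (of_real \<rho> ^ 2 * M * e) \<le> \<rho>\<^sup>2 * norm M"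
      using mult_left_mono[OF e, of "\<rho>\<^sup>2 * norm M"] by (simp add: norm_mult norm_power)
  qed (simp add: norm_mult norm_power)
  finally have le: "norm M * norm M \<le> 2 * norm M + 1 + \<rho>\<^sup>2 * norm M + \<rho>\<^sup>2 * norm \<gamma>"
    by (simp add: norm_power power2_eq_square norm_mult)
  have normM: "norm M = real m * real m" by (simp add: M_def norm_power power2_eq_square norm_mult)
  have "1 \<le> real m" using assms(1) by simp
  then have M1: "real m \<le> norm M" "1 \<le> norm M"
    unfolding normM using mult_mono[of 1 "real m" 1 "real m"] mult_left_mono[of 1 "real m" "real m"] by auto
  have "\<rho>\<^sup>2 * norm \<gamma> \<le> \<rho>\<^sup>2 * norm \<gamma> * norm M"
    using M1(2) mult_left_mono[of 1 "norm M" "\<rho>\<^sup>2 * norm \<gamma>"] by simp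
  then have "norm M * norm M \<le> (3 + \<rho>\<^sup>2 + \<rho>\<^sup>2 * norm \<gamma>) * norm M"
    using le M1(2) by (simp add: algebra_simps)
  then have "norm M \<le> 3 + \<rho>\<^sup>2 + \<rho>\<^sup>2 * norm \<gamma>"
    using M1(2) by (meson mult_right_le_imp_le order.strict_trans2 zero_less_one)
  then show ?thesis using M1(1) by linarith
qed

text \<open>
  Nonresonance, which is a condition on each mode separately, becomes uniform in \<open>m\<close>: for large \<open>m\<close> by
  \<open>pole_gap_large\<close>, for the remaining ones as a minimum over finitely many roots.
\<close>

lemma pole_gap:
  assumes nonres: "\<And>m \<sigma>. 1 \<le> m \<Longrightarrow> \<sigma> \<in> root_labels \<rho> \<gamma> m \<Longrightarrow> (temporal_root \<rho> \<gamma> m \<sigma>)\<^sup>2 + \<gamma> \<noteq> 0"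
  obtains \<delta> where "0 < \<delta>" "\<And>m \<sigma>. 1 \<le> m \<Longrightarrow> \<sigma> \<in> root_labels \<rho> \<gamma> m \<Longrightarrow>
    \<delta> \<le> norm (of_real \<rho> * temporal_root \<rho> \<gamma> m \<sigma> + of_nat m ^ 2)"
proof
  let ?h = "\<lambda>m \<sigma>. norm (of_real \<rho> * temporal_root \<rho> \<gamma> m \<sigma> + of_nat m ^ 2)"
  define I where "I = (SIGMA m : {m. 1 \<le> m \<and> real m \<le> 3 + \<rho>\<^sup>2 + \<rho>\<^sup>2 * norm \<gamma>}. root_labels \<rho> \<gamma> m)"
  define \<delta> where "\<delta> = Min (insert 1 ((\<lambda>(m, \<sigma>). ?h m \<sigma>) ` I))"
  have "finite {m. real m \<le> 3 + \<rho>\<^sup>2 + \<rho>\<^sup>2 * norm \<gamma>}"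
  proof (rule finite_subset)
    show "{m. real m \<le> 3 + \<rho>\<^sup>2 + \<rho>\<^sup>2 * norm \<gamma>} \<subseteq> {..nat \<lfloor>3 + \<rho>\<^sup>2 + \<rho>\<^sup>2 * norm \<gamma>\<rfloor>}"
      by (auto simp: le_nat_floor)
  qed simp
  then have "finite {m. 1 \<le> m \<and> real m \<le> 3 + \<rho>\<^sup>2 + \<rho>\<^sup>2 * norm \<gamma>}"
    by (rule finite_subset[rotated]) auto
  then have fin: "finite I"
    unfolding I_def by (intro finite_SigmaI finite_root_labels)
  have pos: "0 < ?h m \<sigma>" if "1 \<le> m" "\<sigma> \<in> root_labels \<rho> \<gamma> m" for m \<sigma>
  proof -
    have "char_poly \<rho> \<gamma> m (temporal_root \<rho> \<gamma> m \<sigma>) - ((temporal_root \<rho> \<gamma> m \<sigma>)\<^sup>2 + \<gamma>)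
        = of_nat m ^ 2 * (of_real \<rho> * temporal_root \<rho> \<gamma> m \<sigma> + of_nat m ^ 2)"
      by (simp add: char_poly_def power2_eq_square power4_eq_xxxx algebra_simps)
    then have "of_nat m ^ 2 * (of_real \<rho> * temporal_root \<rho> \<gamma> m \<sigma> + of_nat m ^ 2) \<noteq> 0"
      using char_poly_root[OF that(2)] nonres[OF that] by (metis diff_0 neg_equal_0_iff_equal)
    then show ?thesis by (simp del: temporal_root.simps)
  qed
  show "0 < \<delta>"
    unfolding \<delta>_def using fin pos by (auto simp: I_def)
  show "\<delta> \<le> ?h m \<sigma>" if "1 \<le> m" "\<sigma> \<in> root_labels \<rho> \<gamma> m" for m \<sigma>
  proof (cases "?h m \<sigma> < 1")
    case True
    from pole_gap_large[OF that True] have "?h m \<sigma> \<in> (\<lambda>(m, \<sigma>). ?h m \<sigma>) ` I"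
      using that by (force simp: I_def)
    then show ?thesis unfolding \<delta>_def using fin by (intro Min_le) auto
  next
    case False
    then show ?thesis
      unfolding \<delta>_def using fin by (intro order.trans[OF Min_le[of _ 1]]) auto
  qed
qed

section \<open>Size of the initial data and of the moments\<close>

lemma sine_coeff_le_X_norm:
  assumes y: "y \<in> X_space s" and "0 \<le> s" "1 \<le> m"
  shows "norm (sine_coeff y m) \<le> X_norm s y"
proof -
  let ?f = "\<lambda>m. real (Suc m) powr (2 * s) * (cmod (sine_coeff y (Suc m)))\<^sup>2"
  have sum: "summable ?f" using y by (simp add: X_space_def)
  obtain n where n: "m = Suc n" using \<open>1 \<le> m\<close> by (cases m) auto
  have "1 \<le> real (Suc n) powr (2 * s)" using \<open>0 \<le> s\<close> by (intro ge_one_powr_ge_zero) auto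
  then have "(cmod (sine_coeff y m))\<^sup>2 \<le> ?f n"
    using mult_right_mono[of 1 "real (Suc n) powr (2 * s)" "(cmod (sine_coeff y m))\<^sup>2"] by (simp add: n)
  also have "?f n = sum ?f {n}" by simp
  also have "\<dots> \<le> suminf ?f"
    using sum by (intro sum_le_suminf) auto
  finally show ?thesis
    unfolding X_norm_def by (rule real_le_rsqrt)
qed

lemma modal_coeff_le_XN_norm:
  fixes u :: "real \<Rightarrow> complex ^ 'n"
  assumes u: "u \<in> XN_space s" and "0 \<le> s" "1 \<le> m"
  shows "norm (modal_coeff u v m) \<le> (\<Sum>i\<in>UNIV. norm (v $ i)) * XN_norm s u"
proof -
  have int: "integrable (lebesgue_on {0..pi}) (\<lambda>x. u x $ i * of_real (sine_mode m x))" for i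
  proof -
    have "integrable (lebesgue_on {0..pi}) (\<lambda>x. u x $ i)"
      using u by (intro L2_on_imp_integrable) (auto simp: XN_space_def X_space_def)
    moreover have "continuous_on {0..pi} (\<lambda>x. complex_of_real (sine_mode m x))"
      unfolding sine_mode_def by (intro continuous_intros)
    ultimately show ?thesis
      using integrable_continuous_mult[of 0 pi "\<lambda>x. complex_of_real (sine_mode m x)" "\<lambda>x. u x $ i"]
      by (simp add: mult.commute)
  qed
  have "modal_coeff u v m = (LINT x|lebesgue_on {0..pi}. (\<Sum>i\<in>UNIV. cnj (v $ i) * (u x $ i * of_real (sine_mode m x))))"
    unfolding modal_coeff_def herm_def sum_distrib_right by (simp add: mult_ac)
  also have "\<dots> = (\<Sum>i\<in>UNIV. cnj (v $ i) * sine_coeff (\<lambda>x. u x $ i) m)"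
    unfolding sine_coeff_def by (subst Bochner_Integration.integral_sum) (use int in auto)
  also have "norm \<dots> \<le> (\<Sum>i\<in>UNIV. norm (v $ i) * XN_norm s u)"
  proof (intro order.trans[OF norm_sum] sum_mono)
    fix i
    have "norm (sine_coeff (\<lambda>x. u x $ i) m) \<le> X_norm s (\<lambda>x. u x $ i)"
      using u \<open>0 \<le> s\<close> \<open>1 \<le> m\<close> by (intro sine_coeff_le_X_norm) (auto simp: XN_space_def)
    also have "\<dots> \<le> XN_norm s u"
      unfolding XN_norm_def by (intro real_le_rsqrt member_le_sum) auto
    finally show "norm (cnj (v $ i) * sine_coeff (\<lambda>x. u x $ i) m) \<le> norm (v $ i) * XN_norm s u"
      by (auto simp: norm_mult intro: mult_left_mono)
  qed
  finally show ?thesis by (simp add: sum_distrib_right)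
qed

text \<open>
  The radius of the disc is chosen so that the distance to the pole is at worst halved. Every factor
  of \<open>moment_symbol\<close> except the exponential is then at most a constant times a power of \<open>1 + m\<close>: \<open>8\<close> for \<open>z\<^sup>2 + \<gamma>\<close>, \<open>1\<close>
  for the inverse of \<open>lift_coeff m\<close>, \<open>8 \<nu>\<close> for the powers of \<open>p\<close>, and \<open>4\<close> for the data.
\<close>

lemma moment_symbol_bound:
  fixes \<beta> :: "nat \<Rightarrow> nat \<Rightarrow> complex ^ 'l"
  assumes "0 < T" "0 < \<rho>" "\<rho> < 2" "0 < \<delta>"
    and gap: "\<And>m \<sigma>. 1 \<le> m \<Longrightarrow> \<sigma> \<in> root_labels \<rho> \<gamma> m \<Longrightarrow>
      \<delta> \<le> norm (of_real \<rho> * temporal_root \<rho> \<gamma> m \<sigma> + of_nat m ^ 2)"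
  obtains C where "0 \<le> C"
    "\<And>m \<sigma> z c0 c1 E l. 1 \<le> m \<Longrightarrow> \<sigma> \<in> root_labels \<rho> \<gamma> m \<Longrightarrow>
       norm (z - temporal_root \<rho> \<gamma> m \<sigma>) \<le> min 1 (\<delta> / (2 * \<rho>)) \<Longrightarrow> 0 \<le> E \<Longrightarrow>
       (\<forall>k\<in>{1..g}. \<forall>s\<in>{1..r k}. norm (c0 k s) \<le> E \<and> norm (c1 k s) \<le> E) \<Longrightarrow>
       of_real \<rho> * of_nat m ^ 2 * z + of_nat m ^ 4 \<noteq> 0 \<and>
       norm (moment_symbol T \<rho> \<gamma> m \<nu>
           (\<lambda>z. chain_solution g r \<beta> d (\<lambda>k s. state_symbol \<rho> m (c0 k s) (c1 k s) z)) z $ l)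
         \<le> C * (1 + real m) ^ (8 * \<nu> + 13) * exp (- (\<rho> / 2) * (real m)\<^sup>2 * T) * E"
proof -
  obtain CY where CY: "0 \<le> CY" "\<And>U E n. 0 \<le> E \<Longrightarrow> (\<forall>k\<in>{1..g}. \<forall>s\<in>{1..r k}. norm (U k s) \<le> E) \<Longrightarrow>
      n < \<nu> \<Longrightarrow> norm (chain_solution g r \<beta> d U n) \<le> CY * E"
    using chain_solution_bound[of g r \<nu> \<beta> d] by blast
  (* Lz, Lp, LU: leading constants in the polynomial bounds for z, for p (and z^2 + gamma), for the data. *)
  define Lz where "Lz = 7 + \<rho> + \<rho>\<^sup>2 + 4 * norm \<gamma>"
  define Lp where "Lp = Lz\<^sup>2 + \<rho> * Lz + 1 + norm \<gamma>"
  define LU where "LU = 1 + Lz + \<rho>"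
  define K where "K = sqrt (6 * norm \<gamma>) + 1"
  define x0 where "x0 = sqrt (2 / pi)"
  have pos: "0 < Lz" "1 \<le> Lp" "0 < LU" "0 < x0"
    using \<open>0 < \<rho>\<close> by (auto simp: Lz_def Lp_def LU_def x0_def intro!: add_pos_nonneg add_nonneg_nonneg)
  define C where "C = Lp * (2 / \<delta>) * (exp (K * T) / x0) * (real \<nu> * (Lp ^ \<nu> * (CY * LU)))"
  have "0 \<le> C"
    unfolding C_def using pos CY(1) \<open>0 < \<delta>\<close> by (intro mult_nonneg_nonneg divide_nonneg_nonneg) auto
  moreover have "of_real \<rho> * of_nat m ^ 2 * z + of_nat m ^ 4 \<noteq> 0 \<and>
       norm (moment_symbol T \<rho> \<gamma> m \<nu>
           (\<lambda>z. chain_solution g r \<beta> d (\<lambda>k s. state_symbol \<rho> m (c0 k s) (c1 k s) z)) z $ l)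
         \<le> C * (1 + real m) ^ (8 * \<nu> + 13) * exp (- (\<rho> / 2) * (real m)\<^sup>2 * T) * E"
    if m: "1 \<le> m" and \<sigma>: "\<sigma> \<in> root_labels \<rho> \<gamma> m"
      and z: "norm (z - temporal_root \<rho> \<gamma> m \<sigma>) \<le> min 1 (\<delta> / (2 * \<rho>))" and "0 \<le> E"
      and E: "\<forall>k\<in>{1..g}. \<forall>s\<in>{1..r k}. norm (c0 k s) \<le> E \<and> norm (c1 k s) \<le> E"
    for m \<sigma> z c0 c1 E l
  proof -
    define \<mu> where "\<mu> = temporal_root \<rho> \<gamma> m \<sigma>"
    define X where "X = 1 + real m"
    have X: "1 \<le> X" "real m \<le> X" by (auto simp: X_def)
    have pw: "X ^ a \<le> X ^ b" if "a \<le> b" for a b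
      using X that by (intro power_increasing)
    have one_le: "1 \<le> X ^ a" for a
      using X by (simp add: one_le_power)
    have "norm z \<le> norm \<mu> + norm (z - \<mu>)"
      using norm_triangle_ineq[of \<mu> "z - \<mu>"] by simp
    also have "\<dots> \<le> (6 + \<rho> + \<rho>\<^sup>2 + 4 * norm \<gamma>) * X ^ 4 + 1"
      using temporal_root_norm_le[OF \<open>0 < \<rho>\<close>, of \<gamma> m \<sigma>] z by (simp add: X_def \<mu>_def)
    also have "\<dots> \<le> Lz * X ^ 4"
      using one_le[of 4] by (simp add: Lz_def algebra_simps)
    finally have norm_z: "norm z \<le> Lz * X ^ 4" .
    have m2: "(real m)\<^sup>2 \<le> X\<^sup>2" and m4: "real m ^ 4 \<le> X ^ 4"
      using X by (auto intro: power_mono)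
    have norm_z2: "norm (z\<^sup>2) \<le> Lz\<^sup>2 * X ^ 8"
    proof -
      have "norm (z\<^sup>2) \<le> (Lz * X ^ 4)\<^sup>2"
        unfolding norm_power by (intro power_mono norm_z) simp
      then show ?thesis by (simp add: power_mult_distrib flip: power_mult)
    qed
    have \<gamma>: "norm \<gamma> \<le> norm \<gamma> * X ^ 8"
      using mult_left_mono[OF one_le[of 8], of "norm \<gamma>"] by simp
    have norm_p: "norm (char_poly \<rho> \<gamma> m z) \<le> Lp * X ^ 8"
    proof -
      have "norm (of_real \<rho> * of_nat m ^ 2 * z) \<le> \<rho> * X\<^sup>2 * (Lz * X ^ 4)"
        unfolding norm_mult norm_power using m2 norm_z \<open>0 < \<rho>\<close> pos
        by (intro mult_mono) auto
      also have "\<dots> = \<rho> * Lz * X ^ 6" by (simp add: mult_ac flip: power_add)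
      also have "\<dots> \<le> \<rho> * Lz * X ^ 8" using pw[of 6 8] \<open>0 < \<rho>\<close> pos by (intro mult_left_mono) auto
      finally have 1: "norm (of_real \<rho> * of_nat m ^ 2 * z) \<le> \<rho> * Lz * X ^ 8" .
      have 2: "norm (of_nat m ^ 4 :: complex) \<le> X ^ 8"
        using m4 pw[of 4 8] by (simp add: norm_power)
      have "norm (char_poly \<rho> \<gamma> m z) \<le> norm (z\<^sup>2) + norm (of_real \<rho> * of_nat m ^ 2 * z)
          + norm (of_nat m ^ 4 :: complex) + norm \<gamma>"
        unfolding char_poly_def by (meson norm_triangle_ineq order.trans add_right_mono)
      also have "\<dots> \<le> Lz\<^sup>2 * X ^ 8 + \<rho> * Lz * X ^ 8 + X ^ 8 + norm \<gamma> * X ^ 8"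
        by (intro add_mono norm_z2 1 2 \<gamma>)
      finally show ?thesis by (simp add: Lp_def algebra_simps)
    qed
    have norm_S: "norm (z\<^sup>2 + \<gamma>) \<le> Lp * X ^ 8"
    proof -
      have "norm (z\<^sup>2 + \<gamma>) \<le> Lz\<^sup>2 * X ^ 8 + norm \<gamma> * X ^ 8"
        by (intro order.trans[OF norm_triangle_ineq] add_mono norm_z2 \<gamma>)
      also have "\<dots> \<le> Lp * X ^ 8"
        using \<open>0 < \<rho>\<close> pos one_le[of 8] by (simp add: Lp_def algebra_simps)
      finally show ?thesis .
    qed
    have norm_q: "\<delta> / 2 \<le> norm (of_real \<rho> * of_nat m ^ 2 * z + of_nat m ^ 4)"
    proof -
      have "norm (of_real \<rho> * (z - \<mu>)) \<le> \<rho> * (\<delta> / (2 * \<rho>))"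
        unfolding norm_mult using z \<open>0 < \<rho>\<close> by (intro mult_mono) (auto simp: \<mu>_def)
      then have "norm (of_real \<rho> * (z - \<mu>)) \<le> \<delta> / 2" using \<open>0 < \<rho>\<close> by simp
      moreover have "\<delta> \<le> norm (of_real \<rho> * \<mu> + of_nat m ^ 2)"
        unfolding \<mu>_def by (rule gap[OF m \<sigma>])
      moreover have shift: "of_real \<rho> * z + of_nat m ^ 2 = (of_real \<rho> * \<mu> + of_nat m ^ 2) + of_real \<rho> * (z - \<mu>)"
        by (simp add: algebra_simps)
      ultimately have half: "\<delta> / 2 \<le> norm (of_real \<rho> * z + of_nat m ^ 2)"
        using norm_diff_ineq[of "of_real \<rho> * \<mu> + of_nat m ^ 2" "of_real \<rho> * (z - \<mu>)"]
        unfolding shift by linarith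
      have "1 * (\<delta> / 2) \<le> (real m)\<^sup>2 * norm (of_real \<rho> * z + of_nat m ^ 2)"
        using m half \<open>0 < \<delta>\<close> by (intro mult_mono) auto
      also have "\<dots> = norm (of_nat m ^ 2 * (of_real \<rho> * z + of_nat m ^ 2))"
        by (simp add: norm_mult norm_power)
      also have "of_nat m ^ 2 * (of_real \<rho> * z + of_nat m ^ 2) = of_real \<rho> * of_nat m ^ 2 * z + of_nat m ^ 4"
        by (simp add: algebra_simps power2_eq_square power4_eq_xxxx)
      finally show ?thesis by simp
    qed
    have norm_e: "norm (exp (z * of_real T)) \<le> exp (- (\<rho> / 2) * (real m)\<^sup>2 * T) * exp (K * T)"
    proof -
      have "Re z \<le> Re \<mu> + norm (z - \<mu>)"
        using complex_Re_le_cmod[of "z - \<mu>"] by simp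
      also have "\<dots> \<le> - (\<rho> / 2) * (real m)\<^sup>2 + K"
        using temporal_root_Re_le[OF \<open>0 < \<rho>\<close> \<open>\<rho> < 2\<close>, of \<gamma> m \<sigma>] z by (simp add: \<mu>_def K_def)
      finally have "Re z * T \<le> (- (\<rho> / 2) * (real m)\<^sup>2 + K) * T"
        using \<open>0 < T\<close> by (intro mult_right_mono) auto
      then show ?thesis by (simp add: algebra_simps flip: exp_add)
    qed
    have norm_x: "norm (complex_of_real (lift_coeff m)) = x0 / real m"
      using m by (simp add: lift_coeff_def x0_def norm_mult norm_divide norm_power)
    let ?U = "\<lambda>k s. state_symbol \<rho> m (c0 k s) (c1 k s) z"
    have norm_U: "norm (?U k s) \<le> LU * X ^ 4 * E" if "k \<in> {1..g}" "s \<in> {1..r k}" for k s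
    proof -
      have c: "norm (c0 k s) \<le> E" "norm (c1 k s) \<le> E" using E that by auto
      have "norm (z + of_real \<rho> * of_nat m ^ 2) \<le> Lz * X ^ 4 + \<rho> * X ^ 4"
      proof (intro order.trans[OF norm_triangle_ineq] add_mono norm_z)
        have "(real m)\<^sup>2 \<le> X ^ 4" using m2 pw[of 2 4] by linarith
        then show "norm (complex_of_real \<rho> * of_nat m ^ 2) \<le> \<rho> * X ^ 4"
          using \<open>0 < \<rho>\<close> by (simp add: norm_mult norm_power)
      qed
      then have "norm ((z + of_real \<rho> * of_nat m ^ 2) * c0 k s) \<le> (Lz * X ^ 4 + \<rho> * X ^ 4) * E"
        unfolding norm_mult using c(1) \<open>0 \<le> E\<close> pos \<open>0 < \<rho>\<close> X
        by (intro mult_mono) auto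
      moreover have "norm (c1 k s) \<le> X ^ 4 * E"
        using c(2) mult_right_mono[OF one_le[of 4] \<open>0 \<le> E\<close>] by simp
      ultimately have "norm (?U k s) \<le> X ^ 4 * E + (Lz * X ^ 4 + \<rho> * X ^ 4) * E"
        unfolding state_symbol_def by (intro order.trans[OF norm_triangle_ineq] add_mono)
      then show ?thesis by (simp add: LU_def algebra_simps)
    qed
    have "0 \<le> LU * X ^ 4 * E" using pos X \<open>0 \<le> E\<close> by auto
    then have norm_Y: "norm (chain_solution g r \<beta> d ?U n $ l) \<le> CY * (LU * X ^ 4 * E)" if "n < \<nu>" for n
      using CY(2)[of "LU * X ^ 4 * E" ?U n] norm_U that
      by (intro order.trans[OF Finite_Cartesian_Product.norm_nth_le]) auto
    have "1 \<le> Lp * X ^ 8" using mult_mono[OF pos(2) one_le[of 8]] pos by simp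
    have norm_V: "norm (\<Sum>n<\<nu>. (- char_poly \<rho> \<gamma> m z) ^ n * chain_solution g r \<beta> d ?U n $ l)
        \<le> real \<nu> * ((Lp * X ^ 8) ^ \<nu> * (CY * (LU * X ^ 4 * E)))"
    proof -
      have "norm (\<Sum>n<\<nu>. (- char_poly \<rho> \<gamma> m z) ^ n * chain_solution g r \<beta> d ?U n $ l)
          \<le> (\<Sum>n<\<nu>. (Lp * X ^ 8) ^ \<nu> * (CY * (LU * X ^ 4 * E)))"
      proof (intro order.trans[OF norm_sum] sum_mono)
        fix n assume n: "n \<in> {..<\<nu>}"
        have "norm ((- char_poly \<rho> \<gamma> m z) ^ n) \<le> (Lp * X ^ 8) ^ n"
          unfolding norm_power norm_minus_cancel by (intro power_mono norm_p) simp
        also have "\<dots> \<le> (Lp * X ^ 8) ^ \<nu>"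
          using n \<open>1 \<le> Lp * X ^ 8\<close> by (intro power_increasing) auto
        finally show "norm ((- char_poly \<rho> \<gamma> m z) ^ n * chain_solution g r \<beta> d ?U n $ l)
            \<le> (Lp * X ^ 8) ^ \<nu> * (CY * (LU * X ^ 4 * E))"
          unfolding norm_mult using n norm_Y[of n] \<open>1 \<le> Lp * X ^ 8\<close> by (intro mult_mono) auto
      qed
      then show ?thesis by simp
    qed
    have "norm (moment_symbol T \<rho> \<gamma> m \<nu>
           (\<lambda>z. chain_solution g r \<beta> d (\<lambda>k s. state_symbol \<rho> m (c0 k s) (c1 k s) z)) z $ l)
        = norm (z\<^sup>2 + \<gamma>) / norm (of_real \<rho> * of_nat m ^ 2 * z + of_nat m ^ 4)
          * (norm (exp (z * of_real T)) / (x0 / real m))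
          * norm (\<Sum>n<\<nu>. (- char_poly \<rho> \<gamma> m z) ^ n * chain_solution g r \<beta> d ?U n $ l)"
      unfolding moment_symbol_component norm_mult norm_divide norm_x norm_minus_cancel ..
    also have "\<dots> \<le> (Lp * X ^ 8 / (\<delta> / 2))
          * ((exp (- (\<rho> / 2) * (real m)\<^sup>2 * T) * exp (K * T)) / (x0 / X))
          * (real \<nu> * ((Lp * X ^ 8) ^ \<nu> * (CY * (LU * X ^ 4 * E))))"
      using pos X m \<open>0 < \<delta>\<close> \<open>1 \<le> Lp * X ^ 8\<close>
      by (intro mult_mono frac_le norm_V norm_S norm_q norm_e divide_nonneg_nonneg mult_nonneg_nonneg
          divide_left_mono) auto
    also have "\<dots> = C * (X ^ 8 * X * X ^ (8 * \<nu>) * X ^ 4) * exp (- (\<rho> / 2) * (real m)\<^sup>2 * T) * E"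
      unfolding C_def power_mult_distrib power_mult using pos(4) X by (simp add: field_simps)
    also have "X ^ 8 * X * X ^ (8 * \<nu>) * X ^ 4 = X ^ (8 * \<nu> + 13)"
    proof -
      have "X ^ 8 * X * X ^ (8 * \<nu>) * X ^ 4 = X ^ 8 * X ^ 1 * X ^ (8 * \<nu>) * X ^ 4" by simp
      also have "\<dots> = X ^ (8 * \<nu> + 13)" unfolding power_add[symmetric] by (simp add: add_ac)
      finally show ?thesis .
    qed
    finally have "norm (moment_symbol T \<rho> \<gamma> m \<nu>
           (\<lambda>z. chain_solution g r \<beta> d (\<lambda>k s. state_symbol \<rho> m (c0 k s) (c1 k s) z)) z $ l)
         \<le> C * X ^ (8 * \<nu> + 13) * exp (- (\<rho> / 2) * (real m)\<^sup>2 * T) * E" .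
    moreover have "of_real \<rho> * of_nat m ^ 2 * z + of_nat m ^ 4 \<noteq> 0"
      using norm_q \<open>0 < \<delta>\<close> by auto
    ultimately show ?thesis by (simp add: X_def)
  qed
  ultimately show ?thesis using that by blast
qed

lemma norm_vec_le_sum: "norm v \<le> (\<Sum>l\<in>UNIV. norm (v $ l))" for v :: "complex ^ 'l"
  unfolding norm_vec_def by (intro L2_set_le_sum) simp

text \<open>
  Cauchy's inequality on the discs of \<open>moment_symbol_bound\<close>, whose common radius \<open>R\<close> is independent of \<open>m\<close>. As
  \<open>R \<le> 1\<close> and every order \<open>q\<close> is below \<open>2 \<nu>\<close>, one constant serves all derivatives.
\<close>

lemma moment_target_bound:
  fixes \<beta> :: "nat \<Rightarrow> nat \<Rightarrow> complex ^ 'l"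
  assumes "0 < T" "0 < \<rho>" "\<rho> < 2"
    and nonres: "\<And>m \<sigma>. 1 \<le> m \<Longrightarrow> \<sigma> \<in> root_labels \<rho> \<gamma> m \<Longrightarrow> (temporal_root \<rho> \<gamma> m \<sigma>)\<^sup>2 + \<gamma> \<noteq> 0"
  shows "\<exists>C\<ge>0. \<forall>m \<sigma> q c0 c1 E. 1 \<le> m \<longrightarrow> \<sigma> \<in> root_labels \<rho> \<gamma> m \<longrightarrow> q < moment_count \<nu> \<sigma> \<longrightarrow> 0 \<le> E \<longrightarrow>
       (\<forall>k\<in>{1..g}. \<forall>s\<in>{1..r k}. norm (c0 k s) \<le> E \<and> norm (c1 k s) \<le> E) \<longrightarrow>
       norm (moment_target T \<rho> \<gamma> m \<nu>
           (\<lambda>z. chain_solution g r \<beta> d (\<lambda>k s. state_symbol \<rho> m (c0 k s) (c1 k s) z)) q \<sigma>)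
         \<le> C * (1 + real m) ^ (8 * \<nu> + 13) * exp (- (\<rho> / 2) * (real m)\<^sup>2 * T) * E"
proof -
  obtain \<delta> where "0 < \<delta>" and gap: "\<And>m \<sigma>. 1 \<le> m \<Longrightarrow> \<sigma> \<in> root_labels \<rho> \<gamma> m \<Longrightarrow>
    \<delta> \<le> norm (of_real \<rho> * temporal_root \<rho> \<gamma> m \<sigma> + of_nat m ^ 2)"
    using pole_gap[of \<rho> \<gamma>] nonres by blast
  define R where "R = min 1 (\<delta> / (2 * \<rho>))"
  have R: "0 < R" "R \<le> 1" using \<open>0 < \<delta>\<close> \<open>0 < \<rho>\<close> by (auto simp: R_def)
  obtain C where "0 \<le> C" and C: "\<And>m \<sigma> z c0 c1 E l. 1 \<le> m \<Longrightarrow> \<sigma> \<in> root_labels \<rho> \<gamma> m \<Longrightarrow>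
       norm (z - temporal_root \<rho> \<gamma> m \<sigma>) \<le> R \<Longrightarrow> 0 \<le> E \<Longrightarrow>
       (\<forall>k\<in>{1..g}. \<forall>s\<in>{1..r k}. norm (c0 k s) \<le> E \<and> norm (c1 k s) \<le> E) \<Longrightarrow>
       of_real \<rho> * of_nat m ^ 2 * z + of_nat m ^ 4 \<noteq> 0 \<and>
       norm (moment_symbol T \<rho> \<gamma> m \<nu>
           (\<lambda>z. chain_solution g r \<beta> d (\<lambda>k s. state_symbol \<rho> m (c0 k s) (c1 k s) z)) z $ l)
         \<le> C * (1 + real m) ^ (8 * \<nu> + 13) * exp (- (\<rho> / 2) * (real m)\<^sup>2 * T) * E"
    unfolding R_def
    by (rule moment_symbol_bound[where g = g and r = r and \<beta> = \<beta> and d = d and \<nu> = \<nu>,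
          OF assms(1-3) \<open>0 < \<delta>\<close> gap]) blast+
  define C' where "C' = real CARD('l) * (fact (2 * \<nu>) / R ^ (2 * \<nu>)) * C"
  have "norm (moment_target T \<rho> \<gamma> m \<nu>
           (\<lambda>z. chain_solution g r \<beta> d (\<lambda>k s. state_symbol \<rho> m (c0 k s) (c1 k s) z)) q \<sigma>)
         \<le> C' * (1 + real m) ^ (8 * \<nu> + 13) * exp (- (\<rho> / 2) * (real m)\<^sup>2 * T) * E"
    if m: "1 \<le> m" and \<sigma>: "\<sigma> \<in> root_labels \<rho> \<gamma> m" and q: "q < moment_count \<nu> \<sigma>" and "0 \<le> E"
      and E: "\<forall>k\<in>{1..g}. \<forall>s\<in>{1..r k}. norm (c0 k s) \<le> E \<and> norm (c1 k s) \<le> E" for m \<sigma> q c0 c1 E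
  proof -
    define Y where "Y = (\<lambda>z. chain_solution g r \<beta> d (\<lambda>k s. state_symbol \<rho> m (c0 k s) (c1 k s) z))"
    let ?\<mu> = "temporal_root \<rho> \<gamma> m \<sigma>"
    let ?G = "\<lambda>l z. moment_symbol T \<rho> \<gamma> m \<nu> Y z $ l"
    define Bd where "Bd = C * (1 + real m) ^ (8 * \<nu> + 13) * exp (- (\<rho> / 2) * (real m)\<^sup>2 * T) * E"
    have "0 \<le> Bd" using \<open>0 \<le> C\<close> \<open>0 \<le> E\<close> by (simp add: Bd_def)
    have bound: "of_real \<rho> * of_nat m ^ 2 * z + of_nat m ^ 4 \<noteq> 0" "norm (?G l z) \<le> Bd"
      if "norm (z - ?\<mu>) \<le> R" for z l
      using C[OF m \<sigma> that \<open>0 \<le> E\<close> E] by (simp_all add: Y_def Bd_def)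
    have "(\<lambda>z. Y z n $ l) holomorphic_on S" for n l S
      unfolding Y_def state_symbol_def by (intro chain_solution_holomorphic holomorphic_intros)
    then have holo: "?G l holomorphic_on cball ?\<mu> R" for l
      using bound(1) by (intro moment_symbol_holomorphic m) (auto simp: dist_norm norm_minus_commute)
    have comp: "norm ((deriv ^^ q) (?G l) ?\<mu>) \<le> fact (2 * \<nu>) / R ^ (2 * \<nu>) * Bd" for l
    proof -
      have "norm ((deriv ^^ q) (?G l) ?\<mu>) \<le> fact q * Bd / R ^ q"
      proof (rule Cauchy_inequality)
        show "?G l holomorphic_on ball ?\<mu> R"
          by (rule holomorphic_on_subset[OF holo]) auto
        show "continuous_on (cball ?\<mu> R) (?G l)"
          by (rule holomorphic_on_imp_continuous_on[OF holo])
        show "norm (?G l z) \<le> Bd" if "norm (?\<mu> - z) = R" for z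
          using that by (intro bound(2)) (simp add: norm_minus_commute)
      qed (fact R)
      also have "\<dots> = fact q / R ^ q * Bd" by simp
      also have "\<dots> \<le> fact (2 * \<nu>) / R ^ (2 * \<nu>) * Bd"
      proof -
        have "q \<le> 2 * \<nu>" using q by (cases \<sigma>) auto
        then show ?thesis
          using R \<open>0 \<le> Bd\<close> by (intro mult_right_mono frac_le fact_mono power_decreasing) auto
      qed
      finally show ?thesis .
    qed
    have "norm (moment_target T \<rho> \<gamma> m \<nu> Y q \<sigma>) \<le> (\<Sum>l\<in>UNIV. norm (moment_target T \<rho> \<gamma> m \<nu> Y q \<sigma> $ l))"
      by (rule norm_vec_le_sum)
    also have "\<dots> \<le> (\<Sum>l\<in>(UNIV :: 'l set). fact (2 * \<nu>) / R ^ (2 * \<nu>) * Bd)"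
      by (intro sum_mono) (simp only: moment_target_def vec_lambda_beta comp)
    also have "\<dots> = C' * (1 + real m) ^ (8 * \<nu> + 13) * exp (- (\<rho> / 2) * (real m)\<^sup>2 * T) * E"
      by (simp add: C'_def Bd_def)
    finally show ?thesis unfolding Y_def .
  qed
  moreover have "0 \<le> C'" using \<open>0 \<le> C\<close> R by (simp add: C'_def)
  ultimately show ?thesis by blast
qed

section \<open>Moment problem for the terminal conditions\<close>

theorem proposition8:
  fixes T \<rho> :: real
    and A :: "complex ^ 'n ^ 'n"
    and B :: "complex ^ 'l ^ 'n"
    and p0 :: nat
    and \<gamma> :: "nat \<Rightarrow> complex"
    and g :: "nat \<Rightarrow> nat"
    and r :: "nat \<Rightarrow> nat \<Rightarrow> nat"
    and \<psi> :: "nat \<Rightarrow> nat \<Rightarrow> nat \<Rightarrow> complex ^ 'n"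
  assumes "T > 0" and "0 < \<rho>" and "\<rho> < 2"
    and "jordan_structure A p0 \<gamma> g r"
    and "jordan_chain_basis (conj_transpose A) p0 (\<lambda>j. cnj (\<gamma> j)) g r \<psi>"
    and rank_cond: "\<forall>\<mu>\<in>eigenvalues A. rank (block_row (mat \<mu> - A) B) = CARD('n)"
    and separation: "\<forall>j\<in>{1..p0}. \<forall>k\<in>{1..p0}. \<forall>m\<ge>1. \<forall>n\<ge>1.
        \<forall>\<sigma>\<in>{Plus, Minus}. \<forall>\<eta>\<in>{Plus, Minus}. (j, m) \<noteq> (k, n) \<longrightarrow>
          temporal_root \<rho> (\<gamma> j) m \<sigma> \<noteq> temporal_root \<rho> (\<gamma> k) n \<eta>"
    and nonresonance: "\<forall>j\<in>{1..p0}. \<forall>m\<ge>1. \<forall>\<sigma>\<in>root_labels \<rho> (\<gamma> j) m.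
        (temporal_root \<rho> (\<gamma> j) m \<sigma>)\<^sup>2 + \<gamma> j \<noteq> 0"
  shows "\<exists>C P c :: real. C > 0 \<and> P \<ge> 0 \<and> c > 0 \<and>
    (\<forall>u0\<in>XN_space 3. \<forall>u1\<in>XN_space 1.
      \<exists>\<zeta> :: nat \<Rightarrow> nat \<Rightarrow> nat \<Rightarrow> root_label \<Rightarrow> complex ^ 'l.
        (\<forall>f f1 f2. H20_derivs T f f1 f2 \<longrightarrow>
          (\<forall>j\<in>{1..p0}. \<forall>m\<ge>1. \<forall>\<sigma>\<in>root_labels \<rho> (\<gamma> j) m.
             \<forall>q<moment_count (max_block g r j) \<sigma>.
               (LINT t|lebesgue_on {0..T}.
                  moment_fun T (temporal_root \<rho> (\<gamma> j) m \<sigma>) q t *s (f2 t + \<gamma> j *s f t))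
                 = \<zeta> j q m \<sigma>) \<longrightarrow>
          (\<forall>a a1 b b1.
             control_coeffs T \<rho> B p0 \<gamma> g r \<psi> f f2 a a1 \<longrightarrow>
             free_coeffs T \<rho> p0 \<gamma> g r \<psi> u0 u1 b b1 \<longrightarrow>
             (\<forall>j\<in>{1..p0}. \<forall>k\<in>{1..g j}. \<forall>s\<in>{1..r j k}. \<forall>m\<ge>1.
                a j k s m T = - b j k s m T \<and> a1 j k s m T = - b1 j k s m T))) \<and>
        (\<forall>j\<in>{1..p0}. \<forall>m\<ge>1. \<forall>\<sigma>\<in>root_labels \<rho> (\<gamma> j) m.
           \<forall>q<moment_count (max_block g r j) \<sigma>.
             norm (\<zeta> j q m \<sigma>)
               \<le> C * (1 + real m) powr P * exp (- c * (real m)\<^sup>2 * T)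
                   * (XN_norm 3 u0 + XN_norm 1 u1)))"
proof -
  define \<beta> where "\<beta> j k s = conj_transpose B *v \<psi> j k s" for j k s
  define \<nu> where "\<nu> = max_block g r"
  have r_le: "r j k \<le> \<nu> j" if "k \<in> {1..g j}" for j k
    unfolding \<nu>_def max_block_def using that by (intro Max_ge) auto
  have \<beta>0: "\<beta> j k 0 = 0" if "j \<in> {1..p0}" "k \<in> {1..g j}" for j k
  proof -
    have "\<psi> j k 0 = 0" using assms(5) that by (simp add: jordan_chain_basis_def)
    then show ?thesis by (simp add: \<beta>_def)
  qed
  have "\<exists>d. \<forall>k\<in>{1..g j}. \<forall>k'\<in>{1..g j}. herm (d k) (\<beta> j k' 1) = (if k = k' then 1 else 0)"
    if j: "j \<in> {1..p0}" for j
  proof (rule herm_dual_family)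
    fix c k assume zero: "(\<Sum>k\<in>{1..g j}. c k *s \<beta> j k 1) = 0" and k: "k \<in> {1..g j}"
    have "\<gamma> j \<in> eigenvalues A"
      using assms(4) j bij_betwE unfolding jordan_structure_def by blast
    then have rank: "rank (block_row (mat (\<gamma> j) - A) B) = CARD('n)" using rank_cond by blast
    have "1 \<le> r j k" if "k \<in> {1..g j}" for k
      using assms(4) j that unfolding jordan_structure_def by blast
    from observed_eigenvectors_independent[OF rank assms(5) j this zero[unfolded \<beta>_def] k]
    show "c k = 0" .
  qed simp
  then obtain d where d: "\<And>j k k'. j \<in> {1..p0} \<Longrightarrow> k \<in> {1..g j} \<Longrightarrow> k' \<in> {1..g j} \<Longrightarrow>
      herm (d j k) (\<beta> j k' 1) = (if k = k' then 1 else 0)"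
    by metis
  define target where "target c0 c1 j m =
      moment_target T \<rho> (\<gamma> j) m (\<nu> j)
           (\<lambda>z. chain_solution (g j) (r j) (\<beta> j) (d j) (\<lambda>k s. state_symbol \<rho> m (c0 k s) (c1 k s) z))"
    for c0 c1 :: "nat \<Rightarrow> nat \<Rightarrow> complex" and j m
  have "\<exists>C\<ge>0. \<forall>m \<sigma> q c0 c1 E. 1 \<le> m \<longrightarrow> \<sigma> \<in> root_labels \<rho> (\<gamma> j) m \<longrightarrow>
       q < moment_count (\<nu> j) \<sigma> \<longrightarrow> 0 \<le> E \<longrightarrow>
       (\<forall>k\<in>{1..g j}. \<forall>s\<in>{1..r j k}. norm (c0 k s) \<le> E \<and> norm (c1 k s) \<le> E) \<longrightarrow>
       norm (target c0 c1 j m q \<sigma>)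
         \<le> C * (1 + real m) ^ (8 * \<nu> j + 13) * exp (- (\<rho> / 2) * (real m)\<^sup>2 * T) * E"
    if "j \<in> {1..p0}" for j
    unfolding target_def using nonresonance that
    by (intro moment_target_bound assms(1-3)) blast
  then obtain Cj where Cj: "\<And>j. j \<in> {1..p0} \<Longrightarrow> 0 \<le> Cj j"
    "\<And>j m \<sigma> q c0 c1 E. j \<in> {1..p0} \<Longrightarrow> 1 \<le> m \<Longrightarrow> \<sigma> \<in> root_labels \<rho> (\<gamma> j) m \<Longrightarrow>
       q < moment_count (\<nu> j) \<sigma> \<Longrightarrow> 0 \<le> E \<Longrightarrow>
       (\<forall>k\<in>{1..g j}. \<forall>s\<in>{1..r j k}. norm (c0 k s) \<le> E \<and> norm (c1 k s) \<le> E) \<Longrightarrow>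
       norm (target c0 c1 j m q \<sigma>)
         \<le> Cj j * (1 + real m) ^ (8 * \<nu> j + 13) * exp (- (\<rho> / 2) * (real m)\<^sup>2 * T) * E"
    by metis
  (* M converts the norms of the initial data into a bound on all their modal coefficients. *)
  define M where "M = (\<Sum>(j, k, s)\<in>chain_indices p0 g r. \<Sum>i\<in>UNIV. norm (\<psi> j k s $ i))"
  have finite_idx: "finite (chain_indices p0 g r)"
  proof (rule finite_subset)
    show "chain_indices p0 g r \<subseteq> (SIGMA j : {1..p0}. SIGMA k : {1..g j}. {1..r j k})"
      by (auto simp: chain_indices_def)
  qed auto
  have M_ge: "(\<Sum>i\<in>UNIV. norm (\<psi> j k s $ i)) \<le> M" if "(j, k, s) \<in> chain_indices p0 g r" for j k s
  proof -
    have "(\<lambda>(j, k, s). \<Sum>i\<in>UNIV. norm (\<psi> j k s $ i)) (j, k, s) \<le> M"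
      unfolding M_def by (rule member_le_sum[OF that _ finite_idx]) (auto intro: sum_nonneg)
    then show ?thesis by simp
  qed
  have "0 \<le> M" unfolding M_def by (intro sum_nonneg) (auto intro: sum_nonneg)
  (* Sums dominate the constants of all eigenvalues at once; the 1 keeps C positive even if all vanish. *)
  define C where "C = (\<Sum>j\<in>{1..p0}. Cj j) * M + 1"
  define P where "P = (\<Sum>j\<in>{1..p0}. 8 * \<nu> j + 13)"
  have sumC: "0 \<le> (\<Sum>j\<in>{1..p0}. Cj j)" by (intro sum_nonneg Cj)
  have norm_nonneg: "0 \<le> XN_norm t u" for t and u :: "real \<Rightarrow> complex ^ 'n"
    unfolding XN_norm_def by (intro real_sqrt_ge_zero sum_nonneg) simp
  show ?thesis
  proof (rule exI[of _ C], rule exI[of _ "real P"], rule exI[of _ "\<rho> / 2"], intro conjI ballI)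
    show "0 < C" using sumC \<open>0 \<le> M\<close> by (simp add: C_def add_nonneg_pos)
    fix u0 u1 :: "real \<Rightarrow> complex ^ 'n"
    assume u0: "u0 \<in> XN_space 3" and u1: "u1 \<in> XN_space 1"
    define c0 where "c0 j m k s = modal_coeff u0 (\<psi> j k s) m" for j m k s
    define c1 where "c1 j m k s = modal_coeff u1 (\<psi> j k s) m" for j m k s
    define \<zeta> where "\<zeta> j q m \<sigma> = target (c0 j m) (c1 j m) j m q \<sigma>" for j q m \<sigma>
    let ?E0 = "XN_norm 3 u0 + XN_norm 1 u1"
    have E: "norm (c0 j m k s) \<le> M * ?E0 \<and> norm (c1 j m k s) \<le> M * ?E0"
      if "j \<in> {1..p0}" "k \<in> {1..g j}" "s \<in> {1..r j k}" "1 \<le> m" for j k s m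
    proof -
      have idx: "(j, k, s) \<in> chain_indices p0 g r" using that by (simp add: chain_indices_def)
      have mono: "(\<Sum>i\<in>UNIV. norm (\<psi> j k s $ i)) * x \<le> M * ?E0" if "0 \<le> x" "x \<le> ?E0" for x
        using that M_ge[OF idx] \<open>0 \<le> M\<close> by (intro mult_mono) auto
      show ?thesis
        unfolding c0_def c1_def using norm_nonneg \<open>1 \<le> m\<close>
        by (intro conjI order.trans[OF modal_coeff_le_XN_norm[OF u0] mono]
            order.trans[OF modal_coeff_le_XN_norm[OF u1] mono]) auto
    qed
    show "\<exists>\<zeta> :: nat \<Rightarrow> nat \<Rightarrow> nat \<Rightarrow> root_label \<Rightarrow> complex ^ 'l.
        (\<forall>f f1 f2. H20_derivs T f f1 f2 \<longrightarrow>
          (\<forall>j\<in>{1..p0}. \<forall>m\<ge>1. \<forall>\<sigma>\<in>root_labels \<rho> (\<gamma> j) m.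
             \<forall>q<moment_count (max_block g r j) \<sigma>.
               (LINT t|lebesgue_on {0..T}.
                  moment_fun T (temporal_root \<rho> (\<gamma> j) m \<sigma>) q t *s (f2 t + \<gamma> j *s f t))
                 = \<zeta> j q m \<sigma>) \<longrightarrow>
          (\<forall>a a1 b b1.
             control_coeffs T \<rho> B p0 \<gamma> g r \<psi> f f2 a a1 \<longrightarrow>
             free_coeffs T \<rho> p0 \<gamma> g r \<psi> u0 u1 b b1 \<longrightarrow>
             (\<forall>j\<in>{1..p0}. \<forall>k\<in>{1..g j}. \<forall>s\<in>{1..r j k}. \<forall>m\<ge>1.
                a j k s m T = - b j k s m T \<and> a1 j k s m T = - b1 j k s m T))) \<and>
        (\<forall>j\<in>{1..p0}. \<forall>m\<ge>1. \<forall>\<sigma>\<in>root_labels \<rho> (\<gamma> j) m.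
           \<forall>q<moment_count (max_block g r j) \<sigma>.
             norm (\<zeta> j q m \<sigma>)
               \<le> C * (1 + real m) powr real P * exp (- (\<rho> / 2) * (real m)\<^sup>2 * T) * ?E0)"
    proof (intro exI[of _ \<zeta>] conjI allI impI ballI)
      fix f f1 f2 :: "real \<Rightarrow> complex ^ 'l"
        and a a1 b b1 :: "nat \<Rightarrow> nat \<Rightarrow> nat \<Rightarrow> nat \<Rightarrow> real \<Rightarrow> complex" and j k s m :: nat
      assume H: "H20_derivs T f f1 f2"
        and moments: "\<forall>j\<in>{1..p0}. \<forall>m\<ge>1. \<forall>\<sigma>\<in>root_labels \<rho> (\<gamma> j) m.
             \<forall>q<moment_count (max_block g r j) \<sigma>.
               (LINT t|lebesgue_on {0..T}.
                  moment_fun T (temporal_root \<rho> (\<gamma> j) m \<sigma>) q t *s (f2 t + \<gamma> j *s f t))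
                 = \<zeta> j q m \<sigma>"
        and control: "control_coeffs T \<rho> B p0 \<gamma> g r \<psi> f f2 a a1"
        and free: "free_coeffs T \<rho> p0 \<gamma> g r \<psi> u0 u1 b b1"
        and j: "j \<in> {1..p0}" and k: "k \<in> {1..g j}" and s: "s \<in> {1..r j k}" and m: "1 \<le> m"
      show "a j k s m T = - b j k s m T" "a1 j k s m T = - b1 j k s m T"
      proof -
        have control': "\<And>t. t \<in> {0..T} \<Longrightarrow> a j k 0 m t = 0"
          "\<And>s. s \<in> {1..r j k} \<Longrightarrow> modal_ivp T \<rho> (\<gamma> j) m
             (\<lambda>t. - a j k (s - 1) m t - of_real (lift_coeff m) *
                    (herm (f2 t + \<gamma> j *s f t) (\<beta> j k s) + herm (f t) (\<beta> j k (s - 1))))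
             0 0 (a j k s m) (a1 j k s m)"
          using control j k m unfolding control_coeffs_def Let_def \<beta>_def by blast+
        have free': "\<And>t. t \<in> {0..T} \<Longrightarrow> b j k 0 m t = 0"
          "\<And>s. s \<in> {1..r j k} \<Longrightarrow> modal_ivp T \<rho> (\<gamma> j) m (\<lambda>t. - b j k (s - 1) m t)
             (c0 j m k s) (c1 j m k s) (b j k s m) (b1 j k s m)"
          using free j k m unfolding free_coeffs_def c0_def c1_def by blast+
        have "a j k s m T = - b j k s m T \<and> a1 j k s m T = - b1 j k s m T"
        proof (rule terminal_conditions[where \<beta> = "\<beta> j" and d = "d j" and g = "g j" and r = "r j"
              and \<nu> = "\<nu> j" and ?c0.0 = "c0 j m" and ?c1.0 = "c1 j m" and k = k and m = m
              and a = "\<lambda>k s. a j k s m" and ?a1.0 = "\<lambda>k s. a1 j k s m"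
              and b = "\<lambda>k s. b j k s m" and ?b1.0 = "\<lambda>k s. b1 j k s m",
              OF _ m _ _ k \<beta>0[OF j k] r_le[OF k] H _ control'(1) free'(1) control'(2) free'(2) s])
          show "(LINT t|lebesgue_on {0..T}.
                  moment_fun T (temporal_root \<rho> (\<gamma> j) m \<sigma>) q t *s (f2 t + \<gamma> j *s f t))
              = moment_target T \<rho> (\<gamma> j) m (\<nu> j) (\<lambda>z. chain_solution (g j) (r j) (\<beta> j) (d j)
                  (\<lambda>k s. state_symbol \<rho> m (c0 j m k s) (c1 j m k s) z)) q \<sigma>"
            if "\<sigma> \<in> root_labels \<rho> (\<gamma> j) m" "q < moment_count (\<nu> j) \<sigma>" for \<sigma> q
            using moments j m that unfolding \<zeta>_def target_def \<nu>_def by blast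
        qed (use \<open>0 < T\<close> nonresonance j m d in auto)
        then show "a j k s m T = - b j k s m T" "a1 j k s m T = - b1 j k s m T" by auto
      qed
    next
      fix j m q :: nat and \<sigma>
      assume j: "j \<in> {1..p0}" and m: "1 \<le> m" and \<sigma>: "\<sigma> \<in> root_labels \<rho> (\<gamma> j) m"
        and q: "q < moment_count (max_block g r j) \<sigma>"
      have "0 \<le> ?E0" using norm_nonneg by (intro add_nonneg_nonneg)
      have "norm (\<zeta> j q m \<sigma>)
          \<le> Cj j * (1 + real m) ^ (8 * \<nu> j + 13) * exp (- (\<rho> / 2) * (real m)\<^sup>2 * T) * (M * ?E0)"
        unfolding \<zeta>_def using q E[OF j _ _ m] \<open>0 \<le> M\<close> \<open>0 \<le> ?E0\<close>
        by (intro Cj(2)[OF j m \<sigma>]) (auto simp: \<nu>_def)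
      also have "\<dots> = Cj j * M * (1 + real m) ^ (8 * \<nu> j + 13) * exp (- (\<rho> / 2) * (real m)\<^sup>2 * T) * ?E0"
        by (simp add: mult_ac)
      also have "\<dots> \<le> C * (1 + real m) powr real P * exp (- (\<rho> / 2) * (real m)\<^sup>2 * T) * ?E0"
      proof (intro mult_right_mono mult_mono)
        have "Cj j \<le> (\<Sum>j\<in>{1..p0}. Cj j)"
          using j Cj(1) by (intro member_le_sum) auto
        then have "Cj j * M \<le> (\<Sum>j\<in>{1..p0}. Cj j) * M"
          using \<open>0 \<le> M\<close> by (rule mult_right_mono)
        then show "Cj j * M \<le> C" by (simp add: C_def)
        have "8 * \<nu> j + 13 \<le> P"
          unfolding P_def using j by (intro member_le_sum) auto
        then have "(1 + real m) ^ (8 * \<nu> j + 13) \<le> (1 + real m) ^ P"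
          by (intro power_increasing) auto
        then show "(1 + real m) ^ (8 * \<nu> j + 13) \<le> (1 + real m) powr real P"
          by (simp add: powr_realpow)
        show "0 \<le> C" using sumC \<open>0 \<le> M\<close> by (simp add: C_def)
      qed (use \<open>0 \<le> ?E0\<close> in auto)
      finally show "norm (\<zeta> j q m \<sigma>)
          \<le> C * (1 + real m) powr real P * exp (- (\<rho> / 2) * (real m)\<^sup>2 * T) * ?E0" .
    qed
  qed (use \<open>0 < \<rho>\<close> in auto)
qed

end
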